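(* Fix $\beta>0$. Let $f:\mathbb{R}\to\mathbb{C}$ be measurable, $2\pi$-periodic, bounded, and $C^{2,q}$ in neighborhoods of $\frac{\pi}{2}$ and $-\frac{\pi}{2}$, with $0<q\le 1$. Let $M(f):=\sup_{\theta\in(-\pi,\pi]}\mathrm{Re}\, f(\theta)$ and assume that $$M(f)+\beta\log\cos(\tfrac{\pi}{16})<\min\{\mathrm{Re}\, f(\tfrac{\pi}{2}),\mathrm{Re}\, f(-\tfrac{\pi}{2})\}.$$ Then, for any fixed $0<\zeta<\min\{\frac14,\frac q2\}$, as $n\to\infty$, $$I(f)=2^{\beta\frac{n(n-1)}{2}-\frac12}\Big(\frac{8\pi}{\beta n}\Big)^{\frac n2}e^{1-\frac{1}{2\beta}}\bigg[e^{nf(\frac{\pi}{2})}\exp\bigg(\frac{f'(\frac{\pi}{2})^2}{\beta}+\frac{2f''(\frac{\pi}{2})}{\beta}+\mathcal{O}(n^{-\zeta})\bigg)+e^{nf(-\frac{\pi}{2})}\exp\bigg(\frac{f'(-\frac{\pi}{2})^2}{\beta}+\frac{2f''(-\frac{\pi}{2})}{\beta}+\mathcal{O}(n^{-\zeta})\bigg)\bigg].$$ Furthermore, if $\mathrm{Re}\, f\equiv 0$ and $t\in\mathbb{R}$, then the large $n$ asymptotics of $I(tf)$, given by $$I(tf)=2^{\beta\frac{n(n-1)}{2}-\frac12}\Big(\frac{8\pi}{\beta n}\Big)^{\frac n2}e^{1-\frac{1}{2\beta}}\bigg[e^{ntf(\frac{\pi}{2})}\exp\bigg(\frac{t^2f'(\frac{\pi}{2})^2}{\beta}+\frac{2tf''(\frac{\pi}{2})}{\beta}+\mathcal{O}(n^{-\zeta})\bigg)+e^{ntf(-\frac{\pi}{2})}\exp\bigg(\frac{t^2f'(-\frac{\pi}{2})^2}{\beta}+\frac{2tf''(-\frac{\pi}{2})}{\beta}+\mathcal{O}(n^{-\zeta})\bigg)\bigg],$$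 hold uniformly for $t$ in compact subsets of $\mathbb{R}$ (i.e. for each compact $\mathcal{K}\subset\mathbb{R}$ the two $\mathcal{O}(n^{-\zeta})$ terms are bounded by $C n^{-\zeta}$ for all $t\in\mathcal{K}$ and all large $n$, with $C$ independent of $t\in \mathcal{K}$).
   Context: For $\beta>0$, $n\in\mathbb{N}_{>0}$ and a $2\pi$-periodic function $f:\mathbb{R}\to\mathbb{C}$, $$I(f)=\int_{-\pi}^{\pi}\cdots\int_{-\pi}^{\pi}\prod_{1\le j<k\le n}|e^{i\theta_j}-e^{-i\theta_k}|^{\beta}\prod_{j=1}^n e^{f(\theta_j)}\,d\theta_j$$ (the dependence on $n$ and $\beta$ is suppressed from the notation). A function is $C^{2,q}$ in a neighborhood of a point if it is twice continuously differentiable there with $q$-Hölder continuous second derivative. The two $\mathcal{O}(n^{-\zeta})$ terms denote two (possibly different, complex-valued) sequences, each bounded in modulus by a constant times $n^{-\zeta}$ for all large $n$. *)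

theory Defs
  imports "HOL-Analysis.Analysis" "HOL-Library.Landau_Symbols"
begin

text \<open>\<open>f \<in> borel_measurable lebesgue\<close> suffices for the integrand to be measurable for this product
  measure; the completion of the product is not needed.\<close>

definition I_int :: "real \<Rightarrow> nat \<Rightarrow> (real \<Rightarrow> complex) \<Rightarrow> complex" where
  "I_int \<beta> n f =
     (LINT \<theta> | Pi\<^sub>M {1..n} (\<lambda>_. lebesgue_on {-pi..pi}).
        complex_of_real (\<Prod>j\<in>{1..n}. \<Prod>k\<in>{j<..n}. norm (cis (\<theta> j) - cis (- \<theta> k)) powr \<beta>)
        * (\<Prod>j\<in>{1..n}. exp (f (\<theta> j))))"

definition D1 :: "(real \<Rightarrow> complex) \<Rightarrow> real \<Rightarrow> complex" where
  "D1 f = (\<lambda>x. vector_derivative f (at x))"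

definition D2 :: "(real \<Rightarrow> complex) \<Rightarrow> real \<Rightarrow> complex" where
  "D2 f = D1 (D1 f)"

definition holder_on :: "real \<Rightarrow> real set \<Rightarrow> (real \<Rightarrow> complex) \<Rightarrow> bool" where
  "holder_on q U g \<longleftrightarrow> (\<exists>L. \<forall>x\<in>U. \<forall>y\<in>U. norm (g x - g y) \<le> L * \<bar>x - y\<bar> powr q)"

definition C2_holder_near :: "real \<Rightarrow> (real \<Rightarrow> complex) \<Rightarrow> real \<Rightarrow> bool" where
  "C2_holder_near q f x \<longleftrightarrow>
     (\<exists>U. open U \<and> x \<in> U \<and> f C1_differentiable_on U \<and> D1 f C1_differentiable_on U
        \<and> holder_on q U (D2 f))"

definition sup_Re :: "(real \<Rightarrow> complex) \<Rightarrow> real" where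
  "sup_Re f = (SUP \<theta>\<in>{-pi<..pi}. Re (f \<theta>))"

definition prefactor :: "real \<Rightarrow> nat \<Rightarrow> real" where
  "prefactor \<beta> n =
     2 powr (\<beta> * (real n * (real n - 1) / 2) - 1/2)
     * (8 * pi / (\<beta> * real n)) powr (real n / 2)
     * exp (1 - 1 / (2 * \<beta>))"

end

(*
  Writing x_j = theta_j - c with c = pi/2 or -pi/2, the kernel is |e^{i theta_j} - e^{-i theta_k}| = 2 |cos((x_j + x_k)/2)|,
  so it is maximal when all points sit at pi/2 or all sit at -pi/2.

  If all |x_j| are small, then ln cos u = -u^2/2 - u^4/12 + O(u^6) turns the integrand into the density of n independent
  Gaussians of variance 4/(beta n) times exp(-beta/8 S^2 + a S + Z), where S is the sum of the x_j, a = f'(c), and Z is a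
  polynomial in the power sums of the x_j. Those power sums concentrate, so that Z tends to 1 + 2 f''(c)/beta - 1/(2 beta),
  whereas S is exactly Gaussian of variance 4/beta and contributes 2^{-1/2} exp(a^2/beta).

  For the remaining configurations, |cos u| <= exp(-sin^2(u)/2) and the identity
  sum_{j,k} cos(x_j + x_k) = (sum_j cos x_j)^2 - (sum_j sin x_j)^2 bound the kernel by
  exp(-beta/8 (U (2n - U) - 4U)) with U = sum_j (1 - cos x_j). As U <= n for at least one of the two centers, a point that is
  far from this center costs a factor e^{-cn}. This part is absorbed into the larger of the two main terms.
*)
theory Submission
  imports Defs "HOL-Probability.Probability" "HOL-Real_Asymp.Real_Asymp"
begin

section \<open>Moments of Gaussian product measures\<close>

text \<open>The factor (8 pi / (\<beta> n))^(n/2) is of size n^(-n/2) up to exponentials, so a bound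
  for the remaining configurations must be sharp in each coordinate: a one-dimensional integral too
  large by a fixed factor would lose exponentially much. All constants are therefore kept up to
  e^eps, with eps small against the gain from a far point. Near a center \<open>f\<close> is complex
  and the neighborhood has a fixed radius, so the exponent is not uniformly close to its limit. The
  integrand is compared with its limit in mean, through one explicit nonnegative function of
  expectation O(n^(-q/2)), and a one-sided bound on the real part of the exponent takes care of
  large deviations. The rate is that of the Hoelder remainder: n coordinates of size n^(-1/2), each
  to the power 2 + q. The two main terms may nearly cancel, so an error relative to their sum is out
  of reach. Absolute errors are moved into each exponent separately, by a complex logarithm.\<close>

lemma product_first_moment:
  fixes h :: "'a \<Rightarrow> real"
  assumes "prob_space M" "finite I" "integrable M h"
  shows "integrable (Pi\<^sub>M I (\<lambda>_. M)) (\<lambda>\<omega>. \<Sum>i\<in>I. h (\<omega> i))"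
    and "(LINT \<omega>|Pi\<^sub>M I (\<lambda>_. M). (\<Sum>i\<in>I. h (\<omega> i))) = real (card I) * (LINT x|M. h x)"
proof -
  interpret M: prob_space M by fact
  interpret product_sigma_finite "\<lambda>_. M" by standard
  have eq: "h (\<omega> i) = (\<Prod>k\<in>I. (if k = i then h (\<omega> k) else 1))" if "i \<in> I" for i \<omega>
    using that assms(2) by simp
  have int: "integrable M (\<lambda>x. if k = i then h x else 1)" for k i :: 'b
    using assms(3) by (cases "k = i") auto
  have i1: "integrable (Pi\<^sub>M I (\<lambda>_. M)) (\<lambda>\<omega>. h (\<omega> i))" if "i \<in> I" for i
    unfolding eq[OF that] by (rule product_integrable_prod[OF assms(2)]) (rule int)
  have "(LINT \<omega>|Pi\<^sub>M I (\<lambda>_. M). h (\<omega> i)) = (LINT x|M. h x)" if "i \<in> I" for i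
  proof -
    have "(LINT \<omega>|Pi\<^sub>M I (\<lambda>_. M). h (\<omega> i)) = (\<Prod>k\<in>I. LINT x|M. (if k = i then h x else 1))"
      unfolding eq[OF that] by (rule product_integral_prod[OF assms(2)]) (rule int)
    also have "\<dots> = (\<Prod>k\<in>I. if k = i then LINT x|M. h x else 1)"
      by (intro prod.cong) (auto simp: M.prob_space)
    finally show ?thesis using that assms(2) by simp
  qed
  then show "(LINT \<omega>|Pi\<^sub>M I (\<lambda>_. M). (\<Sum>i\<in>I. h (\<omega> i))) = real (card I) * (LINT x|M. h x)"
    using i1 by (subst Bochner_Integration.integral_sum) auto
  show "integrable (Pi\<^sub>M I (\<lambda>_. M)) (\<lambda>\<omega>. \<Sum>i\<in>I. h (\<omega> i))"
    using i1 by auto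
qed

text \<open>Independence and mean zero kill the mixed terms, so the expectation of the square grows
  like \<open>card I\<close> and not like its square. This is the source of the concentration of the
  power sums.\<close>

lemma product_second_moment:
  fixes h :: "'a \<Rightarrow> real"
  assumes "prob_space M" "finite I" "integrable M h" "integrable M (\<lambda>x. (h x)\<^sup>2)"
    and zero: "(LINT x|M. h x) = 0"
  shows "integrable (Pi\<^sub>M I (\<lambda>_. M)) (\<lambda>\<omega>. (\<Sum>i\<in>I. h (\<omega> i))\<^sup>2)"
    and "(LINT \<omega>|Pi\<^sub>M I (\<lambda>_. M). (\<Sum>i\<in>I. h (\<omega> i))\<^sup>2) = real (card I) * (LINT x|M. (h x)\<^sup>2)"
proof -
  interpret M: prob_space M by fact
  interpret product_sigma_finite "\<lambda>_. M" by standard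
  \<comment> \<open>The product of two coordinates is written as a product over all coordinates. If
    \<open>i = j\<close>, both factors fall on the same coordinate and give the square, so diagonal
    and mixed terms share one definition.\<close>
  define F where "F i j k x = (if k = i then h x else 1) * (if k = j then h x else 1)" for i j k :: 'b and x
  have eq: "h (\<omega> i) * h (\<omega> j) = (\<Prod>k\<in>I. F i j k (\<omega> k))" if "i \<in> I" "j \<in> I" for i j \<omega>
    using that assms(2) by (simp add: F_def prod.distrib)
  have int: "integrable M (F i j k)" for i j k
    using assms(3,4) unfolding F_def by (cases "k = i"; cases "k = j") (auto simp: power2_eq_square)
  have i1: "integrable (Pi\<^sub>M I (\<lambda>_. M)) (\<lambda>\<omega>. h (\<omega> i) * h (\<omega> j))" if "i \<in> I" "j \<in> I" for i j
    unfolding eq[OF that] by (rule product_integrable_prod[OF assms(2)]) (rule int)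
  have i2: "(LINT \<omega>|Pi\<^sub>M I (\<lambda>_. M). h (\<omega> i) * h (\<omega> j)) = (if i = j then LINT x|M. (h x)\<^sup>2 else 0)"
    if "i \<in> I" "j \<in> I" for i j
  proof -
    have "(LINT \<omega>|Pi\<^sub>M I (\<lambda>_. M). h (\<omega> i) * h (\<omega> j)) = (\<Prod>k\<in>I. LINT x|M. F i j k x)"
      unfolding eq[OF that] by (rule product_integral_prod[OF assms(2)]) (rule int)
    also have "\<dots> = (if i = j then LINT x|M. (h x)\<^sup>2 else 0)"
    proof (cases "i = j")
      case True
      have "(\<Prod>k\<in>I. LINT x|M. F i j k x) = (\<Prod>k\<in>I. if k = i then LINT x|M. (h x)\<^sup>2 else 1)"
        using True by (intro prod.cong) (auto simp: F_def M.prob_space power2_eq_square)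
      then show ?thesis using that True assms(2) by simp
    next
      case False
      then have "(LINT x|M. F i j i x) = 0" by (simp add: F_def zero)
      then show ?thesis using that assms(2) False by (auto intro!: prod_zero)
    qed
    finally show ?thesis .
  qed
  have sq: "(\<Sum>i\<in>I. h (\<omega> i))\<^sup>2 = (\<Sum>i\<in>I. \<Sum>j\<in>I. h (\<omega> i) * h (\<omega> j))" for \<omega>
    by (simp add: power2_eq_square sum_product)
  show "integrable (Pi\<^sub>M I (\<lambda>_. M)) (\<lambda>\<omega>. (\<Sum>i\<in>I. h (\<omega> i))\<^sup>2)"
    unfolding sq using i1 by auto
  show "(LINT \<omega>|Pi\<^sub>M I (\<lambda>_. M). (\<Sum>i\<in>I. h (\<omega> i))\<^sup>2) = real (card I) * (LINT x|M. (h x)\<^sup>2)"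
    unfolding sq using i1 assms(2) by (simp add: Bochner_Integration.integral_sum i2 cong: sum.cong)
qed

text \<open>The carrier \<sigma>-algebra is that of Lebesgue measure, because the function in the theorem is only Lebesgue measurable.\<close>

definition gauss :: "real \<Rightarrow> real \<Rightarrow> real measure" where
  "gauss c s = density lebesgue (\<lambda>x. ennreal (normal_density c s x))"

lemma sets_gauss [simp, measurable_cong]: "sets (gauss c s) = sets lebesgue"
  by (simp add: gauss_def)

lemma space_gauss [simp]: "space (gauss c s) = UNIV"
  by (simp add: gauss_def)

lemma borel_measurable_gauss: "g \<in> borel_measurable borel \<Longrightarrow> g \<in> borel_measurable (gauss c s)"
  by (simp add: gauss_def measurable_completion)

text \<open>A Borel function has the same integral for Lebesgue measure and for its restriction to
  Borel sets, so known moments of the normal density carry over to \<open>gauss\<close>.\<close>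

lemma has_bochner_integral_gauss:
  fixes g :: "real \<Rightarrow> real"
  assumes [measurable]: "g \<in> borel_measurable borel"
    and "has_bochner_integral lborel (\<lambda>x. normal_density c s x * g x) r"
  shows "integrable (gauss c s) g" "(LINT x|gauss c s. g x) = r"
proof -
  have m: "(\<lambda>x. normal_density c s x) \<in> borel_measurable lebesgue" "g \<in> borel_measurable lebesgue"
    by (simp_all add: measurable_completion)
  have *: "(\<lambda>x. normal_density c s x * g x) \<in> borel_measurable lborel" by simp
  show "integrable (gauss c s) g"
    using assms(2) * m unfolding gauss_def
    by (subst integrable_density) (auto simp: integrable_completion has_bochner_integral_iff)
  show "(LINT x|gauss c s. g x) = r"
    using assms(2) * m unfolding gauss_def
    by (subst integral_density) (auto simp: integral_completion has_bochner_integral_iff)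
qed

lemma emeasure_gauss:
  assumes "A \<in> sets borel"
  shows "emeasure (gauss c s) A = emeasure (density lborel (normal_density c s)) A"
proof -
  have "emeasure (gauss c s) A = (\<integral>\<^sup>+x. ennreal (normal_density c s x) * indicator A x \<partial>lebesgue)"
    unfolding gauss_def using assms by (subst emeasure_density) (auto simp: measurable_completion)
  also have "\<dots> = emeasure (density lborel (normal_density c s)) A"
    using assms by (subst emeasure_density) (auto simp: nn_integral_completion)
  finally show ?thesis .
qed

abbreviation gauss_pow :: "real \<Rightarrow> real \<Rightarrow> nat \<Rightarrow> (nat \<Rightarrow> real) measure" where
  "gauss_pow c s n \<equiv> Pi\<^sub>M {1..n} (\<lambda>_. gauss c s)"

abbreviation leb_pow :: "nat \<Rightarrow> (nat \<Rightarrow> real) measure" where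
  "leb_pow n \<equiv> Pi\<^sub>M {1..n} (\<lambda>_. lebesgue)"

abbreviation cube :: "nat \<Rightarrow> (nat \<Rightarrow> real) measure" where
  "cube n \<equiv> Pi\<^sub>M {1..n} (\<lambda>_. lebesgue_on {-pi..pi})"

text \<open>The integral of exp (- \<beta> n |x|^2 / 8) over n-dimensional space, which is the
  reciprocal of the normalizing factor of the Gaussian product of variance 4 / (\<beta> n).\<close>

abbreviation gauss_volume :: "real \<Rightarrow> nat \<Rightarrow> real" where
  "gauss_volume \<beta> n \<equiv> (8 * pi / (\<beta> * real n)) powr (real n / 2)"

lemma distr_gauss: "distr (gauss c s) borel (\<lambda>x. x) = density lborel (normal_density c s)"
  by (rule measure_eqI) (auto simp: emeasure_distr emeasure_gauss borel_measurable_gauss)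

lemma prob_space_gauss: "s > 0 \<Longrightarrow> prob_space (gauss c s)"
  using prob_space_normal_density[of s c] emeasure_gauss[of UNIV c s]
  by (intro prob_spaceI) (auto dest: prob_space.emeasure_space_1)

text \<open>The moment of order 2 k of a centered normal variable, (2 k - 1)!! s^(2 k), in the shape
  in which \<open>normal_moment_even\<close> states it.\<close>

definition gaussian_moment :: "nat \<Rightarrow> real \<Rightarrow> real" where
  "gaussian_moment k s = fact (2 * k) / ((2 / s\<^sup>2) ^ k * fact k)"

lemma gaussian_moment_simps:
  "s > 0 \<Longrightarrow> gaussian_moment (Suc 0) s = s^2" "s > 0 \<Longrightarrow> gaussian_moment 2 s = 3 * s^4" "s > 0 \<Longrightarrow> gaussian_moment 3 s = 15 * s^6"
  "s > 0 \<Longrightarrow> gaussian_moment 4 s = 105 * s^8"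
  by (simp_all add: gaussian_moment_def fact_numeral field_simps power_mult[symmetric])

lemma gauss_moments:
  assumes "s > 0"
  shows "integrable (gauss c s) (\<lambda>x. (x - c) ^ (2*k))" "(LINT x|gauss c s. (x - c) ^ (2*k)) = gaussian_moment k s"
    "integrable (gauss c s) (\<lambda>x. (x - c) ^ (2*k+1))" "(LINT x|gauss c s. (x - c) ^ (2*k+1)) = 0"
  using has_bochner_integral_gauss[OF _ normal_moment_even[OF assms, of c k]]
    has_bochner_integral_gauss[OF _ normal_moment_odd[OF assms, of c k]]
  by (auto simp: gaussian_moment_def)

section \<open>Change of measure from the cube to the Gaussian product\<close>

lemma
  fixes S :: "real set"
  assumes S: "S \<in> lmeasurable" and [simp]: "finite I" and s: "s > 0"
  shows distr_PiM_lebesgue_on: "distr (Pi\<^sub>M I (\<lambda>_. lebesgue_on S)) (Pi\<^sub>M I (\<lambda>_. lebesgue)) (\<lambda>\<omega>. \<omega>) =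
    density (Pi\<^sub>M I (\<lambda>_. gauss c s)) (\<lambda>\<omega>. ennreal (\<Prod>i\<in>I. indicator S (\<omega> i) / normal_density c s (\<omega> i)))"
    (is "?L = ?R")
    and measurable_id_PiM_lebesgue_on: "(\<lambda>\<omega>. \<omega>) \<in> Pi\<^sub>M I (\<lambda>_. lebesgue_on S) \<rightarrow>\<^sub>M Pi\<^sub>M I (\<lambda>_. lebesgue)"
proof -
  \<comment> \<open>Both sides are the product of copies of \<open>N\<close>; since \<open>N\<close>
    is finite, it suffices to compare them on boxes. The pushforward is there because points of the
    cube have coordinates in \<open>S\<close> only, whereas the Gaussian product lives on the full
    space.\<close>
  define N where "N = density lebesgue (indicator S)"
  have Sm[measurable]: "S \<in> sets lebesgue" using S by (rule fmeasurableD)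
  have eN: "emeasure N A = emeasure lebesgue (A \<inter> S)" if "A \<in> sets lebesgue" for A
    unfolding N_def using that by (subst emeasure_density) (auto simp: indicator_inter_arith[symmetric] Int_commute)
  have "emeasure N (space N) \<noteq> \<infinity>"
    using eN[of UNIV] S by (simp add: N_def fmeasurable_def less_top)
  then interpret N: finite_measure N by (rule finite_measureI)
  interpret PN: product_sigma_finite "\<lambda>_. N" by standard
  interpret SF: finite_measure "lebesgue_on S" by (rule finite_measure_lebesgue_on[OF S])
  interpret PS: product_sigma_finite "\<lambda>_. lebesgue_on S" by standard
  interpret G: prob_space "gauss c s" by (rule prob_space_gauss[OF s])
  interpret PG: product_sigma_finite "\<lambda>_. gauss c s" by standard
  have idm: "(\<lambda>x. x) \<in> lebesgue_on S \<rightarrow>\<^sub>M lebesgue"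
    by (rule measurable_restrict_space1) simp
  have cm: "(\<lambda>\<omega>. \<omega> i) \<in> Pi\<^sub>M I (\<lambda>_. lebesgue_on S) \<rightarrow>\<^sub>M lebesgue" if "i \<in> I" for i
    using measurable_comp[OF measurable_component_singleton[OF that] idm] by (simp add: comp_def)
  show idP: "(\<lambda>\<omega>. \<omega>) \<in> Pi\<^sub>M I (\<lambda>_. lebesgue_on S) \<rightarrow>\<^sub>M Pi\<^sub>M I (\<lambda>_. lebesgue)"
    by (rule measurable_PiM_single'[where f="\<lambda>i \<omega>. \<omega> i"])
      (auto simp: space_PiM PiE_iff intro: cm)
  have sN: "sets N = sets lebesgue" by (simp add: N_def)
  have "?L = Pi\<^sub>M I (\<lambda>_. N)"
  proof (rule PN.PiM_eqI)
    show "sets ?L = sets (Pi\<^sub>M I (\<lambda>_. N))" by (auto simp: N_def intro!: sets_PiM_cong)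
    fix A assume A: "\<And>i. i \<in> I \<Longrightarrow> A i \<in> sets N"
    have A': "A i \<in> sets lebesgue" if "i \<in> I" for i using A[OF that] by (simp add: N_def)
    have "emeasure ?L (Pi\<^sub>E I A) = emeasure (Pi\<^sub>M I (\<lambda>_. lebesgue_on S)) (Pi\<^sub>E I A \<inter> space (Pi\<^sub>M I (\<lambda>_. lebesgue_on S)))"
      using A' by (subst emeasure_distr[OF idP]) (auto intro!: sets_PiM_I_finite)
    also have "Pi\<^sub>E I A \<inter> space (Pi\<^sub>M I (\<lambda>_. lebesgue_on S)) = Pi\<^sub>E I (\<lambda>i. A i \<inter> S)"
      by (auto simp: space_PiM PiE_iff)
    also have "emeasure (Pi\<^sub>M I (\<lambda>_. lebesgue_on S)) \<dots> = (\<Prod>i\<in>I. emeasure (lebesgue_on S) (A i \<inter> S))"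
      using A' by (intro PS.emeasure_PiM) (auto simp: sets_restrict_space)
    also have "\<dots> = (\<Prod>i\<in>I. emeasure N (A i))"
      using A' by (intro prod.cong) (auto simp: eN emeasure_restrict_space)
    finally show "emeasure ?L (Pi\<^sub>E I A) = (\<Prod>i\<in>I. emeasure N (A i))" .
  qed simp
  also have "Pi\<^sub>M I (\<lambda>_. N) = ?R"
  proof (rule PN.PiM_eqI[symmetric])
    show "sets ?R = sets (Pi\<^sub>M I (\<lambda>_. N))" by (auto simp: N_def intro!: sets_PiM_cong)
    fix A assume A: "\<And>i. i \<in> I \<Longrightarrow> A i \<in> sets N"
    have A': "A i \<in> sets lebesgue" if "i \<in> I" for i using A[OF that] by (simp add: N_def)
    define h where "h i x = ennreal (indicator S x / normal_density c s x) * indicator (A i) x" for i and x :: real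
    have nd[measurable]: "normal_density c s \<in> borel_measurable lebesgue"
      by (simp add: measurable_completion)
    have [measurable]: "(\<lambda>x. indicator S x / normal_density c s x) \<in> borel_measurable lebesgue"
      by measurable
    have hm: "h i \<in> borel_measurable (gauss c s)" if "i \<in> I" for i
      using A'[OF that] unfolding h_def by (measurable)
    have "emeasure ?R (Pi\<^sub>E I A) = (\<integral>\<^sup>+\<omega>. ennreal (\<Prod>i\<in>I. indicator S (\<omega> i) / normal_density c s (\<omega> i)) * indicator (Pi\<^sub>E I A) \<omega> \<partial>Pi\<^sub>M I (\<lambda>_. gauss c s))"
      using A' by (intro emeasure_density) (auto intro!: sets_PiM_I_finite)
    also have "\<dots> = (\<integral>\<^sup>+\<omega>. (\<Prod>i\<in>I. h i (\<omega> i)) \<partial>Pi\<^sub>M I (\<lambda>_. gauss c s))"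
    proof (rule nn_integral_cong)
      fix \<omega> assume "\<omega> \<in> space (Pi\<^sub>M I (\<lambda>_. gauss c s))"
      then have "indicator (Pi\<^sub>E I A) \<omega> = (\<Prod>i\<in>I. indicator (A i) (\<omega> i) :: ennreal)"
        by (auto simp: space_PiM PiE_iff indicator_def intro!: prod_zero split: if_splits)
      then show "ennreal (\<Prod>i\<in>I. indicator S (\<omega> i) / normal_density c s (\<omega> i)) * indicator (Pi\<^sub>E I A) \<omega> = (\<Prod>i\<in>I. h i (\<omega> i))"
        by (simp add: h_def prod.distrib prod_ennreal[symmetric])
    qed
    also have "\<dots> = (\<Prod>i\<in>I. integral\<^sup>N (gauss c s) (h i))"
      by (rule PG.product_nn_integral_prod) (auto intro: hm)
    also have "\<dots> = (\<Prod>i\<in>I. emeasure N (A i))"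
    proof (rule prod.cong[OF refl])
      fix i assume i: "i \<in> I"
      have "integral\<^sup>N (gauss c s) (h i) = (\<integral>\<^sup>+x. ennreal (normal_density c s x) * h i x \<partial>lebesgue)"
        unfolding gauss_def using hm[OF i] by (intro nn_integral_density) (auto cong: measurable_cong_sets intro: measurable_compose[OF nd])
      also have "\<dots> = (\<integral>\<^sup>+x. indicator (A i \<inter> S) x \<partial>lebesgue)"
      proof (rule nn_integral_cong)
        fix x
        have p: "normal_density c s x > 0" using s by (rule normal_density_pos)
        then have "ennreal (normal_density c s x) * ennreal (indicator S x / normal_density c s x) = indicator S x"
          by (simp add: ennreal_mult[symmetric] ennreal_indicator)
        then show "ennreal (normal_density c s x) * h i x = indicator (A i \<inter> S) x"
          unfolding h_def by (metis (no_types) indicator_inter_arith mult.assoc mult.commute)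
      qed
      also have "\<dots> = emeasure N (A i)" using A'[OF i] by (simp add: eN)
      finally show "integral\<^sup>N (gauss c s) (h i) = emeasure N (A i)" .
    qed
    finally show "emeasure ?R (Pi\<^sub>E I A) = (\<Prod>i\<in>I. emeasure N (A i))" .
  qed simp
  finally show "?L = ?R" .
qed

text \<open>The normal density is positive everywhere, so the indicator of \<open>S\<close> divided
  by it is the density of Lebesgue measure on \<open>S\<close> with respect to
  \<open>gauss c s\<close>. Integrals over the cube thus become Gaussian expectations.\<close>

lemma integral_PiM_lebesgue_on:
  fixes F :: "('i \<Rightarrow> real) \<Rightarrow> complex"
  assumes S: "S \<in> lmeasurable" and [simp]: "finite I" and s: "s > 0"
    and F: "F \<in> borel_measurable (Pi\<^sub>M I (\<lambda>_. lebesgue))"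
  shows "(LINT \<theta>|Pi\<^sub>M I (\<lambda>_. lebesgue_on S). F \<theta>) =
    (LINT \<theta>|Pi\<^sub>M I (\<lambda>_. gauss c s). (\<Prod>i\<in>I. indicator S (\<theta> i) / normal_density c s (\<theta> i)) *\<^sub>R F \<theta>)"
proof -
  have [measurable]: "S \<in> sets lebesgue" using S by (rule fmeasurableD)
  have [measurable]: "(\<lambda>x. indicator S x / normal_density c s x) \<in> borel_measurable lebesgue"
    by (intro borel_measurable_divide) (auto simp: measurable_completion)
  have "sets (Pi\<^sub>M I (\<lambda>_. lebesgue)) = sets (Pi\<^sub>M I (\<lambda>_. gauss c s))"
    by (auto intro!: sets_PiM_cong)
  then have F': "F \<in> borel_measurable (Pi\<^sub>M I (\<lambda>_. gauss c s))"
    using F measurable_cong_sets by blast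
  have "(LINT \<theta>|Pi\<^sub>M I (\<lambda>_. lebesgue_on S). F \<theta>) = (LINT \<theta>|distr (Pi\<^sub>M I (\<lambda>_. lebesgue_on S)) (Pi\<^sub>M I (\<lambda>_. lebesgue)) (\<lambda>\<omega>. \<omega>). F \<theta>)"
    by (rule integral_distr[symmetric]) (auto intro: F measurable_id_PiM_lebesgue_on[OF S _ s])
  also have "\<dots> = (LINT \<theta>|Pi\<^sub>M I (\<lambda>_. gauss c s). (\<Prod>i\<in>I. indicator S (\<theta> i) / normal_density c s (\<theta> i)) *\<^sub>R F \<theta>)"
    unfolding distr_PiM_lebesgue_on[OF S \<open>finite I\<close> s, where c=c]
    by (rule integral_density) (auto simp: F' intro!: AE_I2 prod_nonneg divide_nonneg_nonneg borel_measurable_prod)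
  finally show ?thesis .
qed

text \<open>Coordinates of a product measure are independent, and independent normal variables add
  up to a normal one. For n coordinates of variance 4 / (\<beta> n) the variance of the sum does not
  shrink with n, so the exact law is required and not just a moment bound.\<close>

lemma distributed_sum_gauss:
  assumes "finite I" "I \<noteq> {}" and s: "s > 0"
  shows "distributed (Pi\<^sub>M I (\<lambda>_. gauss c s)) lborel (\<lambda>\<omega>. \<Sum>i\<in>I. \<omega> i - c)
    (normal_density 0 (sqrt (real (card I)) * s))"
proof -
  interpret G: prob_space "gauss c s" by (rule prob_space_gauss[OF s])
  interpret P: product_prob_space "\<lambda>_. gauss c s" I by unfold_locales
  let ?P = "Pi\<^sub>M I (\<lambda>_. gauss c s)"
  have comp: "distr ?P (gauss c s) (\<lambda>\<omega>. \<omega> i) = gauss c s" if "i \<in> I" for i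
    using P.PiM_component[OF that] .
  have "distr ?P (Pi\<^sub>M I (\<lambda>_. gauss c s)) (\<lambda>x. \<lambda>i\<in>I. x i) = distr ?P ?P (\<lambda>x. x)"
    by (rule distr_cong) (auto simp: space_PiM)
  then have "P.indep_vars (\<lambda>_. gauss c s) (\<lambda>i \<omega>. \<omega> i) I"
    using assms(2) comp by (subst P.indep_vars_iff_distr_eq_PiM') (auto simp: distr_id2 intro!: PiM_cong)
  then have ind: "P.indep_vars (\<lambda>_. borel) (\<lambda>i \<omega>. \<omega> i - c) I"
    by (rule P.indep_vars_compose2) (auto simp: borel_measurable_gauss)
  have dist: "distributed ?P lborel (\<lambda>\<omega>. \<omega> i - c) (normal_density 0 s)" if i: "i \<in> I" for i
  proof -
    have mi: "(\<lambda>\<omega>. \<omega> i) \<in> ?P \<rightarrow>\<^sub>M gauss c s" using i by (rule measurable_component_singleton)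
    have "distr ?P borel (\<lambda>\<omega>. \<omega> i) = distr (distr ?P (gauss c s) (\<lambda>\<omega>. \<omega> i)) borel (\<lambda>x. x)"
      by (subst distr_distr[OF _ mi]) (auto simp: borel_measurable_gauss comp_def)
    also have "\<dots> = density lborel (normal_density c s)" by (simp add: comp[OF i] distr_gauss)
    finally have d: "distr ?P lborel (\<lambda>\<omega>. \<omega> i) = density lborel (normal_density c s)"
      by (simp cong: distr_cong)
    have "(\<lambda>\<omega>. \<omega> i) \<in> ?P \<rightarrow>\<^sub>M lborel"
      using measurable_comp[OF mi, of "\<lambda>x. x" borel] by (simp add: comp_def borel_measurable_gauss)
    then have "distributed ?P lborel (\<lambda>\<omega>. \<omega> i) (normal_density c s)"
      using d by (simp add: distributed_def)
    from P.normal_density_affine[OF this s, of 1 "-c"] show ?thesis by simp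
  qed
  have "distributed ?P lborel (\<lambda>\<omega>. \<Sum>i\<in>I. \<omega> i - c) (normal_density (\<Sum>i\<in>I. 0) (sqrt (\<Sum>i\<in>I. s\<^sup>2)))"
    using assms dist by (intro P.sum_indep_normal ind) auto
  then show ?thesis using s by (simp add: real_sqrt_mult)
qed

section \<open>Gaussian integrals with a complex linear term in the exponent\<close>

lemma normal_density_shift_exp:
  assumes "s > 0"
  shows "normal_density 0 s x * exp (p * x) = exp (p\<^sup>2 * s\<^sup>2 / 2) * normal_density (p * s\<^sup>2) s x"
proof -
  have "- x\<^sup>2 / (2 * s\<^sup>2) + p * x = p\<^sup>2 * s\<^sup>2 / 2 + - (x - p * s\<^sup>2)\<^sup>2 / (2 * s\<^sup>2)"
    using assms by (simp add: field_simps power2_eq_square)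
  then have "exp (- x\<^sup>2 / (2 * s\<^sup>2)) * exp (p * x) = exp (p\<^sup>2 * s\<^sup>2 / 2) * exp (- (x - p * s\<^sup>2)\<^sup>2 / (2 * s\<^sup>2))"
    by (simp only: exp_add[symmetric])
  then show ?thesis by (simp add: normal_density_def)
qed

lemma normal_density_std:
  "s > 0 \<Longrightarrow> s * normal_density m s (m + s * y) = std_normal_density y"
  by (simp add: normal_density_def real_sqrt_mult power_mult_distrib)

text \<open>The substitution x = m + s y reduces this to the characteristic function of the standard
  normal distribution.\<close>

lemma integral_normal_density_iexp:
  assumes s: "s > 0"
  shows "(LINT x|lborel. normal_density m s x *\<^sub>R iexp (q * x)) = exp (\<i> * (q * m) - q\<^sup>2 * s\<^sup>2 / 2)"
proof -
  have "(LINT x|lborel. normal_density m s x *\<^sub>R iexp (q * x)) =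
      s *\<^sub>R (LINT y|lborel. normal_density m s (m + s * y) *\<^sub>R iexp (q * (m + s * y)))"
    using s lborel_integral_real_affine[of s "\<lambda>x. normal_density m s x *\<^sub>R iexp (q * x)" m] by simp
  also have "\<dots> = (LINT y|lborel. iexp (q * m) * (std_normal_density y *\<^sub>R iexp ((q * s) * y)))"
    unfolding integral_scaleR_right[symmetric]
  proof (rule Bochner_Integration.integral_cong[OF refl])
    fix y
    have "iexp (q * (m + s * y)) = iexp (q * m) * iexp ((q * s) * y)"
      by (simp add: exp_add[symmetric] algebra_simps)
    then show "s *\<^sub>R (normal_density m s (m + s * y) *\<^sub>R iexp (q * (m + s * y))) =
      iexp (q * m) * (std_normal_density y *\<^sub>R iexp ((q * s) * y))"
      unfolding normal_density_std[OF s, of m, symmetric] by (simp add: scaleR_conv_of_real)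
  qed
  also have "\<dots> = iexp (q * m) * (LINT y|lborel. std_normal_density y *\<^sub>R iexp ((q * s) * y))"
    by (rule integral_mult_right_zero)
  also have "(LINT y|lborel. std_normal_density y *\<^sub>R iexp ((q * s) * y)) = char std_normal_distribution (q * s)"
    unfolding char_def by (subst integral_density) auto
  also have "\<dots> = exp (- (of_real (q * s))\<^sup>2 / 2)"
    by (simp add: char_std_normal_distribution exp_of_real[symmetric])
  finally show ?thesis by (simp add: exp_add[symmetric] power_mult_distrib)
qed

text \<open>For a = p + i q, completing the square turns p into a shift of the mean to p s^2; the
  characteristic function at that mean accounts for q, and the exponents recombine to a^2 s^2 /
  2.\<close>

lemma integral_normal_density_exp:
  fixes a :: complex
  assumes s: "s > 0"
  shows "(LINT x|lborel. normal_density 0 s x *\<^sub>R exp (a * x)) = exp (a\<^sup>2 * s\<^sup>2 / 2)"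
proof -
  define p q where "p = Re a" and "q = Im a"
  have a: "a = p + \<i> * q" by (simp add: p_def q_def complex_eq)
  have "normal_density 0 s x *\<^sub>R exp (a * x) = exp (p\<^sup>2 * s\<^sup>2 / 2) *\<^sub>R (normal_density (p * s\<^sup>2) s x *\<^sub>R iexp (q * x))" for x
  proof -
    have "exp (a * x) = of_real (exp (p * x)) * iexp (q * x)"
      by (simp add: a exp_add[symmetric] exp_of_real[symmetric] algebra_simps)
    then have "normal_density 0 s x *\<^sub>R exp (a * x) = of_real (normal_density 0 s x * exp (p * x)) * iexp (q * x)"
      by (simp add: scaleR_conv_of_real)
    then show ?thesis unfolding normal_density_shift_exp[OF s] by (simp add: scaleR_conv_of_real)
  qed
  then have "(LINT x|lborel. normal_density 0 s x *\<^sub>R exp (a * x)) =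
      exp (p\<^sup>2 * s\<^sup>2 / 2) *\<^sub>R exp (\<i> * (q * (p * s\<^sup>2)) - q\<^sup>2 * s\<^sup>2 / 2)"
    using integral_normal_density_iexp[OF s, of "p * s\<^sup>2" q] by (simp only: integral_scaleR_right)
  also have "\<dots> = exp (of_real (p\<^sup>2 * s\<^sup>2 / 2) + (\<i> * (q * (p * s\<^sup>2)) - q\<^sup>2 * s\<^sup>2 / 2))"
    by (simp add: scaleR_conv_of_real exp_add exp_of_real[symmetric])
  also have "of_real (p\<^sup>2 * s\<^sup>2 / 2) + (\<i> * (q * (p * s\<^sup>2)) - q\<^sup>2 * s\<^sup>2 / 2) = a\<^sup>2 * s\<^sup>2 / 2"
    by (simp add: a power2_eq_square algebra_simps)
  finally show ?thesis .
qed

text \<open>The density of variance 4 / b and the factor exp (- b x^2 / 8) have the same exponent.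
  Their product is the density of variance 2 / b times the ratio 2 powr (-1/2) of the standard
  deviations, and a^2 s^2 / 2 becomes a^2 / b for s^2 = 2 / b.\<close>

lemma integral_normal_density_gaussian_exp:
  fixes a :: complex
  assumes b: "b > 0"
  shows "(LINT x|lborel. normal_density 0 (2 / sqrt b) x *\<^sub>R exp (of_real (- b / 8 * x\<^sup>2) + a * x)) =
    of_real (2 powr (-1/2)) * exp (a\<^sup>2 / b)"
proof -
  have e: "normal_density 0 (2 / sqrt b) x * exp (- b / 8 * x\<^sup>2) = 2 powr (-1/2) * normal_density 0 (sqrt (2 / b)) x" for x
  proof -
    have "exp (- (x\<^sup>2 * b / 8)) * exp (- (b * x\<^sup>2 / 8)) = exp (- (x\<^sup>2 * b / 4))"
      by (simp add: exp_add[symmetric])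
    moreover have "sqrt (8 * pi / b) = sqrt 2 * sqrt (4 * pi / b)"
      by (simp flip: real_sqrt_mult)
    moreover have "2 powr (-1/2) = 1 / sqrt 2" by (simp add: powr_minus_divide powr_half_sqrt)
    ultimately show ?thesis using b
      by (simp add: normal_density_def power_divide field_simps real_sqrt_mult real_sqrt_divide)
  qed
  have "normal_density 0 (2 / sqrt b) x *\<^sub>R exp (of_real (- b / 8 * x\<^sup>2) + a * x) =
      (2 powr (-1/2)) *\<^sub>R (normal_density 0 (sqrt (2 / b)) x *\<^sub>R exp (a * x))" for x
    unfolding exp_add exp_of_real scaleR_scaleR e[of x, symmetric]
    by (simp only: scaleR_conv_of_real of_real_mult mult.assoc)
  then have "(LINT x|lborel. normal_density 0 (2 / sqrt b) x *\<^sub>R exp (of_real (- b / 8 * x\<^sup>2) + a * x)) =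
      (2 powr (-1/2)) *\<^sub>R (LINT x|lborel. normal_density 0 (sqrt (2 / b)) x *\<^sub>R exp (a * x))"
    by (simp only: integral_scaleR_right)
  moreover have "(complex_of_real (sqrt (2 / b)))\<^sup>2 = 2 / of_real b"
    using b by (simp flip: of_real_power)
  ultimately show ?thesis using b
    using integral_normal_density_exp[of "sqrt (2 / b)" a] by (simp add: scaleR_conv_of_real)
qed

section \<open>The interaction kernel and local expansions\<close>

lemma sum_pairs_symmetric:
  fixes s :: "nat \<Rightarrow> nat \<Rightarrow> real"
  assumes "\<And>j k. s j k = s k j"
  shows "2 * (\<Sum>j\<in>{1..n}. \<Sum>k\<in>{j<..n}. s j k) = (\<Sum>j\<in>{1..n}. \<Sum>k\<in>{1..n}. s j k) - (\<Sum>j\<in>{1..n}. s j j)"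
proof (induction n)
  case (Suc n)
  have "(\<Sum>j\<in>{1..Suc n}. \<Sum>k\<in>{j<..Suc n}. s j k) = (\<Sum>j\<in>{1..n}. \<Sum>k\<in>insert (Suc n) {j<..n}. s j k)"
  proof -
    have "{j<..Suc n} = insert (Suc n) {j<..n}" if "j \<in> {1..n}" for j using that by auto
    then show ?thesis by simp
  qed
  also have "\<dots> = (\<Sum>j\<in>{1..n}. s j (Suc n)) + (\<Sum>j\<in>{1..n}. \<Sum>k\<in>{j<..n}. s j k)"
    by (simp add: sum.distrib)
  finally have "(\<Sum>j\<in>{1..Suc n}. \<Sum>k\<in>{j<..Suc n}. s j k) = (\<Sum>j\<in>{1..n}. s j (Suc n)) + (\<Sum>j\<in>{1..n}. \<Sum>k\<in>{j<..n}. s j k)" .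
  moreover have "(\<Sum>j\<in>{1..n}. s (Suc n) j) = (\<Sum>j\<in>{1..n}. s j (Suc n))"
    by (intro sum.cong refl assms)
  ultimately show ?case using Suc by (simp add: sum.distrib)
qed simp

text \<open>The full double sum is 2 n times the sum of squares plus twice the square of the sum.
  Removing the diagonal, whose terms are 4 x_j^2, and halving leaves the coefficient n - 2.\<close>

lemma sum_pairs_square:
  fixes x :: "nat \<Rightarrow> real"
  shows "(\<Sum>j\<in>{1..n}. \<Sum>k\<in>{j<..n}. (x j + x k)^2) = (real n - 2) * (\<Sum>j\<in>{1..n}. x j ^ 2) + (\<Sum>j\<in>{1..n}. x j)^2"
proof -
  have "(\<Sum>j\<in>{1..n}. \<Sum>k\<in>{1..n}. (x j + x k)^2) =
      (\<Sum>j\<in>{1..n}. real n * x j ^ 2 + 2 * (x j * (\<Sum>k\<in>{1..n}. x k)) + (\<Sum>k\<in>{1..n}. x k ^ 2))"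
    by (simp add: power2_sum sum.distrib sum_distrib_left mult.assoc)
  also have "\<dots> = 2 * real n * (\<Sum>j\<in>{1..n}. x j ^ 2) + 2 * (\<Sum>j\<in>{1..n}. x j)^2"
    unfolding sum.distrib sum_distrib_left[symmetric] sum_distrib_right[symmetric]
    by (simp add: power2_eq_square)
  finally have "(\<Sum>j\<in>{1..n}. \<Sum>k\<in>{1..n}. (x j + x k)^2) = 2 * real n * (\<Sum>j\<in>{1..n}. x j ^ 2) + 2 * (\<Sum>j\<in>{1..n}. x j)^2" .
  moreover have "(\<Sum>j\<in>{1..n}. (x j + x j)^2) = 4 * (\<Sum>j\<in>{1..n}. x j ^ 2)"
    by (simp add: sum_distrib_left power2_eq_square)
  ultimately show ?thesis
    using sum_pairs_symmetric[of "\<lambda>j k. (x j + x k)^2" n, OF arg_cong[where f="\<lambda>t. t^2", OF add.commute]]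
    by (simp only: ) (simp add: left_diff_distrib)
qed

text \<open>By the binomial formula; here the diagonal terms are 16 x_j^4, which turns the
  coefficient n into n - 8.\<close>

lemma sum_pairs_fourth:
  fixes x :: "nat \<Rightarrow> real"
  shows "(\<Sum>j\<in>{1..n}. \<Sum>k\<in>{j<..n}. (x j + x k)^4) = (real n - 8) * (\<Sum>j\<in>{1..n}. x j ^ 4)
    + 4 * (\<Sum>j\<in>{1..n}. x j ^ 3) * (\<Sum>j\<in>{1..n}. x j) + 3 * (\<Sum>j\<in>{1..n}. x j ^ 2)^2"
proof -
  have e: "(a + b)^4 = a^4 + 4 * (a^3 * b) + 6 * (a^2 * b^2) + 4 * (a * b^3) + b^4" for a b :: real
    by algebra
  have "(\<Sum>j\<in>{1..n}. \<Sum>k\<in>{1..n}. (x j + x k)^4) =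
      (\<Sum>j\<in>{1..n}. real n * x j ^ 4 + 4 * (x j ^ 3 * (\<Sum>k\<in>{1..n}. x k))
        + 6 * (x j ^ 2 * (\<Sum>k\<in>{1..n}. x k ^ 2)) + 4 * (x j * (\<Sum>k\<in>{1..n}. x k ^ 3)) + (\<Sum>k\<in>{1..n}. x k ^ 4))"
    unfolding e by (simp add: sum.distrib sum_distrib_left)
  also have "\<dots> = 2 * real n * (\<Sum>j\<in>{1..n}. x j ^ 4)
      + 8 * ((\<Sum>j\<in>{1..n}. x j ^ 3) * (\<Sum>j\<in>{1..n}. x j)) + 6 * (\<Sum>j\<in>{1..n}. x j ^ 2)^2"
    unfolding sum.distrib sum_distrib_left[symmetric] sum_distrib_right[symmetric]
    by (simp add: power2_eq_square)
  finally have "(\<Sum>j\<in>{1..n}. \<Sum>k\<in>{1..n}. (x j + x k)^4) = 2 * real n * (\<Sum>j\<in>{1..n}. x j ^ 4)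
      + 8 * ((\<Sum>j\<in>{1..n}. x j ^ 3) * (\<Sum>j\<in>{1..n}. x j)) + 6 * (\<Sum>j\<in>{1..n}. x j ^ 2)^2" .
  moreover have "(\<Sum>j\<in>{1..n}. (x j + x j)^4) = 16 * (\<Sum>j\<in>{1..n}. x j ^ 4)"
    by (simp add: sum_distrib_left mult_2[symmetric] power_mult_distrib)
  ultimately show ?thesis
    using sum_pairs_symmetric[of "\<lambda>j k. (x j + x k)^4" n, OF arg_cong[where f="\<lambda>t. t^4", OF add.commute]]
    by (simp only: ) (simp add: left_diff_distrib)
qed

text \<open>Convexity of the sixth power, obtained by composing the inequality for squares with the
  one for cubes of nonnegative numbers.\<close>

lemma sixth_power_mean: "((a + b) / 2)^6 \<le> (a^6 + b^6) / (2::real)"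
proof -
  have c: "((u + v) / 2)^2 \<le> (u^2 + v^2) / 2" for u v :: real
    using zero_le_power2[of "u - v"] by (simp add: power2_eq_square field_simps)
  have cube: "((u + v) / 2)^3 \<le> (u^3 + v^3) / 2" if "u \<ge> 0" "v \<ge> 0" for u v :: real
  proof -
    have "(u^3 + v^3) / 2 - ((u + v) / 2)^3 = 3/8 * ((u + v) * (u - v)^2)"
      by (simp add: power2_eq_square power3_eq_cube field_simps)
    then show ?thesis using that by (smt (verit) mult_nonneg_nonneg zero_le_power2 divide_nonneg_nonneg)
  qed
  have "((a + b) / 2)^6 = (((a + b) / 2)^2)^3" by (simp flip: power_mult)
  also have "\<dots> \<le> ((a^2 + b^2) / 2)^3" by (rule power_mono[OF c]) simp
  also have "\<dots> \<le> ((a^2)^3 + (b^2)^3) / 2" by (rule cube) auto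
  finally show ?thesis by (simp flip: power_mult)
qed

lemma sum_pairs_sixth:
  fixes x :: "nat \<Rightarrow> real"
  shows "(\<Sum>j\<in>{1..n}. \<Sum>k\<in>{j<..n}. ((x j + x k)/2)^6) \<le> real n * (\<Sum>j\<in>{1..n}. x j ^ 6)"
proof -
  have "(\<Sum>j\<in>{1..n}. \<Sum>k\<in>{j<..n}. ((x j + x k)/2)^6) \<le> (\<Sum>j\<in>{1..n}. \<Sum>k\<in>{1..n}. ((x j + x k)/2)^6)"
    by (intro sum_mono sum_mono2) auto
  also have "\<dots> \<le> (\<Sum>j\<in>{1..n}. \<Sum>k\<in>{1..n}. (x j^6 + x k^6)/2)"
    by (intro sum_mono sixth_power_mean)
  also have "\<dots> = real n * (\<Sum>j\<in>{1..n}. x j ^ 6)"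
    by (simp add: sum.distrib add_divide_distrib flip: sum_divide_distrib sum_distrib_left)
  finally show ?thesis .
qed

text \<open>This is 1 + x \<le> exp x at x = cos (s / 2)^2 - 1. The exponent is expressed through
  \<open>cos s\<close>, so that the addition theorem can be used when it is summed over
  pairs.\<close>

lemma abs_cos_half_le: "\<bar>cos (s / 2)\<bar> \<le> exp (- (1 - cos s) / (4::real))"
proof -
  have "cos s = 2 * (cos (s/2))^2 - 1"
    using cos_double_cos[of "s/2"] by simp
  then have "(cos (s/2))^2 = 1 + - (1 - cos s)/2" by (simp add: field_simps)
  also have "\<dots> \<le> exp (- (1 - cos s)/2)" by (rule exp_ge_add_one_self)
  also have "\<dots> = (exp (- (1 - cos s) / 4))^2" by (simp flip: exp_double)
  finally have "\<bar>cos (s / 2)\<bar>^2 \<le> (exp (- (1 - cos s) / 4))^2" by simp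
  then show ?thesis by (rule power2_le_imp_le) simp
qed

section \<open>The kernel, normalized to maximum 1, and its global upper bound\<close>

abbreviation kernel :: "real \<Rightarrow> real \<Rightarrow> nat \<Rightarrow> (nat \<Rightarrow> real) \<Rightarrow> real" where
  "kernel \<beta> c n \<theta> \<equiv> (\<Prod>j\<in>{1..n}. \<Prod>k\<in>{j<..n}. \<bar>cos (((\<theta> j - c) + (\<theta> k - c)) / 2)\<bar> powr \<beta>)"

text \<open>With C and S the sums of the cosines and sines, the double sum of 1 - cos (y_j + y_k) is
  n^2 - C^2 + S^2. Dropping S^2 and inserting C = n - U leaves U (2 n - U). The correction 4 U
  bounds the diagonal, by 1 - cos (2 y) \<le> 4 (1 - cos y).\<close>

lemma prod_pairs_cos_le:
  fixes y :: "nat \<Rightarrow> real" and n :: nat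
  assumes b: "\<beta> > 0"
  defines "U \<equiv> (\<Sum>j\<in>{1..n}. 1 - cos (y j))"
  shows "(\<Prod>j\<in>{1..n}. \<Prod>k\<in>{j<..n}. \<bar>cos ((y j + y k) / 2)\<bar> powr \<beta>) \<le> exp (- (\<beta> / 8) * (U * (2 * real n - U) - 4 * U))"
proof -
  have "(\<Prod>j\<in>{1..n}. \<Prod>k\<in>{j<..n}. \<bar>cos ((y j + y k) / 2)\<bar> powr \<beta>) \<le>
      (\<Prod>j\<in>{1..n}. \<Prod>k\<in>{j<..n}. exp (- (\<beta> / 4) * (1 - cos (y j + y k))))"
  proof (intro prod_mono conjI prod_nonneg ballI)
    fix j k
    have "\<bar>cos ((y j + y k) / 2)\<bar> powr \<beta> \<le> exp (- (1 - cos (y j + y k)) / 4) powr \<beta>"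
      using b by (intro powr_mono2 abs_cos_half_le) auto
    also have "\<dots> = exp (- (\<beta> / 4) * (1 - cos (y j + y k)))"
      by (simp add: powr_def field_simps)
    finally show "\<bar>cos ((y j + y k) / 2)\<bar> powr \<beta> \<le> exp (- (\<beta> / 4) * (1 - cos (y j + y k)))" .
  qed auto
  also have "\<dots> = exp (- (\<beta> / 4) * (\<Sum>j\<in>{1..n}. \<Sum>k\<in>{j<..n}. 1 - cos (y j + y k)))"
    by (simp add: exp_sum sum_distrib_left)
  also have "\<dots> \<le> exp (- (\<beta> / 8) * (U * (2 * real n - U) - 4 * U))"
  proof -
    define Cs Sn where "Cs = (\<Sum>j\<in>{1..n}. cos (y j))" and "Sn = (\<Sum>j\<in>{1..n}. sin (y j))"
    have U: "Cs = real n - U" by (simp add: Cs_def U_def sum_subtractf)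
    have "(\<Sum>j\<in>{1..n}. \<Sum>k\<in>{1..n}. 1 - cos (y j + y k)) = (real n)^2 - Cs^2 + Sn^2"
      by (simp add: cos_add sum_subtractf Cs_def Sn_def power2_eq_square sum_product)
    moreover have "(\<Sum>j\<in>{1..n}. 1 - cos (y j + y j)) \<le> 4 * U"
      unfolding U_def sum_distrib_left
    proof (rule sum_mono)
      fix j
      have "1 - cos (y j + y j) = 2 * (1 - cos (y j)) * (1 + cos (y j))"
        using cos_double_cos[of "y j"] by (simp add: power2_eq_square algebra_simps)
      also have "\<dots> \<le> 2 * (1 - cos (y j)) * 2"
        by (intro mult_left_mono) auto
      finally show "1 - cos (y j + y j) \<le> 4 * (1 - cos (y j))" by simp
    qed
    ultimately have "2 * (\<Sum>j\<in>{1..n}. \<Sum>k\<in>{j<..n}. 1 - cos (y j + y k)) \<ge> (real n)^2 - Cs^2 - 4 * U"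
      using sum_pairs_symmetric[of "\<lambda>j k. 1 - cos (y j + y k)" n, OF arg_cong[where f="\<lambda>t. 1 - cos t", OF add.commute]] zero_le_power2[of Sn]
      by linarith
    moreover have "(real n)^2 - Cs^2 = U * (2 * real n - U)"
      unfolding U by (simp add: power2_eq_square algebra_simps)
    ultimately have "(U * (2 * real n - U) - 4 * U) / 2 \<le> (\<Sum>j\<in>{1..n}. \<Sum>k\<in>{j<..n}. 1 - cos (y j + y k))"
      by simp
    from mult_left_mono[OF this, of "\<beta> / 4"] b show ?thesis by simp
  qed
  finally show ?thesis .
qed

section \<open>Local expansions of ln cos and of the given function\<close>

lemma ln_cos_expansion:
  obtains d C :: real where "0 < d" "d \<le> 1" "0 \<le> C"
    "\<And>u. \<bar>u\<bar> \<le> d \<Longrightarrow> 0 < cos u"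
    "\<And>u. \<bar>u\<bar> \<le> d \<Longrightarrow> \<bar>ln (cos u) + u^2/2 + u^4/12\<bar> \<le> C * u^6"
    "\<And>u. \<bar>u\<bar> \<le> d \<Longrightarrow> ln (cos u) \<le> - (u^2/2)"
proof -
  have "(\<lambda>u::real. ln (cos u) + u^2/2 + u^4/12) \<in> O[at 0](\<lambda>u. u^6)" by real_asymp
  then obtain C where C: "C > 0" "eventually (\<lambda>u::real. \<bar>ln (cos u) + u^2/2 + u^4/12\<bar> \<le> C * \<bar>u^6\<bar>) (at 0)"
    by (auto elim!: landau_o.bigE simp: real_norm_def power_even_abs)
  from C(2) obtain d where d: "d > 0" "\<And>u. u \<noteq> 0 \<Longrightarrow> \<bar>u\<bar> < d \<Longrightarrow> \<bar>ln (cos u) + u^2/2 + u^4/12\<bar> \<le> C * \<bar>u^6\<bar>"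
    by (auto simp: eventually_at dist_real_def)
  \<comment> \<open>\<open>d / 2\<close> allows a closed interval, \<open>1\<close> keeps the cosine
    positive, and the last entry gives C u^2 \<le> 1/12, so that the negative quartic term outweighs
    the error C u^6 and the upper bound by - u^2 / 2 follows.\<close>
  define d' where "d' = min (min (d/2) 1) (1 / (12 * C + 1))"
  have d': "d' > 0" "d' \<le> 1" "d' < d" "d' \<le> 1 / (12 * C + 1)"
  proof -
    have "d' \<le> d / 2" by (simp add: d'_def)
    then show "d' < d" using d(1) by simp
  qed (use d(1) C(1) in \<open>auto simp: d'_def\<close>)
  have cp: "0 < cos u" if "\<bar>u\<bar> \<le> d'" for u
    using that d'(2) pi_gt3 by (intro cos_gt_zero_pi) auto
  have ex: "\<bar>ln (cos u) + u^2/2 + u^4/12\<bar> \<le> C * u^6" if "\<bar>u\<bar> \<le> d'" for u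
    using d(2)[of u] that d'(3) by (cases "u = 0") (auto simp: power_even_abs)
  have ub: "ln (cos u) \<le> - (u^2/2)" if u: "\<bar>u\<bar> \<le> d'" for u
  proof -
    have "u^2 \<le> d'^2" using u by (simp add: abs_le_square_iff[symmetric])
    also have "\<dots> \<le> d'" using d'(1,2) by (simp add: power2_eq_square mult_left_le)
    also have "\<dots> \<le> 1 / (12 * C + 1)" by fact
    finally have "C * u^2 \<le> C * (1 / (12 * C + 1))" using C(1) by (intro mult_left_mono) auto
    also have "\<dots> \<le> 1/12" using C(1) by (simp add: field_simps)
    finally have "u^4 * (C * u^2) \<le> u^4 * (1/12)" by (intro mult_left_mono) auto
    moreover have "u^4 * (C * u^2) = C * u^6" by (simp add: power_add[symmetric])
    ultimately show ?thesis using ex[OF u] by linarith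
  qed
  show ?thesis using that[OF d'(1,2), of C] C(1) cp ex ub by simp
qed

text \<open>The linearization bound is applied twice on the segment from c to c + x: to
  \<open>D1 f\<close>, whose derivative varies there by at most L |x|^q, and then to
  \<open>f\<close> minus its linear and quadratic terms. Each application gains a factor |x|. The
  parameter \<open>d0\<close> lets the radius stay below one chosen earlier.\<close>

lemma C2_holder_near_expansion:
  assumes "C2_holder_near q f c" "d0 > 0" and q: "q > 0"
  obtains d L :: real where "0 < d" "d \<le> d0" "0 \<le> L"
    "\<And>x. \<bar>x\<bar> \<le> d \<Longrightarrow> norm (f (c + x) - f c - D1 f c * of_real x - D2 f c / 2 * (of_real x)\<^sup>2) \<le> L * \<bar>x\<bar> powr (2 + q)"
proof -
  obtain U where U: "open U" "c \<in> U" "f C1_differentiable_on U" "D1 f C1_differentiable_on U" "holder_on q U (D2 f)"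
    using assms(1) by (auto simp: C2_holder_near_def)
  have der: "(g has_vector_derivative D1 g x) (at x)" if "g C1_differentiable_on U" "x \<in> U" for g x
    using that by (auto simp: C1_differentiable_on_def D1_def vector_derivative_at)
  obtain e where e: "e > 0" "cball c e \<subseteq> U"
    using U(1,2) open_contains_cball by blast
  obtain L0 where L0: "\<And>x y. x \<in> U \<Longrightarrow> y \<in> U \<Longrightarrow> norm (D2 f x - D2 f y) \<le> L0 * \<bar>x - y\<bar> powr q"
    using U(5) by (auto simp: holder_on_def)
  \<comment> \<open>\<open>holder_on\<close> does not fix the sign of its constant, while the
    estimates below multiply inequalities by it.\<close>
  define L where "L = max L0 0"
  have L: "norm (D2 f x - D2 f y) \<le> L * \<bar>x - y\<bar> powr q" if "x \<in> U" "y \<in> U" for x y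
    using L0[OF that] by (smt (verit) L_def mult_right_mono powr_ge_zero)
  have seg: "closed_segment c (c + x) \<subseteq> U" if "\<bar>x\<bar> \<le> e" for x
  proof -
    have "closed_segment c (c + x) \<subseteq> cball c e"
      using that e(1) by (intro closed_segment_subset) (auto simp: dist_real_def)
    then show ?thesis using e(2) by blast
  qed
  have near: "\<bar>y - c\<bar> \<le> \<bar>x\<bar>" if "y \<in> closed_segment c (c + x)" for x y
    using segment_bound(1)[OF that] by (simp add: abs_minus_commute)
  have near2: "\<bar>y - c\<bar> powr q \<le> \<bar>x\<bar> powr q" if "y \<in> closed_segment c (c + x)" for x y
    using near[OF that] q by (intro powr_mono2) auto
  have first: "norm (D1 f (c + x) - D1 f c - x *\<^sub>R D2 f c) \<le> L * \<bar>x\<bar> powr (1 + q)" if x: "\<bar>x\<bar> \<le> e" for x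
  proof -
    have "norm (D1 f (c + x) - D1 f c - (c + x - c) *\<^sub>R D2 f c) \<le> norm (c + x - c) * (L * \<bar>x\<bar> powr q)"
    proof (rule vector_differentiable_bound_linearization[where S="closed_segment c (c + x)"])
      fix y assume y: "y \<in> closed_segment c (c + x)"
      then have yU: "y \<in> U" using seg[OF x] by auto
      then show "(D1 f has_vector_derivative D2 f y) (at y within closed_segment c (c + x))"
        using der[OF U(4)] by (auto simp: D2_def intro: has_vector_derivative_at_within)
      show "norm (D2 f y - D2 f c) \<le> L * \<bar>x\<bar> powr q"
        using L[OF yU U(2)] mult_left_mono[OF near2[OF y], of L] by (auto simp: L_def)
    qed auto
    then show ?thesis by (cases "x = 0") (auto simp: powr_add algebra_simps)
  qed
  have second: "norm (f (c + x) - f c - D1 f c * of_real x - D2 f c / 2 * (of_real x)\<^sup>2) \<le> L * \<bar>x\<bar> powr (2 + q)"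
    if x: "\<bar>x\<bar> \<le> e" for x
  proof -
    \<comment> \<open>The derivative \<open>r'\<close> of \<open>r\<close> vanishes at
      \<open>c\<close>, so the linearization of \<open>r\<close> there has no linear part and the
      bound concerns \<open>r\<close> itself.\<close>
    define r where "r y = f y - (y - c) *\<^sub>R D1 f c - ((y - c)\<^sup>2 / 2) *\<^sub>R D2 f c" for y
    define r' where "r' y = D1 f y - D1 f c - (y - c) *\<^sub>R D2 f c" for y
    have "norm (r (c + x) - r c - (c + x - c) *\<^sub>R r' c) \<le> norm (c + x - c) * (L * \<bar>x\<bar> powr (1 + q))"
    proof (rule vector_differentiable_bound_linearization[where S="closed_segment c (c + x)"])
      fix y assume y: "y \<in> closed_segment c (c + x)"
      then have yU: "y \<in> U" using seg[OF x] by auto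
      have "(f has_vector_derivative D1 f y) (at y within closed_segment c (c + x))"
        using der[OF U(3) yU] by (rule has_vector_derivative_at_within)
      then show "(r has_vector_derivative r' y) (at y within closed_segment c (c + x))"
        unfolding r_def r'_def by (auto intro!: derivative_eq_intros simp: has_real_derivative_iff_has_vector_derivative[symmetric])
      have "norm (r' y) \<le> L * \<bar>y - c\<bar> powr (1 + q)"
        using first[of "y - c"] near[OF y] x by (simp add: r'_def)
      also have "\<dots> \<le> L * \<bar>x\<bar> powr (1 + q)"
        using near[OF y] q by (intro mult_left_mono powr_mono2) (auto simp: L_def)
      finally show "norm (r' y - r' c) \<le> L * \<bar>x\<bar> powr (1 + q)" by (simp add: r'_def)
    qed auto
    then have "norm (r (c + x) - r c) \<le> \<bar>x\<bar> * (L * \<bar>x\<bar> powr (1 + q))" by (simp add: r'_def)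
    also have "\<dots> = L * \<bar>x\<bar> powr (2 + q)"
    proof (cases "x = 0")
      case False
      then have "\<bar>x\<bar> powr (2 + q) = \<bar>x\<bar> powr (1 + (1 + q))" by (simp add: add.assoc[symmetric])
      also have "\<dots> = \<bar>x\<bar> * \<bar>x\<bar> powr (1 + q)" using False by (subst powr_add) simp
      finally show ?thesis by simp
    qed simp
    also have "r (c + x) - r c = f (c + x) - f c - D1 f c * of_real x - D2 f c / 2 * (of_real x)\<^sup>2"
      by (simp add: r_def scaleR_conv_of_real algebra_simps)
    finally show ?thesis .
  qed
  show ?thesis using that[of "min e d0" L] e(1) assms(2) second by (auto simp: L_def)
qed

section \<open>Configurations far from both centers\<close>

text \<open>The condition on the sum selects a center to which the configuration belongs: cos (x -
  pi/2) and cos (x + pi/2) are opposite, so the sums for the two centers add up to 2 n.\<close>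

abbreviation far :: "real \<Rightarrow> real \<Rightarrow> nat \<Rightarrow> (nat \<Rightarrow> real) set" where
  "far \<delta> c n \<equiv> {\<theta>. (\<Sum>j\<in>{1..n}. 1 - cos (\<theta> j - c)) \<le> real n \<and> (\<exists>j\<in>{1..n}. \<delta> < \<bar>\<theta> j - c\<bar>)}"

text \<open>The quotient (1 - cos y) / y^2 tends to 1/2. Taking \<open>\<rho>\<close> close to 1
  preserves the Gaussian constant up to a factor close to 1; r \<le> pi / 2 is what
  \<open>cos_le_cos_far\<close> asks for.\<close>

lemma one_minus_cos_lower:
  fixes \<rho> :: real
  assumes "\<rho> < 1"
  obtains r where "0 < r" "r \<le> pi / 2" "\<And>y. \<bar>y\<bar> \<le> r \<Longrightarrow> \<rho> * y\<^sup>2 / 2 \<le> 1 - cos y"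
proof -
  have "((\<lambda>y::real. (1 - cos y) / y\<^sup>2) \<longlongrightarrow> 1/2) (at 0)" by real_asymp
  then have "eventually (\<lambda>y::real. (1 - cos y) / y\<^sup>2 > \<rho> / 2) (at 0)"
    using assms by (intro order_tendstoD) auto
  then obtain d where d: "d > 0" "\<And>y. y \<noteq> 0 \<Longrightarrow> \<bar>y\<bar> < d \<Longrightarrow> (1 - cos y) / y\<^sup>2 > \<rho> / 2"
    by (auto simp: eventually_at dist_real_def)
  have "\<rho> * y\<^sup>2 / 2 \<le> 1 - cos y" if "\<bar>y\<bar> \<le> min (d/2) (pi/2)" for y
  proof (cases "y = 0")
    case False
    then show ?thesis using d(2)[of y] d(1) that by (auto simp: field_simps)
  qed simp
  then show ?thesis using d(1) by (intro that[of "min (d/2) (pi/2)"]) auto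
qed

text \<open>Beyond pi the cosine increases again, but 2 pi - |y| is then at least pi / 2, hence at
  least r, and lies in the monotone range. The limit 3 pi / 2 is the largest distance between a
  point of [-pi, pi] and a center.\<close>

lemma cos_le_cos_far:
  assumes "0 \<le> r" "r \<le> pi / 2" "r \<le> \<bar>y\<bar>" "\<bar>y\<bar> \<le> 3 * pi / 2"
  shows "cos y \<le> cos r"
proof (cases "\<bar>y\<bar> \<le> pi")
  case True
  then have "cos \<bar>y\<bar> \<le> cos r" using assms by (intro cos_monotone_0_pi_le) auto
  then show ?thesis by simp
next
  case False
  then have "cos (2 * pi - \<bar>y\<bar>) \<le> cos r" using assms by (intro cos_monotone_0_pi_le) auto
  then show ?thesis by (simp add: cos_diff)
qed

lemma abs_diff_half_pi_le:
  assumes "\<theta> \<in> {-pi..pi}" "c \<in> {pi/2, -pi/2}"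
  shows "\<bar>\<theta> - c\<bar> \<le> 3 * pi / 2"
proof -
  have "c = pi / 2 \<or> c = - (pi / 2)" "- pi \<le> \<theta>" "\<theta> \<le> pi" using assms by auto
  then show ?thesis using pi_gt_zero unfolding abs_le_iff by linarith
qed

text \<open>Close to the center the weight lies below a Gaussian of variance 1 / (\<alpha> \<rho>),
  elsewhere below a constant, which is integrated over an interval of length 2 pi.\<close>

lemma integral_exp_cos_le:
  assumes c: "c \<in> {pi/2, -pi/2}" and \<rho>: "0 < \<rho>" "\<rho> < 1"
  obtains r where "0 < r"
    "\<And>\<alpha>. \<alpha> > 0 \<Longrightarrow> (LINT \<theta>|lebesgue_on {-pi..pi}. exp (- \<alpha> * (1 - cos (\<theta> - c)))) \<le> sqrt (2 * pi / (\<alpha> * \<rho>)) + 2 * pi * exp (- \<alpha> * r)"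
proof -
  obtain r where r: "0 < r" "r \<le> pi / 2" "\<And>y. \<bar>y\<bar> \<le> r \<Longrightarrow> \<rho> * y\<^sup>2 / 2 \<le> 1 - cos y"
    using one_minus_cos_lower[OF \<rho>(2)] by blast
  have "(LINT \<theta>|lebesgue_on {-pi..pi}. exp (- \<alpha> * (1 - cos (\<theta> - c)))) \<le> sqrt (2 * pi / (\<alpha> * \<rho>)) + 2 * pi * exp (- \<alpha> * (1 - cos r))"
    if \<alpha>: "\<alpha> > 0" for \<alpha>
  proof -
    define s where "s = 1 / sqrt (\<alpha> * \<rho>)"
    have s: "s > 0" "s\<^sup>2 = 1 / (\<alpha> * \<rho>)" using \<alpha> \<rho> by (auto simp: s_def power_divide)
    define g where "g \<theta> = sqrt (2 * pi / (\<alpha> * \<rho>)) * normal_density c s \<theta>" for \<theta>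
    have g: "g \<theta> = exp (- \<alpha> * (\<rho> * (\<theta> - c)\<^sup>2 / 2))" for \<theta>
      using \<alpha> \<rho> by (simp add: g_def normal_density_def s)
    have gi: "integrable lebesgue g" "integral\<^sup>L lebesgue g = sqrt (2 * pi / (\<alpha> * \<rho>))"
      unfolding g_def using s(1) by (auto simp: integrable_completion integral_completion)
    have gS: "integrable (lebesgue_on {-pi..pi}) g"
      using gi(1) by (subst integrable_restrict_space) (auto intro!: integrable_mult_indicator[where 'b=real, simplified])
    have "integral\<^sup>L (lebesgue_on {-pi..pi}) g = (LINT x|lebesgue. indicator {-pi..pi} x *\<^sub>R g x)"
      by (rule integral_restrict_space) auto
    also have "\<dots> \<le> integral\<^sup>L lebesgue g"
      by (rule integral_mono'[OF gi(1)]) (auto simp: indicator_def g)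
    finally have gS2: "integral\<^sup>L (lebesgue_on {-pi..pi}) g \<le> sqrt (2 * pi / (\<alpha> * \<rho>))" using gi(2) by simp
    interpret finite_measure "lebesgue_on {-pi..pi}" by (rule finite_measure_lebesgue_on) auto
    have "(LINT \<theta>|lebesgue_on {-pi..pi}. exp (- \<alpha> * (1 - cos (\<theta> - c)))) \<le>
      (LINT \<theta>|lebesgue_on {-pi..pi}. g \<theta> + exp (- \<alpha> * (1 - cos r)))"
    proof (rule integral_mono')
      fix \<theta> assume "\<theta> \<in> space (lebesgue_on {-pi..pi})"
      then have \<theta>: "\<bar>\<theta> - c\<bar> \<le> 3 * pi / 2" using abs_diff_half_pi_le[OF _ c] by simp
      show "exp (- \<alpha> * (1 - cos (\<theta> - c))) \<le> g \<theta> + exp (- \<alpha> * (1 - cos r))"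
      proof (cases "\<bar>\<theta> - c\<bar> \<le> r")
        case True
        have "exp (- \<alpha> * (1 - cos (\<theta> - c))) \<le> g \<theta>"
          using r(3)[OF True] \<alpha> unfolding g by simp
        then show ?thesis by (simp add: add_increasing2)
      next
        case False
        then have "exp (- \<alpha> * (1 - cos (\<theta> - c))) \<le> exp (- \<alpha> * (1 - cos r))"
          using cos_le_cos_far[of r "\<theta> - c"] r \<theta> \<alpha> by simp
        then show ?thesis by (simp add: g add_increasing)
      qed
      show "0 \<le> g \<theta> + exp (- \<alpha> * (1 - cos r))" by (simp add: g add_nonneg_nonneg)
    qed (use gS in auto)
    also have "\<dots> = integral\<^sup>L (lebesgue_on {-pi..pi}) g + 2 * pi * exp (- \<alpha> * (1 - cos r))"
      using gS by (subst Bochner_Integration.integral_add) (auto simp: measure_restrict_space)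
    finally show ?thesis using gS2 by simp
  qed
  \<comment> \<open>The decay rate handed out as \<open>r\<close> is 1 - cos r for the radius
    \<open>r\<close> of this proof.\<close>
  moreover have "1 - cos r > 0"
    using cos_monotone_0_pi[of 0 r] r pi_gt_zero by auto
  ultimately show ?thesis using that by blast
qed

text \<open>The rate loses a factor e^(-\<epsilon>) and \<open>\<rho>\<close> another e^(-\<epsilon>
  / 2), so the square root exceeds sqrt (8 pi / (\<beta> n)) by e^(3 \<epsilon> / 4). The gap
  \<open>k\<close> between this and e^\<epsilon> absorbs the exponentially small term.\<close>

lemma integral_exp_cos_asymp:
  assumes c: "c \<in> {pi/2, -pi/2}" and b: "\<beta> > 0" and e: "\<epsilon> > 0"
  shows "\<forall>\<^sub>F n in sequentially. (LINT \<theta>|lebesgue_on {-pi..pi}. exp (- (\<beta> / 4 * exp (- \<epsilon>) * real n) * (1 - cos (\<theta> - c))))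
    \<le> sqrt (8 * pi / (\<beta> * real n)) * exp \<epsilon>"
proof -
  define \<rho> where "\<rho> = exp (- \<epsilon> / 2)"
  have \<rho>: "0 < \<rho>" "\<rho> < 1" using e by (auto simp: \<rho>_def)
  obtain r where r: "0 < r"
    "\<And>\<alpha>. \<alpha> > 0 \<Longrightarrow> (LINT \<theta>|lebesgue_on {-pi..pi}. exp (- \<alpha> * (1 - cos (\<theta> - c)))) \<le> sqrt (2 * pi / (\<alpha> * \<rho>)) + 2 * pi * exp (- \<alpha> * r)"
    using integral_exp_cos_le[OF c \<rho>] by blast
  define b' where "b' = \<beta> / 4 * exp (- \<epsilon>)"
  have b': "b' > 0" using b by (simp add: b'_def)
  define k where "k = exp \<epsilon> - exp (3 * \<epsilon> / 4)"
  have k: "k > 0" using e by (simp add: k_def)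
  define a where "a = b' * r"
  have a: "a > 0" using b' r(1) by (simp add: a_def)
  have "((\<lambda>n. exp (- a * real n) * sqrt (real n)) \<longlongrightarrow> 0) sequentially" using a by real_asymp
  moreover have "k * sqrt (8 * pi / \<beta>) / (2 * pi) > 0" using k b by simp
  ultimately have "\<forall>\<^sub>F n in sequentially. exp (- a * real n) * sqrt (real n) < k * sqrt (8 * pi / \<beta>) / (2 * pi)"
    by (rule order_tendstoD(2))
  then show ?thesis using eventually_gt_at_top[of 0]
  proof eventually_elim
    case (elim n)
    have p: "b' * real n > 0" using b' elim by simp
    have "2 * pi / (b' * real n * \<rho>) = (8 * pi / (\<beta> * real n)) * exp (3 * \<epsilon> / 2)"
    proof -
      have "exp (- \<epsilon>) * exp (- \<epsilon> / 2) * exp (3 * \<epsilon> / 2) = (1::real)"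
        by (simp flip: exp_add)
      then have "exp (3 * \<epsilon> / 2) = 1 / (exp (- \<epsilon>) * exp (- \<epsilon> / 2))"
        by (metis divide_self_if exp_not_eq_zero mult_eq_0_iff nonzero_mult_div_cancel_left)
      then show ?thesis using b elim unfolding b'_def \<rho>_def by simp
    qed
    moreover have "sqrt (exp (3 * \<epsilon> / 2)) = exp (3 * \<epsilon> / 4)"
      by (rule real_sqrt_unique) (simp_all flip: exp_double)
    ultimately have "sqrt (2 * pi / (b' * real n * \<rho>)) = sqrt (8 * pi / (\<beta> * real n)) * exp (3 * \<epsilon> / 4)"
      by (simp only: real_sqrt_mult)
    moreover have "2 * pi * exp (- (b' * real n) * r) \<le> sqrt (8 * pi / (\<beta> * real n)) * k"
    proof -
      have "sqrt (8 * pi / (\<beta> * real n)) = sqrt (8 * pi / \<beta>) / sqrt (real n)"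
        by (simp add: real_sqrt_divide real_sqrt_mult)
      moreover have "exp (- (b' * real n) * r) = exp (- a * real n)" by (simp add: a_def)
      moreover have "2 * pi * exp (- a * real n) \<le> S / sqrt (real n) * k" if "exp (- a * real n) * sqrt (real n) < k * S / (2 * pi)" for S
        using elim(2) that by (simp add: field_simps)
      ultimately show ?thesis using elim(1) by (simp only:)
    qed
    ultimately have "sqrt (2 * pi / (b' * real n * \<rho>)) + 2 * pi * exp (- (b' * real n) * r) \<le> sqrt (8 * pi / (\<beta> * real n)) * exp \<epsilon>"
      by (simp add: k_def algebra_simps)
    then show ?case using r(2)[OF p] unfolding b'_def by linarith
  qed
qed

text \<open>The term \<open>\<epsilon>\<close> absorbs the linear growth of \<open>h\<close> at its center, which the quadratic \<open>1 - cos\<close> cannot dominate.\<close>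

lemma growth_bound:
  assumes "0 < \<delta>" "\<delta> \<le> pi / 2" "0 \<le> L" "0 \<le> B" "0 < \<epsilon>" "c \<in> {pi/2, -pi/2}"
  obtains K where "0 < K"
    "\<And>h \<theta>. (\<And>x. \<bar>h x\<bar> \<le> B) \<Longrightarrow> (\<And>y. \<bar>y\<bar> \<le> \<delta> \<Longrightarrow> \<bar>h (c + y) - h c\<bar> \<le> L * \<bar>y\<bar>) \<Longrightarrow> \<theta> \<in> {-pi..pi} \<Longrightarrow>
      h \<theta> - h c \<le> \<epsilon> + K * (1 - cos (\<theta> - c))"
proof -
  obtain r where r: "0 < r" "r \<le> pi / 2" "\<And>y. \<bar>y\<bar> \<le> r \<Longrightarrow> 1/2 * y\<^sup>2 / 2 \<le> 1 - cos y"
    using one_minus_cos_lower[of "1/2"] by auto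
  define d where "d = min \<delta> r"
  have d: "0 < d" "d \<le> pi/2" "d \<le> \<delta>" "d \<le> r" using assms r by (auto simp: d_def)
  have v: "1 - cos d > 0"
    using cos_monotone_0_pi[of 0 d] d pi_gt_zero by auto
  \<comment> \<open>The first summand comes from L |y| \<le> \<epsilon> + (L^2 / \<epsilon>) y^2 / 4
    together with y^2 / 4 \<le> 1 - cos y, the second covers points farther than \<open>d\<close>,
    where only |h| \<le> B is known, and 1 makes \<open>K\<close> positive.\<close>
  define K where "K = L\<^sup>2 / \<epsilon> + 2 * B / (1 - cos d) + 1"
  have K0: "K > 0" "L\<^sup>2 / \<epsilon> \<le> K" "2 * B / (1 - cos d) \<le> K" using assms v by (auto simp: K_def add_nonneg_pos)
  have "h \<theta> - h c \<le> \<epsilon> + K * (1 - cos (\<theta> - c))"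
    if h: "\<And>x. \<bar>h x\<bar> \<le> B" "\<And>y. \<bar>y\<bar> \<le> \<delta> \<Longrightarrow> \<bar>h (c + y) - h c\<bar> \<le> L * \<bar>y\<bar>" and \<theta>: "\<theta> \<in> {-pi..pi}" for h :: "real \<Rightarrow> real" and \<theta>
  proof (cases "\<bar>\<theta> - c\<bar> \<le> d")
    case True
    define y where "y = \<theta> - c"
    have y: "\<bar>y\<bar> \<le> d" using True by (simp add: y_def)
    have "h \<theta> - h c \<le> L * \<bar>y\<bar>" using h(2)[of y] y d by (simp add: y_def)
    also have "\<dots> \<le> \<epsilon> + L\<^sup>2 / \<epsilon> * (y\<^sup>2 / 4)"
    proof -
      have "0 \<le> (L * \<bar>y\<bar> / 2 - \<epsilon>)\<^sup>2" by simp
      then have "L * \<bar>y\<bar> * \<epsilon> \<le> \<epsilon> * \<epsilon> + L\<^sup>2 * y\<^sup>2 / 4" by (simp add: power2_eq_square field_simps)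
      then show ?thesis using assms(5) by (simp add: field_simps)
    qed
    also have "L\<^sup>2 / \<epsilon> * (y\<^sup>2 / 4) \<le> K * (1 - cos y)"
      using r(3)[of y] y d K0 by (intro mult_mono) auto
    finally show ?thesis by (simp add: y_def)
  next
    case False
    have "h \<theta> - h c \<le> 2 * B" using h(1)[of \<theta>] h(1)[of c] by linarith
    also have "\<dots> = 2 * B / (1 - cos d) * (1 - cos d)" using v by simp
    also have "\<dots> \<le> K * (1 - cos (\<theta> - c))"
    proof -
      have "\<bar>\<theta> - c\<bar> \<le> 3 * pi / 2" using abs_diff_half_pi_le \<theta> assms(6) by blast
      then have "cos (\<theta> - c) \<le> cos d" using cos_le_cos_far[of d "\<theta> - c"] d False by simp
      then show ?thesis using K0 v by (intro mult_mono) auto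
    qed
    finally show ?thesis using assms(5) by simp
  qed
  then show ?thesis using that K0(1) by blast
qed

text \<open>An exponential beats powers of n; after taking logarithms, - k n^2 beats terms of order
  n ln n. Each bound takes half of the 1 / n that \<open>rest_bound\<close> allows in total.\<close>

lemma rest_scale_bounds:
  assumes "\<beta> > 0" "\<gamma> > 0" "k > 0" "K > 0"
  shows "\<forall>\<^sub>F n in sequentially. 2 * pi * real n * exp (- \<gamma> * real n) / sqrt (8 * pi / (\<beta> * real n)) \<le> 1 / (2 * real n)"
    and "\<forall>\<^sub>F n in sequentially. (2 * pi) ^ n * exp (- k * (real n)\<^sup>2 + K * real n) \<le> gauss_volume \<beta> n / (2 * real n)"
proof -
  show "\<forall>\<^sub>F n in sequentially. 2 * pi * real n * exp (- \<gamma> * real n) / sqrt (8 * pi / (\<beta> * real n)) \<le> 1 / (2 * real n)"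
    using assms by real_asymp
  \<comment> \<open>Collects the coefficients of n in the logarithms of both sides, including n ln
    (2 pi) from the volume of the cube.\<close>
  define M where "M = K + ln (2 * pi) - ln (8 * pi / \<beta>) / 2"
  have "filterlim (\<lambda>n. - k * (real n)\<^sup>2 + M * real n + real n / 2 * ln (real n) + ln (real n) + ln 2) at_bot sequentially"
    using assms by real_asymp
  then have "\<forall>\<^sub>F n in sequentially. - k * (real n)\<^sup>2 + M * real n + real n / 2 * ln (real n) + ln (real n) + ln 2 \<le> 0"
    by (simp add: filterlim_at_bot)
  then show "\<forall>\<^sub>F n in sequentially. (2 * pi) ^ n * exp (- k * (real n)\<^sup>2 + K * real n) \<le> gauss_volume \<beta> n / (2 * real n)"
    using eventually_gt_at_top[of 0]
  proof eventually_elim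
    case (elim n)
    have l: "ln (8 * pi / (\<beta> * real n)) = ln (8 * pi / \<beta>) - ln (real n)"
      using elim assms ln_div[of "8 * pi / \<beta>" "real n"] by simp
    have "real n * t + (- k * (real n)\<^sup>2 + K * real n) \<le> real n / 2 * (s - ln (real n)) - (ln 2 + ln (real n))"
      if "M = K + t - s / 2" for s t
      using elim(1) unfolding that by (simp add: algebra_simps)
    from this[OF M_def] have "real n * ln (2 * pi) + (- k * (real n)\<^sup>2 + K * real n) \<le> real n / 2 * ln (8 * pi / (\<beta> * real n)) - ln (2 * real n)"
      using elim(2) unfolding l by (simp add: ln_mult_pos)
    then have "exp (real n * ln (2 * pi) + (- k * (real n)\<^sup>2 + K * real n)) \<le> exp (real n / 2 * ln (8 * pi / (\<beta> * real n)) - ln (2 * real n))"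
      by simp
    moreover have "exp (real n * ln (2 * pi)) = (2 * pi) ^ n" by (simp add: exp_of_nat_mult)
    ultimately show ?case using elim assms by (simp add: powr_def exp_add exp_diff)
  qed
qed


text \<open>With \<open>U = (\<Sum>j. 1 - cos (\<theta> j - c))\<close>, the kernel bound gives \<open>exp (- k n\<^sup>2)\<close> if \<open>U > \<kappa> n\<close>, which beats the factor
  \<open>(1 / n) powr (n / 2)\<close>. If \<open>U \<le> \<kappa> n\<close>, it is almost the sharp Gaussian weight, and the far point supplies \<open>exp (- \<gamma> n)\<close>.\<close>

lemma rest_bound:
  fixes \<beta> \<delta> L B c :: real
  assumes b: "\<beta> > 0" and \<delta>: "0 < \<delta>" "\<delta> \<le> pi / 2" and LB: "0 \<le> L" "0 \<le> B" and c: "c \<in> {pi/2, -pi/2}"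
  shows "\<forall>\<^sub>F n in sequentially. \<forall>h. (\<forall>x. \<bar>h x\<bar> \<le> B) \<longrightarrow> (\<forall>y. \<bar>y\<bar> \<le> \<delta> \<longrightarrow> \<bar>h (c + y) - h c\<bar> \<le> L * \<bar>y\<bar>) \<longrightarrow>
    (LINT \<theta>|cube n.
      indicator (far \<delta> c n) \<theta> *
      (kernel \<beta> c n \<theta> * (\<Prod>j\<in>{1..n}. exp (h (\<theta> j)))))
    \<le> gauss_volume \<beta> n * exp (real n * h c) / real n"
proof -
  define vd where "vd = 1 - cos \<delta>"
  have vd: "vd > 0" using cos_monotone_0_pi[of 0 \<delta>] \<delta> pi_gt_zero by (auto simp: vd_def)
  \<comment> \<open>The first entry gives exp (- e) \<ge> 1/2; then the gain from a far point is at
    least \<beta> vd / 8, which by the second entry is at least 4 e and exceeds the loss 3 e in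
    \<open>\<gamma>\<close>.\<close>
  define e where "e = min (1/2) (\<beta> * vd / 32)"
  have e: "e > 0" "e \<le> 1/2" "e \<le> \<beta> * vd / 32" using b vd by (auto simp: e_def)
  obtain K where K: "0 < K"
    "\<And>h \<theta>. (\<And>x. \<bar>h x\<bar> \<le> B) \<Longrightarrow> (\<And>y. \<bar>y\<bar> \<le> \<delta> \<Longrightarrow> \<bar>h (c + y) - h c\<bar> \<le> L * \<bar>y\<bar>) \<Longrightarrow> \<theta> \<in> {-pi..pi} \<Longrightarrow>
      h \<theta> - h c \<le> e + K * (1 - cos (\<theta> - c))"
    using growth_bound[OF \<delta> LB e(1) c] by blast
  \<comment> \<open>\<beta> / 2 pays for the diagonal correction 4 U of the kernel bound, which
    carries the factor \<beta> / 8.\<close>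
  define K' where "K' = K + \<beta> / 2"
  have K': "K' > 0" using K b by (simp add: K'_def)
  \<comment> \<open>For U \<le> \<kappa> n the first entry bounds K' U by e n, and the second gives
    2 n - U \<ge> 2 exp (- e) n, so the quadratic exponent is still at least
    \<open>\<alpha> n * U\<close>.\<close>
  define \<kappa> where "\<kappa> = min (e / K') (2 * (1 - exp (- e)))"
  have \<kappa>: "\<kappa> > 0" "\<kappa> * K' \<le> e" "exp (- e) \<le> 1 - \<kappa> / 2"
    using K' e by (auto simp: \<kappa>_def min_def field_simps)
  define \<alpha> where "\<alpha> n = \<beta> / 4 * exp (- e) * real n" for n :: nat
  \<comment> \<open>The three losses e per coordinate stem from the growth of \<open>h\<close>, from
    K' U and from the one-dimensional integrals.\<close>
  define \<gamma> where "\<gamma> = \<beta> / 4 * exp (- e) * vd - 3 * e"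
  have "\<gamma> > 0"
  proof -
    have "exp (- e) \<ge> 1/2" using exp_ge_add_one_self[of "- e"] e by linarith
    then have "\<beta> / 4 * vd * (1/2) \<le> \<beta> / 4 * vd * exp (- e)" using b vd by (intro mult_left_mono) auto
    then have "\<beta> * vd / 8 \<le> \<beta> / 4 * exp (- e) * vd" by (simp add: mult_ac)
    moreover have "\<beta> * vd > 0" using b vd by simp
    ultimately show ?thesis using e unfolding \<gamma>_def by linarith
  qed
  define g where "g n = sqrt (8 * pi / (\<beta> * real n))" for n :: nat
  let ?M = "lebesgue_on {-pi..pi}"
  interpret M: finite_measure ?M by (rule finite_measure_lebesgue_on) auto
  interpret P: product_sigma_finite "\<lambda>_. ?M" by standard
  define G where "G n = (LINT \<theta>|?M. exp (- \<alpha> n * (1 - cos (\<theta> - c))))" for n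
  have "\<forall>\<^sub>F n in sequentially. G n \<le> g n * exp e"
    using integral_exp_cos_asymp[OF c b e(1)] by (simp add: G_def g_def \<alpha>_def)
  note G_le = this
  have kK: "\<beta> / 8 * \<kappa> > 0" "e + K' > 0" using b \<kappa> e K' by auto
  show ?thesis
    using G_le rest_scale_bounds[OF b \<open>\<gamma> > 0\<close> kK] eventually_gt_at_top[of 0]
  proof eventually_elim
    case (elim n)
    have n: "real n > 0" using elim by simp
    have E2: "(2 * pi) ^ n * exp (- (\<beta> / 8 * \<kappa>) * (real n)\<^sup>2 + (e + K') * real n) \<le> gauss_volume \<beta> n / (2 * real n)"
      by (rule elim(3))
    have \<alpha>: "\<alpha> n > 0" using b n by (simp add: \<alpha>_def)
    have gp: "g n > 0" using b n by (simp add: g_def)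
    have g: "g n ^ n = gauss_volume \<beta> n"
    proof -
      have "g n = (8 * pi / (\<beta> * real n)) powr (1/2)" using b n by (simp add: g_def powr_half_sqrt)
      then show ?thesis using b n by (simp add: powr_power)
    qed
    \<comment> \<open>A product weight in which coordinate \<open>j\<close> is forced to be far.
      Summing over \<open>j\<close> is a union bound for the presence of a far point, and every
      summand still factors over the coordinates.\<close>
    define w where "w j i y = (if i = j then indicator {y. \<delta> < \<bar>y - c\<bar>} y else 1) * exp (- \<alpha> n * (1 - cos (y - c)))"
      for i j :: nat and y :: real
    have w0: "0 \<le> w j i y" for j i y by (simp add: w_def)
    have wm: "w j i \<in> borel_measurable ?M" for i j
      unfolding w_def by (cases "i = j") (auto intro!: measurable_restrict_space1 measurable_completion)
    have wi: "integrable ?M (w j i)" for i j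
      using \<alpha> by (intro M.integrable_const_bound[where B=1] AE_I2 wm) (auto simp: w_def abs_mult indicator_def mult_nonneg_nonneg)
    have wG: "integral\<^sup>L ?M (w j i) = G n" if "i \<noteq> j" for i j
    proof -
      have "w j i = (\<lambda>\<theta>. exp (- \<alpha> n * (1 - cos (\<theta> - c))))" using that by (auto simp: w_def)
      then show ?thesis by (simp add: G_def)
    qed
    have wj: "integral\<^sup>L ?M (w j j) \<le> 2 * pi * exp (- \<alpha> n * vd)" for j
    proof -
      have "integral\<^sup>L ?M (w j j) \<le> (LINT y|?M. exp (- \<alpha> n * vd))"
      proof (rule integral_mono')
        fix y assume "y \<in> space ?M"
        then have "\<bar>y - c\<bar> \<le> 3 * pi / 2" using abs_diff_half_pi_le[OF _ c] by simp
        then show "w j j y \<le> exp (- \<alpha> n * vd)"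
          using \<alpha> cos_le_cos_far[of \<delta> "y - c"] \<delta> by (auto simp: w_def indicator_def vd_def)
      qed auto
      then show ?thesis by (simp add: measure_restrict_space)
    qed
    have G0: "0 \<le> G n" by (auto simp: G_def)
    have wprod: "(LINT \<theta>|Pi\<^sub>M {1..n} (\<lambda>_. ?M). (\<Prod>i\<in>{1..n}. w j i (\<theta> i))) \<le> 2 * pi * exp (- \<alpha> n * vd) * (g n * exp e) ^ (n - 1)"
      if j: "j \<in> {1..n}" for j
    proof -
      have "(LINT \<theta>|Pi\<^sub>M {1..n} (\<lambda>_. ?M). (\<Prod>i\<in>{1..n}. w j i (\<theta> i))) = (\<Prod>i\<in>{1..n}. integral\<^sup>L ?M (w j i))"
        by (rule P.product_integral_prod) (auto intro: wi)
      also have "\<dots> = integral\<^sup>L ?M (w j j) * (\<Prod>i\<in>{1..n} - {j}. integral\<^sup>L ?M (w j i))"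
        using j by (subst prod.remove[of _ j]) auto
      also have "(\<Prod>i\<in>{1..n} - {j}. integral\<^sup>L ?M (w j i)) = G n ^ (n - 1)"
        using j by (simp add: wG)
      also have "integral\<^sup>L ?M (w j j) * G n ^ (n - 1) \<le> 2 * pi * exp (- \<alpha> n * vd) * (g n * exp e) ^ (n - 1)"
        using elim(1) G0 wj by (intro mult_mono power_mono) (auto intro!: integral_nonneg_AE simp: w0)
      finally show ?thesis .
    qed
    \<comment> \<open>Up to the factor exp (n h(c)), \<open>W\<close> dominates the integrand if U
      \<le> \<kappa> n and the constant \<open>E\<close> does if \<kappa> n < U \<le> n. Using their
      sum avoids splitting the integral.\<close>
    define E where "E = exp (- (\<beta> / 8 * \<kappa>) * (real n)\<^sup>2 + (e + K') * real n)"
    define W where "W \<theta> = exp (2 * e * real n) * (\<Sum>j\<in>{1..n}. \<Prod>i\<in>{1..n}. w j i (\<theta> i))" for \<theta> :: "nat \<Rightarrow> real"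
    have W0: "0 \<le> W \<theta>" for \<theta> unfolding W_def by (intro mult_nonneg_nonneg sum_nonneg prod_nonneg) (auto simp: w0)
    have wpi: "integrable (Pi\<^sub>M {1..n} (\<lambda>_. ?M)) (\<lambda>\<theta>. \<Prod>i\<in>{1..n}. w j i (\<theta> i))" for j
      by (rule P.product_integrable_prod) (auto intro: wi)
    have Wi: "integrable (Pi\<^sub>M {1..n} (\<lambda>_. ?M)) W"
      unfolding W_def by (intro integrable_mult_right Bochner_Integration.integrable_sum wpi)
    have one: "integrable (Pi\<^sub>M {1..n} (\<lambda>_. ?M)) (\<lambda>\<theta>. 1::real)" "(LINT \<theta>|Pi\<^sub>M {1..n} (\<lambda>_. ?M). 1::real) = (2 * pi) ^ n"
      using P.product_integrable_prod[of "{1..n}" "\<lambda>_ _. 1::real"] P.product_integral_prod[of "{1..n}" "\<lambda>_ _. 1::real"]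
      by (auto simp: measure_restrict_space)
    have cnst: "integrable (Pi\<^sub>M {1..n} (\<lambda>_. ?M)) (\<lambda>\<theta>. E)" "(LINT \<theta>|Pi\<^sub>M {1..n} (\<lambda>_. ?M). E) = (2 * pi) ^ n * E"
      using integrable_mult_right[OF one(1), of E] arg_cong[OF one(2), of "\<lambda>t. E * t"]
      unfolding integral_mult_right_zero[symmetric] by (auto simp: mult.commute)
    have Wint: "integral\<^sup>L (Pi\<^sub>M {1..n} (\<lambda>_. ?M)) W \<le> gauss_volume \<beta> n / (2 * real n)"
    proof -
      have "integral\<^sup>L (Pi\<^sub>M {1..n} (\<lambda>_. ?M)) W = exp (2 * e * real n) * (\<Sum>j\<in>{1..n}. LINT \<theta>|Pi\<^sub>M {1..n} (\<lambda>_. ?M). (\<Prod>i\<in>{1..n}. w j i (\<theta> i)))"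
        unfolding W_def integral_mult_right_zero by (subst Bochner_Integration.integral_sum) (rule wpi, rule refl)
      also have "\<dots> \<le> exp (2 * e * real n) * (\<Sum>j\<in>{1..n}. 2 * pi * exp (- \<alpha> n * vd) * (g n * exp e) ^ (n - 1))"
        by (intro mult_left_mono sum_mono wprod) auto
      also have "\<dots> = 2 * pi * real n * (exp (2 * e * real n) * exp (- \<alpha> n * vd)) * (g n * exp e) ^ (n - 1)"
        by simp
      \<comment> \<open>The far coordinate leaves only n - 1 Gaussian integrals. Completing the
        power to \<open>g n ^ n\<close> costs 1 / g n, of order sqrt n, which exp (- \<gamma> n)
        absorbs.\<close>
      also have "\<dots> \<le> 2 * pi * real n * (exp (2 * e * real n) * exp (- \<alpha> n * vd)) * (g n ^ n / g n * exp (e * real n))"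
      proof (intro mult_left_mono)
        have "g n ^ n / g n = g n ^ (n - 1)" using gp elim by (cases n) auto
        moreover have "exp e ^ (n - 1) \<le> exp e ^ n" using e by (intro power_increasing) auto
        ultimately show "(g n * exp e) ^ (n - 1) \<le> g n ^ n / g n * exp (e * real n)"
          using gp by (simp add: power_mult_distrib exp_of_nat_mult mult.commute[of e] mult_left_mono)
      qed auto
      also have "\<dots> = 2 * pi * real n * (exp (2 * e * real n) * exp (- \<alpha> n * vd) * exp (e * real n)) / g n * g n ^ n"
        by simp
      also have "exp (2 * e * real n) * exp (- \<alpha> n * vd) * exp (e * real n) = exp (- \<gamma> * real n)"
        by (simp add: \<gamma>_def \<alpha>_def algebra_simps flip: exp_add)
      also have "2 * pi * real n * exp (- \<gamma> * real n) / g n * g n ^ n \<le> 1 / (2 * real n) * g n ^ n"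
        using elim(2) gp unfolding g_def[symmetric] by (intro mult_right_mono) auto
      finally show ?thesis by (simp add: g)
    qed
    \<comment> \<open>All conditions on n are settled before \<open>h\<close> is fixed, so the
      threshold depends on \<open>h\<close> only through \<open>B\<close> and \<open>L\<close>. The
      uniformity in t rests on this.\<close>
    show ?case
    proof (intro allI impI)
      fix h :: "real \<Rightarrow> real"
      assume h: "\<forall>x. \<bar>h x\<bar> \<le> B" "\<forall>y. \<bar>y\<bar> \<le> \<delta> \<longrightarrow> \<bar>h (c + y) - h c\<bar> \<le> L * \<bar>y\<bar>"
      let ?P = "Pi\<^sub>M {1..n} (\<lambda>_. ?M)"
      let ?A = "(far \<delta> c n)"
      have "(LINT \<theta>|?P. indicator ?A \<theta> * (kernel \<beta> c n \<theta> * (\<Prod>j\<in>{1..n}. exp (h (\<theta> j)))))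
        \<le> (LINT \<theta>|?P. exp (real n * h c) * (W \<theta> + E))"
      proof (rule integral_mono')
        show "integrable ?P (\<lambda>\<theta>. exp (real n * h c) * (W \<theta> + E))"
          using Wi cnst by auto
        show "0 \<le> exp (real n * h c) * (W \<theta> + E)" for \<theta> using W0[of \<theta>] by (simp add: E_def add_nonneg_nonneg)
        fix \<theta> assume sp: "\<theta> \<in> space ?P"
        then have \<theta>: "\<theta> j \<in> {-pi..pi}" if "j \<in> {1..n}" for j using that by (auto simp: space_PiM PiE_iff)
        define U where "U = (\<Sum>j\<in>{1..n}. 1 - cos (\<theta> j - c))"
        have U0: "0 \<le> U" unfolding U_def by (intro sum_nonneg) auto
        show "indicator ?A \<theta> * (kernel \<beta> c n \<theta> * (\<Prod>j\<in>{1..n}. exp (h (\<theta> j))))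
          \<le> exp (real n * h c) * (W \<theta> + E)"
        proof (cases "\<theta> \<in> ?A")
          case True
          then have Un: "U \<le> real n" and "\<exists>j\<in>{1..n}. \<delta> < \<bar>\<theta> j - c\<bar>" by (auto simp: U_def)
          then obtain j0 where j0: "j0 \<in> {1..n}" "\<delta> < \<bar>\<theta> j0 - c\<bar>" by auto
          have "(\<Sum>j\<in>{1..n}. h (\<theta> j)) \<le> (\<Sum>j\<in>{1..n}. h c + e + K * (1 - cos (\<theta> j - c)))"
          proof (rule sum_mono)
            fix j assume "j \<in> {1..n}"
            then have "h (\<theta> j) - h c \<le> e + K * (1 - cos (\<theta> j - c))"
              using h by (intro K(2) \<theta>) blast+
            then show "h (\<theta> j) \<le> h c + e + K * (1 - cos (\<theta> j - c))" by linarith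
          qed
          also have "\<dots> = real n * h c + e * real n + K * U"
            unfolding sum.distrib U_def sum_distrib_left[symmetric] by (simp add: mult.commute)
          finally have "(\<Prod>j\<in>{1..n}. exp (h (\<theta> j))) \<le> exp (real n * h c + e * real n + K * U)"
            by (simp flip: exp_sum)
          moreover have "kernel \<beta> c n \<theta> \<le> exp (- (\<beta> / 8) * (U * (2 * real n - U) - 4 * U))"
            using prod_pairs_cos_le[OF b, where n=n and y="\<lambda>j. \<theta> j - c"] by (simp add: U_def)
          ultimately have "kernel \<beta> c n \<theta> * (\<Prod>j\<in>{1..n}. exp (h (\<theta> j)))
            \<le> exp (- (\<beta> / 8) * (U * (2 * real n - U) - 4 * U)) * exp (real n * h c + e * real n + K * U)"
            by (intro mult_mono) (auto intro!: prod_nonneg)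
          also have "\<dots> = exp (real n * h c) * exp (e * real n + K' * U - \<beta> / 8 * (U * (2 * real n - U)))"
            by (simp add: K'_def algebra_simps flip: exp_add)
          also have "exp (e * real n + K' * U - \<beta> / 8 * (U * (2 * real n - U))) \<le> W \<theta> + E"
          proof (cases "U \<le> \<kappa> * real n")
            case True
            have "K' * U \<le> K' * (\<kappa> * real n)" using True K' by (intro mult_left_mono) auto
            also have "\<dots> \<le> e * real n" using mult_right_mono[OF \<kappa>(2), of "real n"] by (simp add: mult_ac)
            finally have 1: "K' * U \<le> e * real n" .
            have "2 * exp (- e) * real n \<le> 2 * real n - U"
              using mult_right_mono[OF \<kappa>(3), of "2 * real n"] True by (simp add: algebra_simps)
            then have "\<beta> / 8 * (U * (2 * exp (- e) * real n)) \<le> \<beta> / 8 * (U * (2 * real n - U))"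
              using b U0 by (intro mult_left_mono) auto
            then have "\<alpha> n * U \<le> \<beta> / 8 * (U * (2 * real n - U))" by (simp add: \<alpha>_def mult_ac)
            then have "e * real n + K' * U - \<beta> / 8 * (U * (2 * real n - U)) \<le> 2 * e * real n + - \<alpha> n * U"
              using 1 by simp
            then have "exp (e * real n + K' * U - \<beta> / 8 * (U * (2 * real n - U))) \<le> exp (2 * e * real n) * exp (- \<alpha> n * U)"
              by (simp flip: exp_add)
            also have "exp (- \<alpha> n * U) = (\<Prod>i\<in>{1..n}. w j0 i (\<theta> i))"
              using j0 by (auto simp: w_def U_def exp_sum sum_distrib_left sum_negf[symmetric] simp del: sum_negf intro!: prod.cong)
            also have "\<dots> \<le> (\<Sum>j\<in>{1..n}. \<Prod>i\<in>{1..n}. w j i (\<theta> i))"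
              using j0(1) by (intro member_le_sum) (auto intro!: prod_nonneg w0)
            finally have "exp (e * real n + K' * U - \<beta> / 8 * (U * (2 * real n - U))) \<le> W \<theta>"
              by (simp add: W_def)
            then show ?thesis by (simp add: E_def add_increasing2)
          next
            case False
            have "\<kappa> * (real n)\<^sup>2 \<le> U * (2 * real n - U)"
              using mult_mono[of "\<kappa> * real n" U "real n" "2 * real n - U"] False Un U0 n
              by (simp add: power2_eq_square mult.assoc)
            then have "\<beta> / 8 * (\<kappa> * (real n)\<^sup>2) \<le> \<beta> / 8 * (U * (2 * real n - U))"
              using b by (intro mult_left_mono) auto
            moreover have "K' * U \<le> K' * real n" using Un K' by (intro mult_left_mono) auto
            ultimately have "exp (e * real n + K' * U - \<beta> / 8 * (U * (2 * real n - U))) \<le> E"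
              by (simp add: E_def algebra_simps)
            then show ?thesis using W0[of \<theta>] by linarith
          qed
          finally show ?thesis using True by simp
        next
          case False
          then show ?thesis using W0[of \<theta>] by (simp add: E_def add_nonneg_nonneg)
        qed
      qed
      also have "\<dots> = exp (real n * h c) * (integral\<^sup>L ?P W + (2 * pi) ^ n * E)"
        using Wi cnst by simp
      also have "\<dots> \<le> exp (real n * h c) * (gauss_volume \<beta> n / (2 * real n) + gauss_volume \<beta> n / (2 * real n))"
        using Wint E2 unfolding E_def by (intro mult_left_mono add_mono) auto
      also have "\<dots> = gauss_volume \<beta> n * exp (real n * h c) / real n"
        using n by (simp add: field_simps)
      finally show "(LINT \<theta>|?P. indicator ?A \<theta> * (kernel \<beta> c n \<theta> * (\<Prod>j\<in>{1..n}. exp (h (\<theta> j)))))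
        \<le> gauss_volume \<beta> n * exp (real n * h c) / real n" .
    qed
  qed
qed

section \<open>Power sums under the Gaussian measure\<close>

definition power_sum :: "real \<Rightarrow> nat \<Rightarrow> nat \<Rightarrow> (nat \<Rightarrow> real) \<Rightarrow> real" where
  "power_sum c n k \<omega> = (\<Sum>j\<in>{1..n}. (\<omega> j - c) ^ k)"

lemma power_sum_even_nonneg: "even k \<Longrightarrow> 0 \<le> power_sum c n k \<omega>"
  by (auto simp: power_sum_def intro!: sum_nonneg)

lemma power_sum_first_moment:
  assumes "s > 0"
  shows "integrable (gauss_pow c s n) (power_sum c n (2*k))"
    and "(LINT \<omega>|gauss_pow c s n. power_sum c n (2*k) \<omega>) = real n * gaussian_moment k s"
  using product_first_moment[OF prob_space_gauss[OF assms] finite_atLeastAtMost[of 1 n] gauss_moments(1)[OF assms, of c k]]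
  by (simp_all add: power_sum_def[abs_def] gauss_moments(2)[OF assms])

lemma power_sum_odd_second_moment:
  assumes "s > 0"
  shows "integrable (gauss_pow c s n) (\<lambda>\<omega>. (power_sum c n (2*k+1) \<omega>)\<^sup>2)" (is ?A)
    and "(LINT \<omega>|gauss_pow c s n. (power_sum c n (2*k+1) \<omega>)\<^sup>2) = real n * gaussian_moment (2*k+1) s" (is ?B)
proof -
  have e: "((x - c) ^ (2*k+1))\<^sup>2 = (x - c) ^ (2*(2*k+1))" for x :: real
    by (metis mult.commute power_mult)
  note m = product_second_moment[OF prob_space_gauss[OF assms] finite_atLeastAtMost[of 1 n] gauss_moments(3)[OF assms, of c k]]
  show ?A
    ?B
    using m gauss_moments[OF assms, of c] unfolding power_sum_def e by (simp_all del: mult_Suc_right)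
qed

lemma power_sum_variance:
  assumes s: "s > 0"
  shows "integrable (gauss_pow c s n) (\<lambda>\<omega>. (power_sum c n (2*k) \<omega> - real n * gaussian_moment k s)\<^sup>2)" (is ?A)
    and "(LINT \<omega>|gauss_pow c s n. (power_sum c n (2*k) \<omega> - real n * gaussian_moment k s)\<^sup>2) = real n * (gaussian_moment (2*k) s - (gaussian_moment k s)\<^sup>2)" (is ?B)
proof -
  interpret G: prob_space "gauss c s" by (rule prob_space_gauss[OF s])
  define h where "h x = (x - c) ^ (2*k) - gaussian_moment k s" for x
  have sq: "(h x)\<^sup>2 = (x - c) ^ (2*(2*k)) - 2 * gaussian_moment k s * (x - c) ^ (2*k) + (gaussian_moment k s)\<^sup>2" for x
    by (simp add: h_def power2_diff power_mult[symmetric] mult.commute[of "2*k"])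
  have i1: "integrable (gauss c s) h"
    unfolding h_def by (intro Bochner_Integration.integrable_diff gauss_moments(1)[OF s] G.integrable_const)
  have i2: "integrable (gauss c s) (\<lambda>x. (h x)\<^sup>2)"
    unfolding sq by (intro Bochner_Integration.integrable_add Bochner_Integration.integrable_diff integrable_mult_right gauss_moments(1)[OF s] G.integrable_const)
  have z: "(LINT x|gauss c s. h x) = 0"
    unfolding h_def using gauss_moments(1,2)[OF s, of c k] by (simp add: G.prob_space[simplified])
  have v: "(LINT x|gauss c s. (h x)\<^sup>2) = gaussian_moment (2*k) s - (gaussian_moment k s)\<^sup>2"
    unfolding sq using gauss_moments(1,2)[OF s, of c k] gauss_moments(1,2)[OF s, of c "2*k"]
    by (simp add: G.prob_space[simplified] power2_eq_square)
  have e: "(\<Sum>j\<in>{1..n}. h (\<omega> j)) = power_sum c n (2*k) \<omega> - real n * gaussian_moment k s" for \<omega>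
    by (simp add: h_def power_sum_def sum_subtractf)
  note m = product_second_moment[OF G.prob_space_axioms finite_atLeastAtMost[of 1 n] i1 i2 z]
  show ?A
    ?B
    using m unfolding e v by simp_all
qed

text \<open>At the limiting value l = 1 / (4 s^2) half of the exponent of the density is used up;
  what remains is sqrt 2 times the density of variance 2 s^2.\<close>

lemma gauss_exp_square_le:
  assumes s: "s > 0" and l: "l \<le> 1 / (4 * s\<^sup>2)"
  shows "integrable (gauss c s) (\<lambda>x. exp (l * (x - c)\<^sup>2))" (is ?A)
    and "(LINT x|gauss c s. exp (l * (x - c)\<^sup>2)) \<le> sqrt 2" (is ?B)
proof -
  let ?g = "\<lambda>x. sqrt 2 * normal_density c (sqrt 2 * s) x"
  have le: "normal_density c s x * exp (l * (x - c)\<^sup>2) \<le> ?g x" for x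
  proof -
    have "l * (x - c)\<^sup>2 \<le> 1 / (4 * s\<^sup>2) * (x - c)\<^sup>2" using l by (rule mult_right_mono) simp
    then have "exp (- (x - c)\<^sup>2 / (2 * s\<^sup>2)) * exp (l * (x - c)\<^sup>2) \<le> exp (- (x - c)\<^sup>2 / (2 * s\<^sup>2) + 1 / (4 * s\<^sup>2) * (x - c)\<^sup>2)"
      by (simp flip: exp_add)
    also have "- (x - c)\<^sup>2 / (2 * s\<^sup>2) + 1 / (4 * s\<^sup>2) * (x - c)\<^sup>2 = - (x - c)\<^sup>2 / (2 * (sqrt 2 * s)\<^sup>2)"
      using s by (simp add: power_mult_distrib field_simps)
    finally have "1 / sqrt (2 * pi * s\<^sup>2) * (exp (- (x - c)\<^sup>2 / (2 * s\<^sup>2)) * exp (l * (x - c)\<^sup>2)) \<le> 1 / sqrt (2 * pi * s\<^sup>2) * exp (- (x - c)\<^sup>2 / (2 * (sqrt 2 * s)\<^sup>2))"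
      by (rule mult_left_mono) simp
    also have "1 / sqrt (2 * pi * s\<^sup>2) * exp (- (x - c)\<^sup>2 / (2 * (sqrt 2 * s)\<^sup>2)) =
      sqrt 2 * (1 / sqrt (2 * pi * (sqrt 2 * s)\<^sup>2) * exp (- (x - c)\<^sup>2 / (2 * (sqrt 2 * s)\<^sup>2)))"
    proof -
      have "2 * pi * (sqrt 2 * s)\<^sup>2 = 2 * (2 * pi * s\<^sup>2)" by (simp add: power_mult_distrib)
      then have "sqrt (2 * pi * (sqrt 2 * s)\<^sup>2) = sqrt 2 * sqrt (2 * pi * s\<^sup>2)"
        by (simp only: real_sqrt_mult[of 2 "2 * pi * s\<^sup>2"])
      then show ?thesis by simp
    qed
    finally show ?thesis by (simp add: normal_density_def mult.assoc)
  qed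
  have ig: "integrable lborel ?g" using s by simp
  have il: "integrable lborel (\<lambda>x. normal_density c s x * exp (l * (x - c)\<^sup>2))"
    by (rule Bochner_Integration.integrable_bound[OF ig]) (use le in \<open>auto intro!: AE_I2 simp: abs_mult\<close>)
  have "(LINT x|lborel. normal_density c s x * exp (l * (x - c)\<^sup>2)) \<le> (LINT x|lborel. ?g x)"
    by (rule integral_mono[OF il ig le])
  also have "\<dots> = sqrt 2" using s by simp
  finally show ?A ?B
    using has_bochner_integral_gauss[OF _ has_bochner_integral_integrable[OF il]] by auto
qed

lemma power_sum_exp_moment:
  assumes s: "s > 0" and l: "l \<le> 1 / (4 * s\<^sup>2)"
  shows "integrable (gauss_pow c s n) (\<lambda>\<omega>. exp (l * power_sum c n 2 \<omega>))" (is ?A)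
    and "(LINT \<omega>|gauss_pow c s n. exp (l * power_sum c n 2 \<omega>)) \<le> sqrt 2 ^ n" (is ?B)
proof -
  interpret G: prob_space "gauss c s" by (rule prob_space_gauss[OF s])
  interpret P: product_sigma_finite "\<lambda>_. gauss c s" by standard
  have e: "exp (l * power_sum c n 2 \<omega>) = (\<Prod>j\<in>{1..n}. exp (l * (\<omega> j - c)\<^sup>2))" for \<omega>
    by (simp add: power_sum_def exp_sum sum_distrib_left)
  note i = gauss_exp_square_le[OF s l, of c]
  show ?A
    unfolding e using i by (intro P.product_integrable_prod) auto
  have "(LINT \<omega>|gauss_pow c s n. exp (l * power_sum c n 2 \<omega>)) = (LINT x|gauss c s. exp (l * (x - c)\<^sup>2)) ^ n"
    unfolding e using i by (subst P.product_integral_prod) auto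
  also have "\<dots> \<le> sqrt 2 ^ n" using i by (intro power_mono) auto
  finally show ?B .
qed

text \<open>Each error term of the local expansion is bounded by one of these summands. The weights \<open>sqrt n\<close> come from the
  arithmetic-geometric mean inequality, which leaves only second moments of centered sums to be computed. The last summand bounds
  the Hoelder remainder \<open>\<Sum>\<bar>x\<^sub>j\<bar> powr (2 + q)\<close>, by interpolation at the scale of the standard deviation.\<close>

definition fluctuation :: "real \<Rightarrow> real \<Rightarrow> real \<Rightarrow> nat \<Rightarrow> (nat \<Rightarrow> real) \<Rightarrow> real" where
  "fluctuation \<beta> q c n \<omega> =
     1 / sqrt (real n) + sqrt (real n) * (power_sum c n 2 \<omega> - 4 / \<beta>)\<^sup>2
     + sqrt (real n) * (real n)\<^sup>2 * (power_sum c n 4 \<omega> - 48 / (\<beta>\<^sup>2 * real n))\<^sup>2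
     + (power_sum c n 1 \<omega>)\<^sup>2 / sqrt (real n) + sqrt (real n) * (power_sum c n 3 \<omega>)\<^sup>2
     + power_sum c n 4 \<omega> + real n * power_sum c n 6 \<omega>
     + ((2 / sqrt (\<beta> * real n)) powr q * power_sum c n 2 \<omega> + (2 / sqrt (\<beta> * real n)) powr (q - 2) * power_sum c n 4 \<omega>)"

text \<open>All summands but the last have expectation of order n^(-1/2) or smaller. The last one
  gives a constant times s^q with s = 2 / sqrt (\<beta> n), hence n^(-q/2), which dominates because
  q \<le> 1.\<close>

lemma fluctuation_expectation:
  assumes b: "\<beta> > 0" and q: "0 < q" "q \<le> 1"
  obtains C where "0 \<le> C"
    "\<And>n. n \<ge> 1 \<Longrightarrow> integrable (gauss_pow c (2 / sqrt (\<beta> * real n)) n) (fluctuation \<beta> q c n)"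
    "\<And>n. n \<ge> 1 \<Longrightarrow> (LINT \<omega>|gauss_pow c (2 / sqrt (\<beta> * real n)) n. fluctuation \<beta> q c n \<omega>) \<le> C * real n powr (- q / 2)"
proof -
  \<comment> \<open>Moments at s^2 = 4 / (\<beta> n): 32 = 2 * 4^2 and 24576 = 96 * 4^4 belong to
    the variances 2 s^4 and 96 s^8 of x^2 and x^4, 48 = 3 * 4^2 and 960 = 15 * 4^3 to the fourth and
    sixth moments, and 16 / \<beta> = 4 / \<beta> + 12 / \<beta> to the two parts of the last
    summand.\<close>
  define C where "C = 1 + 32 / \<beta>^2 + 24576 / \<beta>^4 + 4 / \<beta> + 960 / \<beta>^3 + 48 / \<beta>^2 + 960 / \<beta>^3 + 16 / \<beta> * (2 / sqrt \<beta>) powr q"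
  have main: "integrable (gauss_pow c (2 / sqrt (\<beta> * real n)) n) (fluctuation \<beta> q c n) \<and>
     (LINT \<omega>|gauss_pow c (2 / sqrt (\<beta> * real n)) n. fluctuation \<beta> q c n \<omega>) \<le> C * real n powr (- q / 2)" if n: "n \<ge> 1" for n
  proof -
    define s where "s = 2 / sqrt (\<beta> * real n)"
    have s: "s > 0" "s\<^sup>2 = 4 / (\<beta> * real n)" using b n by (auto simp: s_def power_divide)
    have s4: "s ^ 4 = 16 / (\<beta>^2 * (real n)^2)" "s ^ 6 = 64 / (\<beta>^3 * (real n)^3)" "s ^ 8 = 256 / (\<beta>^4 * (real n)^4)"
      using arg_cong[OF s(2), of "\<lambda>x. x^2"] arg_cong[OF s(2), of "\<lambda>x. x^3"] arg_cong[OF s(2), of "\<lambda>x. x^4"]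
      by (simp_all add: power_mult[symmetric] power_divide power_mult_distrib)
    let ?P = "gauss_pow c s n"
    interpret G: prob_space "gauss c s" by (rule prob_space_gauss[OF s(1)])
    interpret P: prob_space ?P by (intro prob_space_PiM prob_space_gauss s(1))
    have n0: "real n > 0" using n by simp
    have m1: "integrable ?P (\<lambda>\<omega>. (power_sum c n 2 \<omega> - 4 / \<beta>)\<^sup>2)" (is ?A) "(LINT \<omega>|?P. (power_sum c n 2 \<omega> - 4 / \<beta>)\<^sup>2) = 32 / (\<beta>^2 * real n)" (is ?B)
    proof -
      have "real n * gaussian_moment (Suc 0) s = 4 / \<beta>" using n0 b by (simp add: gaussian_moment_simps[OF s(1)] s)
      moreover have "real n * (gaussian_moment 2 s - (gaussian_moment (Suc 0) s)\<^sup>2) = 32 / (\<beta>^2 * real n)"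
      proof -
        have "gaussian_moment 2 s - (gaussian_moment (Suc 0) s)\<^sup>2 = 2 * s ^ 4" by (simp add: gaussian_moment_simps[OF s(1)] flip: power_mult)
        then show ?thesis using n0 b by (simp add: s4 power2_eq_square)
      qed
      ultimately show ?A ?B
        using power_sum_variance[OF s(1), of n c 1] by simp_all
    qed
    have m2: "integrable ?P (\<lambda>\<omega>. (power_sum c n 4 \<omega> - 48 / (\<beta>\<^sup>2 * real n))\<^sup>2)" (is ?A) "(LINT \<omega>|?P. (power_sum c n 4 \<omega> - 48 / (\<beta>\<^sup>2 * real n))\<^sup>2) = 24576 / (\<beta>^4 * (real n)^3)" (is ?B)
    proof -
      have "real n * gaussian_moment 2 s = 48 / (\<beta>\<^sup>2 * real n)" using n0 b by (simp add: gaussian_moment_simps[OF s(1)] s4 power2_eq_square)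
      moreover have "real n * (gaussian_moment 4 s - (gaussian_moment 2 s)\<^sup>2) = 24576 / (\<beta>^4 * (real n)^3)"
      proof -
        have e: "gaussian_moment 4 s - (gaussian_moment 2 s)\<^sup>2 = 96 * s ^ 8" by (simp add: gaussian_moment_simps[OF s(1)] power_mult_distrib flip: power_mult)
        show ?thesis unfolding e s4 using n0 b by (simp add: eval_nat_numeral)
      qed
      ultimately show ?A ?B
        using power_sum_variance[OF s(1), of n c 2] by simp_all
    qed
    have m3: "integrable ?P (\<lambda>\<omega>. (power_sum c n 1 \<omega>)\<^sup>2)" "(LINT \<omega>|?P. (power_sum c n 1 \<omega>)\<^sup>2) = 4 / \<beta>"
      using power_sum_odd_second_moment[OF s(1), of n c 0] n0 b gaussian_moment_simps(1)[OF s(1)] by (simp_all add: s)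
    have m4: "integrable ?P (\<lambda>\<omega>. (power_sum c n 3 \<omega>)\<^sup>2)" (is ?A) "(LINT \<omega>|?P. (power_sum c n 3 \<omega>)\<^sup>2) = 960 / (\<beta>^3 * (real n)^2)" (is ?B)
    proof -
      have "real n * gaussian_moment 3 s = 960 / (\<beta>^3 * (real n)^2)"
        using n0 b by (simp add: gaussian_moment_simps[OF s(1)] s4 power2_eq_square power3_eq_cube)
      moreover have "2 * 1 + 1 = (3::nat)" by simp
      ultimately show ?A ?B
        using power_sum_odd_second_moment[OF s(1), of n c 1] by (simp_all only:)
    qed
    have m5: "integrable ?P (power_sum c n 4)" "(LINT \<omega>|?P. power_sum c n 4 \<omega>) = 48 / (\<beta>^2 * real n)"
      using power_sum_first_moment[OF s(1), of n c 2] n0 b gaussian_moment_simps(2)[OF s(1)]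
      by (simp_all add: s4 power2_eq_square)
    have m6: "integrable ?P (power_sum c n 6)" "(LINT \<omega>|?P. power_sum c n 6 \<omega>) = 960 / (\<beta>^3 * (real n)^2)"
      using power_sum_first_moment[OF s(1), of n c 3] n0 b gaussian_moment_simps(3)[OF s(1)]
      by (simp_all add: s4 power2_eq_square power3_eq_cube)
    have m7: "integrable ?P (power_sum c n 2)" "(LINT \<omega>|?P. power_sum c n 2 \<omega>) = 4 / \<beta>"
      using power_sum_first_moment[OF s(1), of n c 1] n0 b gaussian_moment_simps(1)[OF s(1)] by (simp_all add: s)
    have m0: "has_bochner_integral ?P (\<lambda>\<omega>. 1 / sqrt (real n)) (1 / sqrt (real n))"
      using P.prob_space unfolding has_bochner_integral_iff by (intro conjI P.integrable_const) simp
    note m = m1 m2 m3 m4 m5 m6 m7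
    let ?v = "1 / sqrt (real n) + sqrt (real n) * (32 / (\<beta>^2 * real n))
     + sqrt (real n) * (real n)\<^sup>2 * (24576 / (\<beta>^4 * (real n)^3))
     + (4 / \<beta>) / sqrt (real n) + sqrt (real n) * (960 / (\<beta>^3 * (real n)^2))
     + 48 / (\<beta>^2 * real n) + real n * (960 / (\<beta>^3 * (real n)^2))
     + (s powr q * (4 / \<beta>) + s powr (q - 2) * (48 / (\<beta>^2 * real n)))"
    have hb: "has_bochner_integral ?P (fluctuation \<beta> q c n) ?v"
      unfolding fluctuation_def[abs_def] s_def[symmetric]
      by (intro m0 has_bochner_integral_add has_bochner_integral_mult_right has_bochner_integral_divide)
        (simp_all add: has_bochner_integral_iff m del: One_nat_def)
    then have di: "integrable ?P (fluctuation \<beta> q c n)" by (simp add: has_bochner_integral_iff)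
    have "(LINT \<omega>|?P. fluctuation \<beta> q c n \<omega>) =
     ?v"
      using hb by (simp only: has_bochner_integral_iff)
    also have "\<dots> \<le> C * real n powr (- q / 2)"
    proof -
      define r where "r = real n powr (- q / 2)"
      have r0: "r > 0" using n0 by (simp add: r_def)
      have rs: "1 / sqrt (real n) \<le> r"
      proof -
        have "1 / sqrt (real n) = real n powr (- 1 / 2)" using n0 by (simp add: powr_minus_divide powr_half_sqrt)
        also have "\<dots> \<le> r" unfolding r_def using n q by (intro powr_mono) auto
        finally show ?thesis .
      qed
      have sq: "sqrt (real n) * sqrt (real n) = real n" by simp
      have ge1: "1 \<le> sqrt (real n)" using n by simp
      have rn: "sqrt (real n) / real n \<le> r" using rs n0 by (simp add: sqrt_divide_self_eq inverse_eq_divide)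
      have rn1: "1 / real n \<le> r"
      proof -
        have "1 / real n \<le> sqrt (real n) / real n" using ge1 n0 by (intro divide_right_mono) auto
        then show ?thesis using rn by simp
      qed
      have rn2: "sqrt (real n) / (real n)^2 \<le> r"
      proof -
        have "sqrt (real n) / (real n)^2 \<le> sqrt (real n) / real n" using n n0
          by (intro divide_left_mono) (auto simp: power2_eq_square)
        then show ?thesis using rn by simp
      qed
      have sp: "s powr q = (2 / sqrt \<beta>) powr q * r"
      proof -
        have "s = (2 / sqrt \<beta>) * real n powr (- 1 / 2)"
          using n0 by (simp add: s_def real_sqrt_mult powr_minus_divide powr_half_sqrt)
        then have "s powr q = (2 / sqrt \<beta>) powr q * (real n powr (- 1 / 2)) powr q"
          using b by (simp only: powr_mult)
        then show ?thesis by (simp add: powr_powr r_def)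
      qed
      have sp2: "s powr (q - 2) = s powr q * (\<beta> * real n / 4)"
        using s n0 b by (simp add: powr_diff)
      have t: "k / x * y \<le> k / x * r" if "y \<le> r" "0 \<le> k" "0 < x" for k x y
        using that by (intro mult_left_mono) auto
      have "?v
        = 1 / sqrt (real n) + 32 / \<beta>^2 * (sqrt (real n) / real n)
         + 24576 / \<beta>^4 * (sqrt (real n) / real n)
         + 4 / \<beta> * (1 / sqrt (real n)) + 960 / \<beta>^3 * (sqrt (real n) / (real n)^2)
         + 48 / \<beta>^2 * (1 / real n) + 960 / \<beta>^3 * (1 / real n)
         + 16 / \<beta> * (2 / sqrt \<beta>) powr q * r"
        unfolding sp2 sp using n0 b by (simp add: power2_eq_square power3_eq_cube mult_ac)
      also have "\<dots> \<le> r + 32 / \<beta>^2 * r + 24576 / \<beta>^4 * r + 4 / \<beta> * r + 960 / \<beta>^3 * r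
         + 48 / \<beta>^2 * r + 960 / \<beta>^3 * r + 16 / \<beta> * (2 / sqrt \<beta>) powr q * r"
        using rs rn rn1 rn2 b by (intro add_mono t order_refl) auto
      also have "\<dots> = C * r" by (simp add: C_def algebra_simps)
      finally show ?thesis by (simp add: r_def)
    qed
    finally show ?thesis using di by (simp add: s_def)
  qed
  show ?thesis
  proof (rule that)
    show "0 \<le> C" unfolding C_def using b by (intro add_nonneg_nonneg) auto
  qed (use main in auto)
qed

section \<open>The integrand near a center\<close>

text \<open>Mean value inequality on the half-plane Re z \<le> M, which is convex and on which the
  derivative of exp is at most exp M in modulus.\<close>

lemma norm_exp_diff_le:
  fixes z w :: complex
  assumes "Re z \<le> M" "Re w \<le> M"
  shows "norm (exp z - exp w) \<le> norm (z - w) * exp M"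
proof -
  have "norm (exp z - exp w) \<le> exp M * norm (z - w)"
  proof (rule field_differentiable_bound[where S="{z. Re z \<le> M}" and f'=exp])
    show "(exp has_field_derivative exp x) (at x within {z. Re z \<le> M})" for x :: complex
      by (rule DERIV_subset[OF DERIV_exp]) simp
  qed (use assms in \<open>auto simp: convex_halfspace_Re_le\<close>)
  then show ?thesis by (simp add: mult.commute)
qed

lemma abs_le_half_weighted:
  fixes t s :: real
  assumes "s > 0"
  shows "\<bar>t\<bar> \<le> (1 / s + s * t\<^sup>2) / 2"
proof -
  have "0 \<le> (1 - s * \<bar>t\<bar>)\<^sup>2" by simp
  then have "2 * (s * \<bar>t\<bar>) \<le> 1 + s * (s * t\<^sup>2)" by (simp add: power2_eq_square algebra_simps)
  then show ?thesis using assms by (simp add: field_simps)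
qed

lemma abs_mult_le_half_weighted:
  fixes u v s :: real
  assumes "s > 0"
  shows "\<bar>u * v\<bar> \<le> (u\<^sup>2 / s + s * v\<^sup>2) / 2"
proof -
  have "0 \<le> (\<bar>u\<bar> - s * \<bar>v\<bar>)\<^sup>2" by simp
  then have "2 * (s * (\<bar>u\<bar> * \<bar>v\<bar>)) \<le> u\<^sup>2 + s * (s * v\<^sup>2)" by (simp add: power2_eq_square algebra_simps)
  then show ?thesis using assms by (simp add: field_simps abs_mult)
qed

text \<open>The first term suffices for |x| \<le> s, the second for |x| > s. If s is the standard
  deviation of a centered normal x, both expectations are of order s^(2 + q), and only even moments
  have to be computed.\<close>

lemma powr_le_interpolation:
  fixes x s q :: real
  assumes "s > 0" "0 < q" "q \<le> 2"
  shows "\<bar>x\<bar> powr (2 + q) \<le> s powr q * x^2 + s powr (q - 2) * x^4"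
proof (cases "x = 0")
  case False
  have x2: "\<bar>x\<bar> powr 2 = x^2" and x4: "\<bar>x\<bar> powr 4 = x^4" using False by (simp_all add: powr_numeral power_even_abs)
  show ?thesis
  proof (cases "\<bar>x\<bar> \<le> s")
    case True
    have "\<bar>x\<bar> powr (2 + q) = \<bar>x\<bar> powr q * x^2" by (simp add: powr_add x2)
    also have "\<dots> \<le> s powr q * x^2" using True assms by (intro mult_right_mono powr_mono2) auto
    finally show ?thesis by (simp add: add_increasing2)
  next
    case f: False
    have "\<bar>x\<bar> powr (2 + q) = \<bar>x\<bar> powr (q - 2) * x^4"
      unfolding x4[symmetric] powr_add[symmetric] by simp
    also have "\<dots> \<le> s powr (q - 2) * x^4" using f assms by (intro mult_right_mono powr_mono2') auto
    finally show ?thesis by (simp add: add_increasing)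
  qed
qed simp

text \<open>The deviations of p_2 and n p_4 are paired with the constant summand 1 / sqrt n, and p_1
  p_3 with the weighted squares of its factors; p_k denotes the power sums. For the square of p_2,
  put t = p_2 - 4 / \<beta> and use p_2^2 - 16 / \<beta>^2 = t^2 + (8 / \<beta>) t.\<close>

lemma fluctuation_bounds:
  assumes b: "\<beta> > 0" and n: "n \<ge> 1"
  shows "0 \<le> fluctuation \<beta> q c n \<omega>" "\<bar>power_sum c n 2 \<omega> - 4 / \<beta>\<bar> \<le> fluctuation \<beta> q c n \<omega>"
    "real n * \<bar>power_sum c n 4 \<omega> - 48 / (\<beta>\<^sup>2 * real n)\<bar> \<le> fluctuation \<beta> q c n \<omega>"
    "\<bar>(power_sum c n 2 \<omega>)\<^sup>2 - 16 / \<beta>\<^sup>2\<bar> \<le> (1 + 8 / \<beta>) * fluctuation \<beta> q c n \<omega>"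
    "power_sum c n 4 \<omega> \<le> fluctuation \<beta> q c n \<omega>" "\<bar>power_sum c n 1 \<omega> * power_sum c n 3 \<omega>\<bar> \<le> fluctuation \<beta> q c n \<omega>"
    "real n * power_sum c n 6 \<omega> \<le> fluctuation \<beta> q c n \<omega>"
    "(2 / sqrt (\<beta> * real n)) powr q * power_sum c n 2 \<omega> + (2 / sqrt (\<beta> * real n)) powr (q - 2) * power_sum c n 4 \<omega> \<le> fluctuation \<beta> q c n \<omega>"
proof -
  define s where "s = sqrt (real n)"
  have s: "s \<ge> 1" "s > 0" using n by (auto simp: s_def)
  define t where "t = power_sum c n 2 \<omega> - 4 / \<beta>"
  define T1 T2 T3 T4 T5 T6 T7 T8 where
    "T1 = 1 / s" and "T2 = s * t\<^sup>2" and "T3 = s * (real n)\<^sup>2 * (power_sum c n 4 \<omega> - 48 / (\<beta>\<^sup>2 * real n))\<^sup>2"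
    and "T4 = (power_sum c n 1 \<omega>)\<^sup>2 / s" and "T5 = s * (power_sum c n 3 \<omega>)\<^sup>2" and "T6 = power_sum c n 4 \<omega>" and "T7 = real n * power_sum c n 6 \<omega>"
    and "T8 = (2 / sqrt (\<beta> * real n)) powr q * power_sum c n 2 \<omega> + (2 / sqrt (\<beta> * real n)) powr (q - 2) * power_sum c n 4 \<omega>"
  note T = T1_def T2_def T3_def T4_def T5_def T6_def T7_def T8_def
  have dv: "fluctuation \<beta> q c n \<omega> = T1 + T2 + T3 + T4 + T5 + T6 + T7 + T8"
    unfolding fluctuation_def T t_def s_def by simp
  have pos: "0 \<le> T1" "0 \<le> T2" "0 \<le> T3" "0 \<le> T4" "0 \<le> T5" "0 \<le> T6" "0 \<le> T7" "0 \<le> T8"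
    using s by (auto simp: T power_sum_even_nonneg intro!: add_nonneg_nonneg mult_nonneg_nonneg)
  show "0 \<le> fluctuation \<beta> q c n \<omega>" using pos unfolding dv by linarith
  have t1: "\<bar>t\<bar> \<le> fluctuation \<beta> q c n \<omega>"
  proof -
    have "(T1 + T2) / 2 \<le> fluctuation \<beta> q c n \<omega>" unfolding dv using pos by argo
    then show ?thesis using abs_le_half_weighted[OF s(2), of t] unfolding T1_def[symmetric] T2_def[symmetric] by (rule order_trans[rotated])
  qed
  then show "\<bar>power_sum c n 2 \<omega> - 4 / \<beta>\<bar> \<le> fluctuation \<beta> q c n \<omega>" by (simp add: t_def)
  have "\<bar>real n * (power_sum c n 4 \<omega> - 48 / (\<beta>\<^sup>2 * real n))\<bar> \<le> (T1 + T3) / 2"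
    using abs_le_half_weighted[OF s(2), of "real n * (power_sum c n 4 \<omega> - 48 / (\<beta>\<^sup>2 * real n))"] by (simp add: T power_mult_distrib mult.assoc)
  then show "real n * \<bar>power_sum c n 4 \<omega> - 48 / (\<beta>\<^sup>2 * real n)\<bar> \<le> fluctuation \<beta> q c n \<omega>"
    using pos unfolding dv abs_mult by simp
  have "t\<^sup>2 \<le> T2" using mult_right_mono[OF s(1), of "t\<^sup>2"] by (simp add: T2_def)
  then have t2: "t\<^sup>2 \<le> fluctuation \<beta> q c n \<omega>" using pos unfolding dv by linarith
  have "(power_sum c n 2 \<omega>)\<^sup>2 - 16 / \<beta>\<^sup>2 = t\<^sup>2 + 8 / \<beta> * t"
    using b by (simp add: t_def power2_eq_square field_simps)
  then have "\<bar>(power_sum c n 2 \<omega>)\<^sup>2 - 16 / \<beta>\<^sup>2\<bar> \<le> t\<^sup>2 + 8 / \<beta> * \<bar>t\<bar>"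
    using b abs_triangle_ineq[of "t\<^sup>2" "8 / \<beta> * t"] by (simp add: abs_mult)
  also have "\<dots> \<le> fluctuation \<beta> q c n \<omega> + 8 / \<beta> * fluctuation \<beta> q c n \<omega>"
    using t1 t2 b by (intro add_mono mult_left_mono) auto
  finally show "\<bar>(power_sum c n 2 \<omega>)\<^sup>2 - 16 / \<beta>\<^sup>2\<bar> \<le> (1 + 8 / \<beta>) * fluctuation \<beta> q c n \<omega>" by (simp add: algebra_simps)
  show "power_sum c n 4 \<omega> \<le> fluctuation \<beta> q c n \<omega>" using pos unfolding dv T6_def[symmetric] by argo
  show "real n * power_sum c n 6 \<omega> \<le> fluctuation \<beta> q c n \<omega>" using pos unfolding dv T7_def[symmetric] by argo
  show "(2 / sqrt (\<beta> * real n)) powr q * power_sum c n 2 \<omega> + (2 / sqrt (\<beta> * real n)) powr (q - 2) * power_sum c n 4 \<omega> \<le> fluctuation \<beta> q c n \<omega>"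
    using pos unfolding dv T8_def[symmetric] by argo
  show "\<bar>power_sum c n 1 \<omega> * power_sum c n 3 \<omega>\<bar> \<le> fluctuation \<beta> q c n \<omega>"
  proof -
    have "(T4 + T5) / 2 \<le> fluctuation \<beta> q c n \<omega>" unfolding dv using pos by argo
    then show ?thesis
      using abs_mult_le_half_weighted[OF s(2), of "power_sum c n 1 \<omega>" "power_sum c n 3 \<omega>"]
      unfolding T4_def[symmetric] T5_def[symmetric] by (rule order_trans[rotated])
  qed
qed

abbreviation gauss_weight :: "real \<Rightarrow> complex \<Rightarrow> real \<Rightarrow> complex" where
  "gauss_weight \<beta> a x \<equiv> exp (of_real (- \<beta> / 8 * x\<^sup>2) + a * of_real x)"

text \<open>The factor exp (\<beta> n p_2 / 8) undoes the Gaussian density. What is left splits into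
  a function of p_1 alone, whose law is known exactly, and \<open>exp Z\<close> with
  \<open>Z\<close> close to a constant. The one-sided bound on \<open>Re Z\<close> controls the size
  of \<open>exp Z\<close> also where \<open>fluctuation\<close> is large and closeness is of no
  help.\<close>

lemma local_exponent:
  fixes a b :: complex and \<phi> :: "real \<Rightarrow> complex" and n :: nat and \<omega> :: "nat \<Rightarrow> real"
  assumes bt: "\<beta> > 0" and q: "0 < q" "q \<le> 1" and n: "n \<ge> 1" and C6: "0 \<le> C6"
    and lc: "\<And>u. \<bar>u\<bar> \<le> \<delta> \<Longrightarrow> 0 < cos u"
      "\<And>u. \<bar>u\<bar> \<le> \<delta> \<Longrightarrow> \<bar>ln (cos u) + u^2/2 + u^4/12\<bar> \<le> C6 * u^6"
      "\<And>u. \<bar>u\<bar> \<le> \<delta> \<Longrightarrow> ln (cos u) \<le> - (u^2/2)"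
    and \<delta>: "\<delta> \<le> 1" and L: "0 \<le> L"
    and \<phi>: "\<And>x. \<bar>x\<bar> \<le> \<delta> \<Longrightarrow> norm (\<phi> (c + x) - a * of_real x - b / 2 * (of_real x)\<^sup>2) \<le> L * \<bar>x\<bar> powr (2 + q)"
    and B: "norm b \<le> B"
    and loc: "\<And>j. j \<in> {1..n} \<Longrightarrow> \<bar>\<omega> j - c\<bar> \<le> \<delta>"
  obtains Z where
    "of_real (kernel \<beta> c n \<omega>) * (\<Prod>j\<in>{1..n}. exp (\<phi> (\<omega> j)))
        * of_real (exp (\<beta> * real n / 8 * power_sum c n 2 \<omega>))
      = gauss_weight \<beta> a (power_sum c n 1 \<omega>) * exp Z"
    "norm (Z - (1 + 2 * b / of_real \<beta> - of_real (1 / (2 * \<beta>)))) \<le> (L + B / 2 + \<beta> / 4 + \<beta> * C6 + (\<beta> / 12 + 1 / 8)) * fluctuation \<beta> q c n \<omega>"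
    "Re Z \<le> (\<beta> / 4 + B / 2 + L) * power_sum c n 2 \<omega>"
proof -
  define x where "x j = \<omega> j - c" for j
  have xl: "\<bar>x j\<bar> \<le> \<delta>" if "j \<in> {1..n}" for j using loc[OF that] by (simp add: x_def)
  define p where "p k = power_sum c n k \<omega>" for k
  have p: "p k = (\<Sum>j\<in>{1..n}. x j ^ k)" for k by (simp add: p_def power_sum_def x_def)
  have B0: "0 \<le> B" using order_trans[OF norm_ge_zero B] .
  have p1: "p 1 = (\<Sum>j\<in>{1..n}. x j)" by (simp add: p)
  let ?d = "fluctuation \<beta> q c n \<omega>"
  note db = fluctuation_bounds[OF bt n, where c=c and \<omega>=\<omega> and q=q, folded p_def]
  define LC where "LC = (\<Sum>j\<in>{1..n}. \<Sum>k\<in>{j<..n}. ln (cos ((x j + x k) / 2)))"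
  define u where "u j k = (x j + x k) / 2" for j k
  have ul: "\<bar>u j k\<bar> \<le> \<delta>" if "j \<in> {1..n}" "k \<in> {j<..n}" for j k
    using xl[of j] xl[of k] that by (auto simp: u_def)
  define Q where "Q = (real n - 8) * p 4 + 4 * p 3 * p 1 + 3 * (p 2)^2"
  have S2: "(\<Sum>j\<in>{1..n}. \<Sum>k\<in>{j<..n}. (u j k)^2 / 2) = ((real n - 2) * p 2 + (p 1)^2) / 8"
    using sum_pairs_square[of x n] by (simp add: u_def p power_divide flip: sum_divide_distrib)
  have S4: "(\<Sum>j\<in>{1..n}. \<Sum>k\<in>{j<..n}. (u j k)^4 / 12) = Q / 192"
    using sum_pairs_fourth[of x n] by (simp add: u_def p Q_def power_divide flip: sum_divide_distrib)
  have S6: "(\<Sum>j\<in>{1..n}. \<Sum>k\<in>{j<..n}. (u j k)^6) \<le> real n * p 6"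
    using sum_pairs_sixth[of x n] by (simp add: u_def p)
  define RR where "RR = (\<Sum>j\<in>{1..n}. \<Sum>k\<in>{j<..n}. ln (cos (u j k)) + (u j k)^2 / 2 + (u j k)^4 / 12)"
  have RR: "\<bar>RR\<bar> \<le> C6 * ?d"
  proof -
    have "\<bar>RR\<bar> \<le> (\<Sum>j\<in>{1..n}. \<Sum>k\<in>{j<..n}. C6 * (u j k)^6)"
      unfolding RR_def
      by (intro order_trans[OF sum_abs] sum_mono lc(2) ul)
    also have "\<dots> = C6 * (\<Sum>j\<in>{1..n}. \<Sum>k\<in>{j<..n}. (u j k)^6)" by (simp add: sum_distrib_left)
    also have "\<dots> \<le> C6 * ?d" using C6 S6 db(7) by (intro mult_left_mono) auto
    finally show ?thesis .
  qed
  have LC: "LC = RR - ((real n - 2) * p 2 + (p 1)^2) / 8 - Q / 192"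
    unfolding RR_def sum.distrib S2 S4 by (simp add: LC_def u_def)
  have LCle: "LC \<le> - (((real n - 2) * p 2 + (p 1)^2) / 8)"
  proof -
    have "LC \<le> (\<Sum>j\<in>{1..n}. \<Sum>k\<in>{j<..n}. - ((u j k)^2 / 2))"
      unfolding LC_def u_def[symmetric] by (intro sum_mono lc(3) ul)
    then show ?thesis unfolding sum_negf S2 .
  qed
  define rem where "rem = (\<Sum>j\<in>{1..n}. \<phi> (\<omega> j) - a * of_real (x j) - b / 2 * (of_real (x j))\<^sup>2)"
  have rem1: "norm rem \<le> (\<Sum>j\<in>{1..n}. L * \<bar>x j\<bar> powr (2 + q))"
    unfolding rem_def
  proof (intro order_trans[OF norm_sum] sum_mono)
    fix j assume "j \<in> {1..n}"
    from \<phi>[OF xl[OF this]] show "norm (\<phi> (\<omega> j) - a * of_real (x j) - b / 2 * (of_real (x j))\<^sup>2) \<le> L * \<bar>x j\<bar> powr (2 + q)"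
      by (simp add: x_def)
  qed
  have rem2: "norm rem \<le> L * ?d"
  proof -
    let ?s = "2 / sqrt (\<beta> * real n)"
    have "(\<Sum>j\<in>{1..n}. L * \<bar>x j\<bar> powr (2 + q)) \<le> (\<Sum>j\<in>{1..n}. L * (?s powr q * (x j)^2 + ?s powr (q - 2) * (x j)^4))"
      using bt n q L by (intro sum_mono mult_left_mono powr_le_interpolation) auto
    also have "\<dots> = L * (?s powr q * p 2 + ?s powr (q - 2) * p 4)"
      by (simp add: p sum.distrib sum_distrib_left distrib_left)
    also have "\<dots> \<le> L * ?d" using db(8) L by (intro mult_left_mono) auto
    finally show ?thesis using rem1 by linarith
  qed
  \<comment> \<open>Since |x_j| \<le> 1, the remainder is also at most quadratic. This cruder bound
    serves the estimate of \<open>Re Z\<close>.\<close>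
  have rem3: "norm rem \<le> L * p 2"
  proof -
    have "(\<Sum>j\<in>{1..n}. L * \<bar>x j\<bar> powr (2 + q)) \<le> (\<Sum>j\<in>{1..n}. L * (x j)^2)"
    proof (intro sum_mono mult_left_mono L)
      fix j assume "j \<in> {1..n}"
      then have x1: "\<bar>x j\<bar> \<le> 1" using xl[of j] \<delta> by linarith
      show "\<bar>x j\<bar> powr (2 + q) \<le> (x j)^2"
      proof (cases "x j = 0")
        case False
        then have "\<bar>x j\<bar> powr (2 + q) \<le> \<bar>x j\<bar> powr 2" using x1 q by (intro powr_mono') auto
        then show ?thesis using False by (simp add: powr_numeral)
      qed simp
    qed
    then show ?thesis using rem1 by (simp add: p sum_distrib_left)
  qed
  \<comment> \<open>The term with n cancels the leading part of \<open>\<beta> * LC\<close> and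
    leaves \<beta> p_2 / 4, owing to the coefficient n - 2; the term \<beta> p_1^2 / 8 restores the
    square that \<open>gauss_weight\<close> has taken out.\<close>
  define Z where "Z = rem + b / 2 * of_real (p 2) + of_real (\<beta> * real n / 8 * p 2 + \<beta> / 8 * (p 1)^2 + \<beta> * LC)"
  have sphi: "(\<Sum>j\<in>{1..n}. \<phi> (\<omega> j)) = rem + a * of_real (p 1) + b / 2 * of_real (p 2)"
    unfolding rem_def p1 p[of 2] by (simp add: sum_subtractf sum_distrib_left)
  have kern: "kernel \<beta> c n \<omega> = exp (\<beta> * LC)"
  proof -
    have "exp (\<beta> * LC) = (\<Prod>j\<in>{1..n}. \<Prod>k\<in>{j<..n}. exp (\<beta> * ln (cos (u j k))))"
      by (simp add: LC_def u_def exp_sum sum_distrib_left)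
    also have "\<dots> = (\<Prod>j\<in>{1..n}. \<Prod>k\<in>{j<..n}. \<bar>cos (u j k)\<bar> powr \<beta>)"
    proof (intro prod.cong refl)
      fix j k assume "j \<in> {1..n}" "k \<in> {j<..n}"
      then have "cos (u j k) > 0" by (intro lc(1) ul)
      then show "exp (\<beta> * ln (cos (u j k))) = \<bar>cos (u j k)\<bar> powr \<beta>" by (simp add: powr_def)
    qed
    finally show ?thesis by (simp add: u_def x_def)
  qed
  show ?thesis
  proof (rule that[of Z])
    have "exp (of_real (\<beta> * LC)) * exp (\<Sum>j\<in>{1..n}. \<phi> (\<omega> j)) * exp (of_real (\<beta> * real n / 8 * p 2)) =
        exp (of_real (- \<beta> / 8 * (p 1)\<^sup>2) + a * of_real (p 1)) * exp Z"
      unfolding sphi Z_def exp_add[symmetric] by (rule arg_cong[where f=exp]) (simp add: algebra_simps)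
    then show "of_real (kernel \<beta> c n \<omega>) * (\<Prod>j\<in>{1..n}. exp (\<phi> (\<omega> j)))
        * of_real (exp (\<beta> * real n / 8 * power_sum c n 2 \<omega>))
      = gauss_weight \<beta> a (power_sum c n 1 \<omega>) * exp Z"
      unfolding kern p_def[symmetric] by (simp only: exp_sum finite_atLeastAtMost exp_of_real)
    \<comment> \<open>As p_2 concentrates at 4 / \<beta> and n p_4 at 48 / \<beta>^2, the term
      \<beta> p_2 / 4 concentrates at 1 and \<open>Q\<close>, in which n p_4 and 3 p_2^2 matter, at
      96 / \<beta>^2. Hence \<beta> Q / 192 contributes 1 / (2 \<beta>).\<close>
    define v where "v = \<beta> / 4 * (p 2 - 4 / \<beta>) + \<beta> * RR - \<beta> / 192 * (Q - 96 / \<beta>^2)"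
    have Zv: "Z - (1 + 2 * b / of_real \<beta> - of_real (1 / (2 * \<beta>))) = rem + b / 2 * of_real (p 2 - 4 / \<beta>) + of_real v"
    proof -
      have "\<beta> * real n / 8 * p 2 + \<beta> / 8 * (p 1)^2 + \<beta> * LC - 1 + 1 / (2 * \<beta>) = v"
        using bt unfolding v_def LC by (simp add: field_simps power2_eq_square)
      then have "of_real (\<beta> * real n / 8 * p 2 + \<beta> / 8 * (p 1)^2 + \<beta> * LC) = (of_real v + 1 - of_real (1 / (2 * \<beta>)) :: complex)"
        by (smt (verit) of_real_1 of_real_add of_real_diff)
      moreover have "2 * b / of_real \<beta> = b / 2 * of_real (4 / \<beta>)" by simp
      ultimately show ?thesis unfolding Z_def by (simp add: algebra_simps)
    qed
    have Qd: "\<bar>Q - 96 / \<beta>^2\<bar> \<le> (16 + 24 / \<beta>) * ?d"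
    proof -
      have e: "Q - 96 / \<beta>^2 = real n * (p 4 - 48 / (\<beta>\<^sup>2 * real n)) - 8 * p 4 + 4 * (p 1 * p 3) + 3 * ((p 2)\<^sup>2 - 16 / \<beta>\<^sup>2)"
        using n by (simp add: Q_def algebra_simps)
      have "\<bar>Q - 96 / \<beta>^2\<bar> \<le> \<bar>real n * (p 4 - 48 / (\<beta>\<^sup>2 * real n))\<bar> + 8 * p 4 + 4 * \<bar>p 1 * p 3\<bar> + 3 * \<bar>(p 2)\<^sup>2 - 16 / \<beta>\<^sup>2\<bar>"
      proof -
        have tri: "\<bar>A - 8 * P + 4 * X + 3 * Y\<bar> \<le> \<bar>A\<bar> + 8 * P + 4 * \<bar>X\<bar> + 3 * \<bar>Y\<bar>" if "0 \<le> P" for A P X Y :: real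
          using that by linarith
        show ?thesis unfolding e by (rule tri) (simp add: p_def power_sum_even_nonneg)
      qed
      also have "\<dots> \<le> ?d + 8 * ?d + 4 * ?d + 3 * ((1 + 8 / \<beta>) * ?d)"
      proof -
        have "\<bar>real n * (p 4 - 48 / (\<beta>\<^sup>2 * real n))\<bar> \<le> ?d" using db(3) by (simp only: abs_mult abs_of_nat)
        then show ?thesis by (intro add_mono db(4,5,6) mult_left_mono) simp_all
      qed
      finally show ?thesis by (simp add: algebra_simps)
    qed
    have "\<bar>v\<bar> \<le> \<bar>\<beta> / 4 * (p 2 - 4 / \<beta>)\<bar> + \<bar>\<beta> * RR\<bar> + \<bar>\<beta> / 192 * (Q - 96 / \<beta>^2)\<bar>"
      unfolding v_def by linarith
    also have "\<dots> \<le> \<beta> / 4 * ?d + \<beta> * (C6 * ?d) + \<beta> / 192 * ((16 + 24 / \<beta>) * ?d)"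
    proof (intro add_mono)
      show "\<bar>\<beta> / 4 * (p 2 - 4 / \<beta>)\<bar> \<le> \<beta> / 4 * ?d"
        using mult_left_mono[OF db(2), of "\<beta> / 4"] bt by (simp only: abs_mult) simp
      show "\<bar>\<beta> * RR\<bar> \<le> \<beta> * (C6 * ?d)"
        using mult_left_mono[OF RR, of \<beta>] bt by (simp only: abs_mult) simp
      show "\<bar>\<beta> / 192 * (Q - 96 / \<beta>\<^sup>2)\<bar> \<le> \<beta> / 192 * ((16 + 24 / \<beta>) * ?d)"
        using mult_left_mono[OF Qd, of "\<beta> / 192"] bt by (simp only: abs_mult) simp
    qed
    also have "\<dots> = (\<beta> / 4 + \<beta> * C6 + (\<beta> / 12 + 1 / 8)) * ?d"
      using bt by (simp add: field_simps)
    finally have v: "\<bar>v\<bar> \<le> (\<beta> / 4 + \<beta> * C6 + (\<beta> / 12 + 1 / 8)) * ?d" .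
    have bp: "norm (b / 2 * of_real (p 2 - 4 / \<beta>)) \<le> B / 2 * ?d"
      unfolding norm_mult norm_of_real using B B0 db(2) by (intro mult_mono) (auto simp: norm_divide)
    have "norm (rem + b / 2 * of_real (p 2 - 4 / \<beta>) + of_real v) \<le> norm rem + norm (b / 2 * of_real (p 2 - 4 / \<beta>)) + norm (of_real v :: complex)"
      by (intro order_trans[OF norm_triangle_ineq] add_mono norm_triangle_ineq order_refl)
    also have "\<dots> \<le> L * ?d + B / 2 * ?d + (\<beta> / 4 + \<beta> * C6 + (\<beta> / 12 + 1 / 8)) * ?d"
      using rem2 bp v by (intro add_mono) auto
    finally show "norm (Z - (1 + 2 * b / of_real \<beta> - of_real (1 / (2 * \<beta>)))) \<le> (L + B / 2 + \<beta> / 4 + \<beta> * C6 + (\<beta> / 12 + 1 / 8)) * ?d"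
      unfolding Zv by (simp add: algebra_simps)
    have p20: "0 \<le> p 2" by (simp add: p_def power_sum_even_nonneg)
    have "Re (b / 2 * of_real (p 2)) \<le> B / 2 * p 2"
    proof -
      have "Re (b / 2 * of_real (p 2)) \<le> norm (b / 2 * of_real (p 2))" by (rule complex_Re_le_cmod)
      also have "\<dots> \<le> B / 2 * p 2" unfolding norm_mult norm_of_real using B B0 p20 by (intro mult_mono) (auto simp: norm_divide)
      finally show ?thesis .
    qed
    moreover have "Re rem \<le> L * p 2" using complex_Re_le_cmod[of rem] rem3 by linarith
    moreover have "\<beta> * real n / 8 * p 2 + \<beta> / 8 * (p 1)^2 + \<beta> * LC \<le> \<beta> / 4 * p 2"
      using mult_left_mono[OF LCle, of \<beta>] bt by (simp add: field_simps)
    ultimately show "Re Z \<le> (\<beta> / 4 + B / 2 + L) * power_sum c n 2 \<omega>"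
      unfolding p_def[symmetric] Z_def by (simp add: algebra_simps)
  qed
qed

section \<open>Contribution of one center\<close>

lemma borel_measurable_PiM_lebesgue_component:
  assumes "g \<in> borel_measurable lebesgue" "j \<in> I"
  shows "(\<lambda>\<omega>. g (\<omega> j)) \<in> borel_measurable (Pi\<^sub>M I (\<lambda>_. lebesgue))"
  using measurable_comp[OF measurable_component_singleton[OF assms(2)] assms(1)] by (simp add: comp_def)

lemma borel_measurable_PiM_lebesgue_coordinate:
  "j \<in> I \<Longrightarrow> (\<lambda>\<omega>. \<omega> j) \<in> borel_measurable (Pi\<^sub>M I (\<lambda>_. lebesgue))" for j :: 'i
  by (rule borel_measurable_PiM_lebesgue_component[where g="\<lambda>x. x"]) (auto simp: measurable_completion)

lemma borel_measurable_PiM_gauss: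
  "borel_measurable (Pi\<^sub>M I (\<lambda>_. gauss c s)) = borel_measurable (Pi\<^sub>M I (\<lambda>_. lebesgue))"
  by (intro measurable_cong_sets sets_PiM_cong) auto

lemma borel_measurable_power_sum:
  "power_sum c n k \<in> borel_measurable (leb_pow n)"
  unfolding power_sum_def[abs_def]
  by (intro borel_measurable_sum borel_measurable_power borel_measurable_diff borel_measurable_const
      borel_measurable_PiM_lebesgue_coordinate)

text \<open>The integrand of \<open>I_int\<close> up to powers of 2. It is the same function for both centers \<open>c\<close>, see
  \<open>integrand_center_indep\<close>.\<close>

definition integrand :: "real \<Rightarrow> real \<Rightarrow> nat \<Rightarrow> (real \<Rightarrow> complex) \<Rightarrow> (nat \<Rightarrow> real) \<Rightarrow> complex" where
  "integrand \<beta> c n \<phi> \<theta> = of_real (kernel \<beta> c n \<theta>) * (\<Prod>j\<in>{1..n}. exp (\<phi> (\<theta> j)))"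

definition nearby :: "real \<Rightarrow> real \<Rightarrow> nat \<Rightarrow> (nat \<Rightarrow> real) set" where
  "nearby \<delta> c n = {\<theta>. \<forall>j\<in>{1..n}. \<bar>\<theta> j - c\<bar> \<le> \<delta>}"

lemma borel_measurable_integrand:
  assumes "\<phi> \<in> borel_measurable lebesgue"
  shows "integrand \<beta> c n \<phi> \<in> borel_measurable (leb_pow n)"
proof -
  have m: "(\<lambda>\<theta>. \<bar>cos (((\<theta> j - c) + (\<theta> k - c)) / 2)\<bar> powr \<beta>) \<in> borel_measurable (leb_pow n)"
    if "j \<in> {1..n}" "k \<in> {j<..n}" for j k
  proof -
    have [measurable]: "(\<lambda>\<theta>. \<theta> j) \<in> borel_measurable (leb_pow n)" "(\<lambda>\<theta>. \<theta> k) \<in> borel_measurable (leb_pow n)"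
      using that by (auto intro!: borel_measurable_PiM_lebesgue_coordinate)
    show ?thesis by measurable
  qed
  have e: "(\<lambda>\<theta>. exp (\<phi> (\<theta> j))) \<in> borel_measurable (leb_pow n)" if "j \<in> {1..n}" for j
  proof -
    have [measurable]: "(\<lambda>\<theta>. \<phi> (\<theta> j)) \<in> borel_measurable (leb_pow n)"
      by (rule borel_measurable_PiM_lebesgue_component[OF assms that])
    show ?thesis by measurable
  qed
  show ?thesis unfolding integrand_def[abs_def]
    by (intro borel_measurable_times measurable_compose[OF _ borel_measurable_of_real] borel_measurable_prod m e)
qed

lemma measurable_indicator_nearby:
  "(indicator (nearby \<delta> c n) :: _ \<Rightarrow> real) \<in> borel_measurable (leb_pow n)"
proof -
  have "Measurable.pred (Pi\<^sub>M {1..n} (\<lambda>_. lebesgue)) (\<lambda>\<theta>. \<bar>\<theta> j - c\<bar> \<le> \<delta>)" if "j \<in> {1..n}" for j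
  proof -
    have [measurable]: "(\<lambda>\<theta>. \<theta> j) \<in> borel_measurable (leb_pow n)"
      using that by (rule borel_measurable_PiM_lebesgue_coordinate)
    show ?thesis by measurable
  qed
  then have "Measurable.pred (Pi\<^sub>M {1..n} (\<lambda>_. lebesgue)) (\<lambda>\<theta>. \<forall>j\<in>{1..n}. \<bar>\<theta> j - c\<bar> \<le> \<delta>)"
    by (intro pred_intros_finite) auto
  then have "(\<lambda>\<theta>. if \<forall>j\<in>{1..n}. \<bar>\<theta> j - c\<bar> \<le> \<delta> then 1 else 0 :: real) \<in> borel_measurable (leb_pow n)"
    by (intro measurable_If) auto
  moreover have "(\<lambda>\<theta>. if \<forall>j\<in>{1..n}. \<bar>\<theta> j - c\<bar> \<le> \<delta> then 1 else 0 :: real) = indicator (nearby \<delta> c n)"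
    by (auto simp: nearby_def indicator_def fun_eq_iff)
  ultimately show ?thesis by simp
qed

text \<open>The maximum of - \<beta> x^2 / 8 + B |x|, attained at |x| = 4 B / \<beta>, is 2 B^2 /
  \<beta>. A bound free of x lets the weight be pulled out of all error expectations.\<close>

lemma gaussian_weight_bound:
  fixes a :: complex and x \<beta> B :: real
  assumes bt: "\<beta> > 0" and a: "norm a \<le> B"
  shows "norm (gauss_weight \<beta> a x) \<le> exp (2 * B\<^sup>2 / \<beta>)"
proof -
  have "Re (a * of_real x) \<le> norm (a * of_real x)" by (rule complex_Re_le_cmod)
  also have "\<dots> \<le> B * \<bar>x\<bar>" using a by (simp add: norm_mult mult_right_mono)
  finally have "Re (of_real (- \<beta> / 8 * x\<^sup>2) + a * of_real x) \<le> - \<beta> / 8 * x\<^sup>2 + B * \<bar>x\<bar>" by simp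
  also have "\<dots> \<le> 2 * B\<^sup>2 / \<beta>"
  proof -
    have "0 \<le> (\<beta> * \<bar>x\<bar> - 4 * B)\<^sup>2 / (8 * \<beta>)" using bt by simp
    also have "\<dots> = 2 * B\<^sup>2 / \<beta> - (- \<beta> / 8 * x\<^sup>2 + B * \<bar>x\<bar>)"
      using bt by (simp add: power2_eq_square field_simps)
    finally show ?thesis by simp
  qed
  finally show ?thesis by simp
qed

text \<open>The first power sum has the same normal law for every n, so this expectation is exact
  and contributes no error.\<close>

lemma gaussian_weight_expectation:
  fixes a :: complex and \<beta> c :: real and n :: nat
  assumes bt: "\<beta> > 0" and n: "n \<ge> 1"
  defines "P \<equiv> gauss_pow c (2 / sqrt (\<beta> * real n)) n"
  shows "integrable P (\<lambda>\<omega>. gauss_weight \<beta> a (power_sum c n 1 \<omega>))" (is ?A)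
    and "(LINT \<omega>|P. gauss_weight \<beta> a (power_sum c n 1 \<omega>)) = of_real (2 powr (-1/2)) * exp (a\<^sup>2 / \<beta>)" (is ?B)
proof -
  let ?s = "2 / sqrt (\<beta> * real n)"
  have s: "?s > 0" using bt n by simp
  interpret P: prob_space P unfolding P_def by (intro prob_space_PiM prob_space_gauss s)
  define W where "W x = gauss_weight \<beta> a x" for x :: real
  have Wm: "W \<in> borel_measurable borel" unfolding W_def[abs_def] by measurable
  have D: "distributed P lborel (power_sum c n 1) (normal_density 0 (2 / sqrt \<beta>))"
    using distributed_sum_gauss[of "{1..n}" ?s c] s n by (simp add: P_def power_sum_def[abs_def] real_sqrt_mult)
  have pm: "power_sum c n 1 \<in> P \<rightarrow>\<^sub>M lborel" using distributed_measurable[OF D] .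
  have Wp: "(\<lambda>\<omega>. W (power_sum c n 1 \<omega>)) \<in> borel_measurable P"
    by (rule measurable_compose[OF pm]) (simp add: Wm)
  have "integrable P (\<lambda>\<omega>. W (power_sum c n 1 \<omega>))"
    using gaussian_weight_bound[OF bt, of a "norm a"] Wp
    by (intro P.integrable_const_bound[where B="exp (2 * (norm a)\<^sup>2 / \<beta>)"] AE_I2) (auto simp: W_def)
  then show ?A
    by (simp add: W_def)
  have "(LINT \<omega>|P. W (power_sum c n 1 \<omega>)) = (LINT x|distr P lborel (power_sum c n 1). W x)"
    by (rule integral_distr[symmetric, OF pm]) (simp add: Wm)
  also have "\<dots> = (LINT x|lborel. normal_density 0 (2 / sqrt \<beta>) x *\<^sub>R W x)"
    unfolding distributed_distr_eq_density[OF D] by (rule integral_density) (auto simp: Wm)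
  also have "\<dots> = of_real (2 powr (-1/2)) * exp (a\<^sup>2 / \<beta>)"
    unfolding W_def by (rule integral_normal_density_gaussian_exp[OF bt])
  finally show ?B
    by (simp add: W_def)
qed

lemma inverse_normal_density:
  assumes "\<beta> > 0" "n \<ge> (1::nat)"
  shows "1 / normal_density c (2 / sqrt (\<beta> * real n)) x = sqrt (8 * pi / (\<beta> * real n)) * exp (\<beta> * real n / 8 * (x - c)\<^sup>2)"
proof -
  have "(2 / sqrt (\<beta> * real n))\<^sup>2 = 4 / (\<beta> * real n)" using assms by (simp add: power_divide)
  then show ?thesis using assms by (simp add: normal_density_def exp_minus field_simps)
qed

text \<open>Since exp (\<beta> n p_2 / 32 - n) is at least 1 for p_2 > 32 / \<beta>, this is a
  Chernoff bound for that event, weighted by exp (C1 p_2). The condition on n keeps the coefficient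
  of p_2 at most 1 / (4 s^2) = \<beta> n / 16, and the resulting \<open>sqrt 2 ^ n\<close> is beaten
  by exp (- n).\<close>

lemma tail_expectation:
  fixes \<beta> c C1 q :: real and n :: nat
  assumes bt: "\<beta> > 0" and q: "0 < q" "q \<le> 1" and n: "n \<ge> 1" "32 * C1 / \<beta> \<le> real n"
  defines "P \<equiv> gauss_pow c (2 / sqrt (\<beta> * real n)) n"
  shows "integrable P (\<lambda>\<omega>. exp ((C1 + \<beta> * real n / 32) * power_sum c n 2 \<omega> - real n))" (is ?A)
    and "(LINT \<omega>|P. exp ((C1 + \<beta> * real n / 32) * power_sum c n 2 \<omega> - real n)) \<le> 2 * real n powr (- q / 2)" (is ?B)
proof -
  let ?s = "2 / sqrt (\<beta> * real n)"
  have s: "?s > 0" using bt n by simp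
  have l: "C1 + \<beta> * real n / 32 \<le> 1 / (4 * ?s\<^sup>2)"
    using bt n by (simp add: power_divide field_simps)
  note m = power_sum_exp_moment[OF s l, of n c, folded P_def]
  have e: "exp ((C1 + \<beta> * real n / 32) * power_sum c n 2 \<omega> - real n) = exp (- real n) * exp ((C1 + \<beta> * real n / 32) * power_sum c n 2 \<omega>)" for \<omega>
    by (simp flip: exp_add)
  show ?A
    unfolding e by (intro integrable_mult_right m(1))
  have "(LINT \<omega>|P. exp ((C1 + \<beta> * real n / 32) * power_sum c n 2 \<omega> - real n)) \<le> exp (- real n) * sqrt 2 ^ n"
    unfolding e integral_mult_right_zero using m(2) by (intro mult_left_mono) auto
  also have "\<dots> \<le> exp (- real n) * exp (1/2) ^ n"
  proof (intro mult_left_mono power_mono)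
    have "2 \<le> exp (1::real)" using exp_ge_add_one_self[of 1] by simp
    then have "sqrt 2 \<le> sqrt (exp 1)" by simp
    also have "sqrt (exp 1) = exp (1/2)" by (rule real_sqrt_unique) (simp_all flip: exp_double)
    finally show "sqrt 2 \<le> exp (1/2)" .
  qed auto
  also have "\<dots> = exp (- (real n / 2))" by (simp flip: exp_of_nat_mult exp_add)
  also have "\<dots> \<le> 2 / real n"
  proof -
    have "real n / 2 \<le> exp (real n / 2)" using exp_ge_add_one_self[of "real n / 2"] by linarith
    then show ?thesis using n by (simp add: exp_minus field_simps)
  qed
  also have "\<dots> = 2 * real n powr (-1)" using n by (simp add: powr_minus_divide)
  also have "\<dots> \<le> 2 * real n powr (- q / 2)" using n q by (intro mult_left_mono powr_mono) auto
  finally show ?B .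
qed

text \<open>The error is measured against \<open>gauss_volume\<close> and not against the main term.
  The quantifiers over \<open>\<phi>\<close>, \<open>a\<close> and \<open>b\<close> stand inside, so
  that one threshold for n serves all multiples t f at once.\<close>

abbreviation local_asymp :: "real \<Rightarrow> real \<Rightarrow> real \<Rightarrow> real \<Rightarrow> real \<Rightarrow> real \<Rightarrow> real \<Rightarrow> nat \<Rightarrow> bool" where
  "local_asymp \<beta> q \<delta> L B c C n \<equiv> \<forall>\<phi> a b. \<phi> \<in> borel_measurable lebesgue \<longrightarrow>
    (\<forall>x. \<bar>x\<bar> \<le> \<delta> \<longrightarrow> norm (\<phi> (c + x) - a * of_real x - b / 2 * (of_real x)\<^sup>2) \<le> L * \<bar>x\<bar> powr (2 + q)) \<longrightarrow>
    norm a \<le> B \<longrightarrow> norm b \<le> B \<longrightarrow>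
    norm ((LINT \<theta>|cube n. indicator (nearby \<delta> c n) \<theta> *\<^sub>R integrand \<beta> c n \<phi> \<theta>)
        - of_real (gauss_volume \<beta> n * 2 powr (-1/2)) * exp (a\<^sup>2 / \<beta> + (1 + 2 * b / \<beta> - of_real (1 / (2 * \<beta>)))))
      \<le> gauss_volume \<beta> n * (C * real n powr (- q / 2))"

text \<open>In the Gaussian picture the integrand minus its limit is dominated pointwise by a
  multiple of \<open>fluctuation\<close> plus the Chernoff weight of
  \<open>tail_expectation\<close>, and both have expectation O(n^(-q/2)).\<close>

lemma local_integral_asymp:
  fixes \<beta> q B L \<delta> c C6 :: real
  assumes bt: "\<beta> > 0" and q: "0 < q" "q \<le> 1" and C6: "0 \<le> C6"
    and lc: "\<And>u. \<bar>u\<bar> \<le> \<delta> \<Longrightarrow> 0 < cos u"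
      "\<And>u. \<bar>u\<bar> \<le> \<delta> \<Longrightarrow> \<bar>ln (cos u) + u^2/2 + u^4/12\<bar> \<le> C6 * u^6"
      "\<And>u. \<bar>u\<bar> \<le> \<delta> \<Longrightarrow> ln (cos u) \<le> - (u^2/2)"
    and \<delta>: "0 < \<delta>" "\<delta> \<le> 1" and L: "0 \<le> L" and B: "0 \<le> B" and c: "c \<in> {pi/2, -pi/2}"
  obtains C where "0 \<le> C"
    "\<forall>\<^sub>F n in sequentially. local_asymp \<beta> q \<delta> L B c C n"
proof -
  obtain Cd where Cd: "0 \<le> Cd"
    "\<And>n. n \<ge> 1 \<Longrightarrow> integrable (gauss_pow c (2 / sqrt (\<beta> * real n)) n) (fluctuation \<beta> q c n)"
    "\<And>n. n \<ge> 1 \<Longrightarrow> (LINT \<omega>|gauss_pow c (2 / sqrt (\<beta> * real n)) n. fluctuation \<beta> q c n \<omega>) \<le> Cd * real n powr (- q / 2)"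
    using fluctuation_expectation[OF bt q, where c=c] by blast
  define C1 where "C1 = \<beta> / 4 + B / 2 + L"
  define Kd where "Kd = L + B / 2 + \<beta> / 4 + \<beta> * C6 + (\<beta> / 12 + 1 / 8)"
  define Zm where "Zm = 1 + 2 * B / \<beta> + 1 / (2 * \<beta>)"
  define Wc where "Wc = exp (2 * B\<^sup>2 / \<beta>)"
  \<comment> \<open>One summand for each case of the pointwise estimate: p_2 \<le> 32 / \<beta>,
    which is eight times the mean of p_2; p_2 > 32 / \<beta>; and configurations outside
    \<open>nearby\<close>.\<close>
  define M where "M = Kd * exp (C1 * (32 / \<beta>) + Zm) + (1 + exp Zm) + exp Zm / \<delta>^4"
  have pos: "0 \<le> C1" "0 \<le> Kd" "0 \<le> Zm" "0 < Wc" "0 \<le> M"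
    using bt B L C6 \<delta> by (auto simp: C1_def Kd_def Zm_def Wc_def M_def add_nonneg_nonneg)
  have Mge: "Kd * exp (C1 * (32 / \<beta>) + Zm) \<le> M" "1 + exp Zm \<le> M" "exp Zm / \<delta>^4 \<le> M"
    unfolding M_def using pos \<delta> by (auto simp: add_nonneg_nonneg)
  define C where "C = Wc * M * (Cd + 2)"
  show ?thesis
  proof (rule that[of C])
    show "0 \<le> C" using pos Cd by (simp add: C_def)
    have "\<forall>\<^sub>F n in sequentially. 32 * C1 / \<beta> \<le> real n"
      using eventually_ge_at_top[of "nat \<lceil>32 * C1 / \<beta>\<rceil>"] by eventually_elim linarith
    then show "\<forall>\<^sub>F n in sequentially. local_asymp \<beta> q \<delta> L B c C n"
      using eventually_ge_at_top[of 1]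
    proof (eventually_elim, intro allI impI)
      fix n :: nat and \<phi> and a b :: complex
      assume nl: "32 * C1 / \<beta> \<le> real n" and n: "1 \<le> n" and \<phi>m: "\<phi> \<in> borel_measurable lebesgue"
        and \<phi>: "\<forall>x. \<bar>x\<bar> \<le> \<delta> \<longrightarrow> norm (\<phi> (c + x) - a * of_real x - b / 2 * (of_real x)\<^sup>2) \<le> L * \<bar>x\<bar> powr (2 + q)"
        and a: "norm a \<le> B" and b: "norm b \<le> B"
      define s where "s = 2 / sqrt (\<beta> * real n)"
      have s: "s > 0" using bt n by (simp add: s_def)
      let ?P = "gauss_pow c s n"
      interpret P: prob_space ?P by (intro prob_space_PiM prob_space_gauss s)
      define V where "V = gauss_volume \<beta> n"
      have V0: "0 \<le> V" by (simp add: V_def)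
      define z where "z = 1 + 2 * b / \<beta> - of_real (1 / (2 * \<beta>))"
      define w where "w \<omega> = gauss_weight \<beta> a (power_sum c n 1 \<omega>)" for \<omega>
      define T where "T \<omega> = indicator (nearby \<delta> c n) \<omega> *\<^sub>R (integrand \<beta> c n \<phi> \<omega> * of_real (exp (\<beta> * real n / 8 * power_sum c n 2 \<omega>)))" for \<omega>
      define E where "E \<omega> = exp ((C1 + \<beta> * real n / 32) * power_sum c n 2 \<omega> - real n)" for \<omega>
      let ?d = "fluctuation \<beta> q c n"
      have z: "norm z \<le> Zm"
      proof -
        have "norm z \<le> norm (1 + 2 * b / \<beta>) + norm (of_real (1 / (2 * \<beta>)) :: complex)" unfolding z_def by (rule norm_triangle_ineq4)
        also have "norm (1 + 2 * b / \<beta>) \<le> 1 + norm (2 * b / \<beta>)" using norm_triangle_ineq[of 1 "2 * b / \<beta>"] by simp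
        also have "norm (2 * b / \<beta>) \<le> 2 * B / \<beta>" using bt b by (simp add: norm_divide norm_mult divide_right_mono)
        also have "norm (of_real (1 / (2 * \<beta>)) :: complex) = 1 / (2 * \<beta>)" using bt by (simp add: norm_divide norm_mult)
        finally show ?thesis by (simp add: Zm_def)
      qed
      have rz: "Re z \<le> Zm" using z complex_Re_le_cmod[of z] by linarith
      have ez: "norm (exp z) \<le> exp Zm" using rz by simp
      have w: "norm (w \<omega>) \<le> Wc" for \<omega>
        unfolding w_def Wc_def by (rule gaussian_weight_bound[OF bt a])
      have E0: "0 < E \<omega>" for \<omega> by (simp add: E_def)
      have d0: "0 \<le> ?d \<omega>" for \<omega> by (rule fluctuation_bounds(1)[OF bt n])
      have key: "norm (T \<omega> - w \<omega> * exp z) \<le> Wc * M * (?d \<omega> + E \<omega>)" for \<omega>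
      proof (cases "\<omega> \<in> nearby \<delta> c n")
        case True
        then have loc: "\<bar>\<omega> j - c\<bar> \<le> \<delta>" if "j \<in> {1..n}" for j using that by (auto simp: nearby_def)
        obtain Z where Z:
          "of_real (kernel \<beta> c n \<omega>) * (\<Prod>j\<in>{1..n}. exp (\<phi> (\<omega> j)))
            * of_real (exp (\<beta> * real n / 8 * power_sum c n 2 \<omega>)) = w \<omega> * exp Z"
          "norm (Z - z) \<le> Kd * ?d \<omega>" "Re Z \<le> C1 * power_sum c n 2 \<omega>"
          using local_exponent[where \<omega>=\<omega> and c=c, OF bt q n C6 lc \<delta>(2) L \<phi>[rule_format] b loc] unfolding w_def z_def Kd_def C1_def by blast
        have T: "T \<omega> = w \<omega> * exp Z" using True Z(1) by (simp add: T_def integrand_def)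
        have p2: "0 \<le> power_sum c n 2 \<omega>" by (simp add: power_sum_even_nonneg)
        have "norm (exp Z - exp z) \<le> M * (?d \<omega> + E \<omega>)"
        proof (cases "power_sum c n 2 \<omega> \<le> 32 / \<beta>")
          case True
          have "C1 * power_sum c n 2 \<omega> \<le> C1 * (32 / \<beta>)" using True pos by (intro mult_left_mono) auto
          moreover have "0 \<le> C1 * (32 / \<beta>)" using pos bt by simp
          ultimately have "norm (exp Z - exp z) \<le> norm (Z - z) * exp (C1 * (32 / \<beta>) + Zm)"
            using Z(3) rz pos by (intro norm_exp_diff_le) linarith+
          also have "\<dots> \<le> (Kd * ?d \<omega>) * exp (C1 * (32 / \<beta>) + Zm)" using Z(2) by (intro mult_right_mono) auto
          also have "\<dots> = (Kd * exp (C1 * (32 / \<beta>) + Zm)) * ?d \<omega>" by simp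
          also have "\<dots> \<le> M * (?d \<omega> + E \<omega>)" using Mge d0[of \<omega>] E0[of \<omega>] pos by (intro mult_mono) auto
          finally show ?thesis .
        next
          case False
          have e1: "1 \<le> exp (C1 * power_sum c n 2 \<omega>)" using pos p2 by simp
          have "norm (exp Z - exp z) \<le> norm (exp Z) + norm (exp z)" by (rule norm_triangle_ineq4)
          also have "\<dots> \<le> exp (C1 * power_sum c n 2 \<omega>) + exp Zm * exp (C1 * power_sum c n 2 \<omega>)"
          proof (intro add_mono)
            show "norm (exp Z) \<le> exp (C1 * power_sum c n 2 \<omega>)" using Z(3) by simp
            show "norm (exp z) \<le> exp Zm * exp (C1 * power_sum c n 2 \<omega>)"
              by (rule order_trans[OF ez]) (use pos p2 in simp)
          qed
          also have "\<dots> = (1 + exp Zm) * exp (C1 * power_sum c n 2 \<omega>)" by (simp add: algebra_simps)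
          also have "\<dots> \<le> M * (?d \<omega> + E \<omega>)"
          proof (intro mult_mono Mge)
            have "real n \<le> \<beta> * real n / 32 * power_sum c n 2 \<omega>"
              using False bt n mult_left_mono[of "32 / \<beta>" "power_sum c n 2 \<omega>" "\<beta> * real n / 32"] by simp
            then have "exp (C1 * power_sum c n 2 \<omega>) \<le> E \<omega>" by (simp add: E_def algebra_simps)
            then show "exp (C1 * power_sum c n 2 \<omega>) \<le> ?d \<omega> + E \<omega>" using d0[of \<omega>] by linarith
          qed (use pos in auto)
          finally show ?thesis .
        qed
        then have "norm (w \<omega>) * norm (exp Z - exp z) \<le> Wc * (M * (?d \<omega> + E \<omega>))"
          using w pos by (intro mult_mono) auto
        then show ?thesis unfolding T by (simp add: norm_mult flip: right_diff_distrib)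
      next
        case False
        then obtain j where j: "j \<in> {1..n}" "\<delta> < \<bar>\<omega> j - c\<bar>" by (auto simp: nearby_def not_le)
        \<comment> \<open>Outside \<open>nearby\<close> the integrand is cut off but the main term
          is not. There \<open>fluctuation\<close>, which contains the fourth power sum, is at least
          \<delta>^4 and so bounds the main term up to a constant.\<close>
        have "\<delta> ^ 4 \<le> \<bar>\<omega> j - c\<bar> ^ 4" using j \<delta> by (intro power_mono) auto
        also have "\<dots> \<le> power_sum c n 4 \<omega>"
          unfolding power_sum_def using j(1) member_le_sum[of j "{1..n}" "\<lambda>j. (\<omega> j - c) ^ 4"] by (simp add: power_even_abs)
        also have "\<dots> \<le> ?d \<omega>" by (rule fluctuation_bounds(5)[OF bt n])
        finally have "1 \<le> ?d \<omega> / \<delta>^4" using \<delta> by simp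
        then have "exp Zm \<le> exp Zm / \<delta>^4 * ?d \<omega>" using mult_left_mono[of 1 "?d \<omega> / \<delta>^4" "exp Zm"] by simp
        also have "\<dots> \<le> M * (?d \<omega> + E \<omega>)" using Mge d0[of \<omega>] E0[of \<omega>] pos by (intro mult_mono) auto
        finally have "norm (exp z) \<le> M * (?d \<omega> + E \<omega>)" by (rule order_trans[OF ez])
        then have "norm (w \<omega>) * norm (exp z) \<le> Wc * (M * (?d \<omega> + E \<omega>))"
          by (rule mult_mono[OF w]) (use pos in auto)
        moreover have "T \<omega> = 0" using False by (simp add: T_def)
        ultimately show ?thesis by (simp add: norm_mult)
      qed
      note Ei = tail_expectation[OF bt q n nl, where c=c, folded s_def E_def]
      note di = Cd(2,3)[OF n, folded s_def]
      note wi = gaussian_weight_expectation[OF bt n, where a=a and c=c, folded s_def w_def]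
      have bi: "integrable ?P (\<lambda>\<omega>. Wc * M * (?d \<omega> + E \<omega>))"
        using Ei di by (intro integrable_mult_right Bochner_Integration.integrable_add) auto
      have Fm: "(\<lambda>\<omega>. indicator (nearby \<delta> c n) \<omega> *\<^sub>R integrand \<beta> c n \<phi> \<omega>) \<in> borel_measurable (leb_pow n)"
        by (intro borel_measurable_scaleR measurable_indicator_nearby borel_measurable_integrand \<phi>m)
      have Tm: "T \<in> borel_measurable ?P"
      proof -
        have [measurable]: "power_sum c n 2 \<in> borel_measurable (leb_pow n)"
          "integrand \<beta> c n \<phi> \<in> borel_measurable (leb_pow n)"
          "(indicator (nearby \<delta> c n) :: _ \<Rightarrow> real) \<in> borel_measurable (leb_pow n)"
          by (rule borel_measurable_power_sum borel_measurable_integrand[OF \<phi>m] measurable_indicator_nearby)+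
        show ?thesis unfolding T_def[abs_def] borel_measurable_PiM_gauss by measurable
      qed
      have dfi: "integrable ?P (\<lambda>\<omega>. T \<omega> - w \<omega> * exp z)"
      proof (rule Bochner_Integration.integrable_bound[OF bi])
        show "(\<lambda>\<omega>. T \<omega> - w \<omega> * exp z) \<in> borel_measurable ?P"
          using Tm wi(1) by (intro borel_measurable_diff borel_measurable_times borel_measurable_const) auto
        have "norm (T \<omega> - w \<omega> * exp z) \<le> norm (Wc * M * (?d \<omega> + E \<omega>))" for \<omega>
          using key[of \<omega>] by (metis abs_ge_self order_trans real_norm_def)
        then show "AE \<omega> in ?P. norm (T \<omega> - w \<omega> * exp z) \<le> norm (Wc * M * (?d \<omega> + E \<omega>))" by simp
      qed
      have wzi: "integrable ?P (\<lambda>\<omega>. w \<omega> * exp z)" using wi(1) by (intro integrable_mult_left) auto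
      have Ti: "integrable ?P T" using Bochner_Integration.integrable_add[OF dfi wzi] by simp
      have "norm ((LINT \<omega>|?P. T \<omega>) - (LINT \<omega>|?P. w \<omega> * exp z)) = norm (LINT \<omega>|?P. T \<omega> - w \<omega> * exp z)"
        using Ti wzi by simp
      also have "\<dots> \<le> (LINT \<omega>|?P. Wc * M * (?d \<omega> + E \<omega>))"
        using dfi bi key by (intro order_trans[OF integral_norm_bound] integral_mono) auto
      also have "\<dots> = Wc * M * ((LINT \<omega>|?P. ?d \<omega>) + (LINT \<omega>|?P. E \<omega>))"
        using di Ei by simp
      also have "\<dots> \<le> Wc * M * (Cd * real n powr (- q / 2) + 2 * real n powr (- q / 2))"
        using di Ei pos by (intro mult_left_mono add_mono) auto
      also have "\<dots> = C * real n powr (- q / 2)" by (simp add: C_def algebra_simps)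
      finally have main: "norm ((LINT \<omega>|?P. T \<omega>) - (LINT \<omega>|?P. w \<omega> * exp z)) \<le> C * real n powr (- q / 2)" .
      have wz: "(LINT \<omega>|?P. w \<omega> * exp z) = of_real (2 powr (-1/2)) * exp (a\<^sup>2 / \<beta> + z)"
        using wi by (simp add: exp_add)
      have tr: "(LINT \<theta>|cube n. indicator (nearby \<delta> c n) \<theta> *\<^sub>R integrand \<beta> c n \<phi> \<theta>) = of_real V * (LINT \<omega>|?P. T \<omega>)"
      proof -
        have "(LINT \<theta>|cube n. indicator (nearby \<delta> c n) \<theta> *\<^sub>R integrand \<beta> c n \<phi> \<theta>) =
          (LINT \<theta>|?P. (\<Prod>i\<in>{1..n}. indicator {-pi..pi} (\<theta> i) / normal_density c s (\<theta> i)) *\<^sub>R (indicator (nearby \<delta> c n) \<theta> *\<^sub>R integrand \<beta> c n \<phi> \<theta>))"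
          by (rule integral_PiM_lebesgue_on[OF _ _ s Fm]) auto
        also have "\<dots> = (LINT \<theta>|?P. of_real V * T \<theta>)"
        proof (rule Bochner_Integration.integral_cong[OF refl])
          fix \<theta>
          show "(\<Prod>i\<in>{1..n}. indicator {-pi..pi} (\<theta> i) / normal_density c s (\<theta> i)) *\<^sub>R (indicator (nearby \<delta> c n) \<theta> *\<^sub>R integrand \<beta> c n \<phi> \<theta>) = of_real V * T \<theta>"
          proof (cases "\<theta> \<in> nearby \<delta> c n")
            case True
            have "indicator {-pi..pi} (\<theta> i) / normal_density c s (\<theta> i) = sqrt (8 * pi / (\<beta> * real n)) * exp (\<beta> * real n / 8 * (\<theta> i - c)\<^sup>2)"
              if "i \<in> {1..n}" for i
            proof -
              \<comment> \<open>A radius of at most 1 keeps the neighborhood inside the cube, so the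
                indicator equals 1.\<close>
              have "\<bar>\<theta> i - c\<bar> \<le> 1" using True that \<delta> by (force simp: nearby_def)
              then have "\<theta> i \<in> {-pi..pi}" using c pi_gt3 by auto
              then show ?thesis using inverse_normal_density[OF bt n] by (simp add: s_def)
            qed
            then have "(\<Prod>i\<in>{1..n}. indicator {-pi..pi} (\<theta> i) / normal_density c s (\<theta> i)) = sqrt (8 * pi / (\<beta> * real n)) ^ n * exp (\<beta> * real n / 8 * power_sum c n 2 \<theta>)"
              by (simp add: prod.distrib power_sum_def exp_sum sum_distrib_left)
            also have "sqrt (8 * pi / (\<beta> * real n)) ^ n = V"
              using bt n by (simp add: V_def powr_half_sqrt[symmetric] powr_power)
            finally show ?thesis using True by (simp add: T_def scaleR_conv_of_real)
          qed (simp add: T_def)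
        qed
        finally show ?thesis by simp
      qed
      have "(LINT \<theta>|cube n. indicator (nearby \<delta> c n) \<theta> *\<^sub>R integrand \<beta> c n \<phi> \<theta>)
          - of_real (V * 2 powr (-1/2)) * exp (a\<^sup>2 / \<beta> + z) = of_real V * ((LINT \<omega>|?P. T \<omega>) - (LINT \<omega>|?P. w \<omega> * exp z))"
        unfolding tr wz by (simp add: right_diff_distrib)
      also have "norm \<dots> \<le> V * (C * real n powr (- q / 2))"
        using main V0 by (simp add: norm_mult mult_left_mono)
      finally show "norm ((LINT \<theta>|cube n. indicator (nearby \<delta> c n) \<theta> *\<^sub>R integrand \<beta> c n \<phi> \<theta>)
          - of_real (gauss_volume \<beta> n * 2 powr (-1/2)) * exp (a\<^sup>2 / \<beta> + (1 + 2 * b / \<beta> - of_real (1 / (2 * \<beta>)))))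
        \<le> gauss_volume \<beta> n * (C * real n powr (- q / 2))"
        unfolding V_def z_def .
    qed
  qed
qed

section \<open>Assembling the asymptotics\<close>

text \<open>The modulus is 2 |sin ((x + y) / 2)| by the half-angle formula, and subtracting pi / 2
  or - pi / 2 from the angle turns the sine into a cosine up to sign.\<close>

lemma norm_cis_diff:
  assumes "c \<in> {pi/2, -pi/2}"
  shows "norm (cis x - cis (- y)) = 2 * \<bar>cos (((x - c) + (y - c)) / 2)\<bar>"
proof -
  have "(norm (cis x - cis (- y)))\<^sup>2 = (cos x - cos y)\<^sup>2 + (sin x + sin y)\<^sup>2"
    by (simp add: cmod_power2)
  also have "\<dots> = 2 - 2 * cos (x + y)"
    unfolding cos_add using sin_cos_squared_add[of x] sin_cos_squared_add[of y] by algebra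
  also have "cos (x + y) = 1 - 2 * (sin ((x + y) / 2))\<^sup>2"
  proof -
    have "2 * ((x + y) / 2) = x + y" by simp
    then show ?thesis using cos_double_sin[of "(x + y) / 2"] by (simp only:)
  qed
  finally have "(norm (cis x - cis (- y)))\<^sup>2 = (2 * \<bar>sin ((x + y) / 2)\<bar>)\<^sup>2"
    by (simp add: power_mult_distrib)
  then have 1: "norm (cis x - cis (- y)) = 2 * \<bar>sin ((x + y) / 2)\<bar>"
    by (rule power2_eq_imp_eq) auto
  have "\<bar>cos (((x - c) + (y - c)) / 2)\<bar> = \<bar>sin ((x + y) / 2)\<bar>"
  proof -
    have e: "((x - c) + (y - c)) / 2 = (x + y) / 2 - c" by (simp add: field_simps)
    have "c = pi / 2 \<or> c = - (pi / 2)" using assms by auto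
    then show ?thesis unfolding e by (elim disjE; hypsubst) (simp_all add: cos_diff cos_add)
  qed
  then show ?thesis using 1 by simp
qed

lemma prod_pairs_two_powr:
  "(\<Prod>j\<in>{1..n}. \<Prod>k\<in>{j<..n}. 2 powr \<beta>) = 2 powr (\<beta> * (real n * (real n - 1) / 2))"
proof -
  have "(\<Sum>j\<in>{1..n}. \<Sum>k\<in>{j<..n}. \<beta> * ln 2) = \<beta> * (real n * (real n - 1) / 2) * ln 2"
    using sum_pairs_symmetric[of "\<lambda>_ _. \<beta> * ln 2" n] by (simp add: algebra_simps)
  then have "exp (\<Sum>j\<in>{1..n}. \<Sum>k\<in>{j<..n}. \<beta> * ln 2) = 2 powr (\<beta> * (real n * (real n - 1) / 2))"
    by (simp add: powr_def)
  then show ?thesis by (simp add: exp_sum powr_def exp_of_nat_mult[symmetric])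
qed

lemma I_int_integrand:
  assumes "c \<in> {pi/2, -pi/2}"
  shows "I_int \<beta> n f = of_real (2 powr (\<beta> * (real n * (real n - 1) / 2))) *
    (LINT \<theta>|cube n. integrand \<beta> c n f \<theta>)"
proof -
  have "(\<Prod>j\<in>{1..n}. \<Prod>k\<in>{j<..n}. norm (cis (\<theta> j) - cis (- \<theta> k)) powr \<beta>) =
      2 powr (\<beta> * (real n * (real n - 1) / 2)) * kernel \<beta> c n \<theta>" for \<theta> :: "nat \<Rightarrow> real"
    unfolding norm_cis_diff[OF assms] prod_pairs_two_powr[symmetric] by (simp add: powr_mult prod.distrib)
  then have "I_int \<beta> n f = (LINT \<theta>|cube n. of_real (2 powr (\<beta> * (real n * (real n - 1) / 2))) * integrand \<beta> c n f \<theta>)"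
    unfolding I_int_def integrand_def by (simp only: of_real_mult mult.assoc)
  then show ?thesis by (simp only: integral_mult_right_zero)
qed

text \<open>The left side of \<open>norm_cis_diff\<close> does not mention the center, so one and
  the same integrand may be expanded around either of them.\<close>

lemma integrand_center_indep:
  assumes "c \<in> {pi/2, -pi/2}"
  shows "integrand \<beta> c n \<phi> = integrand \<beta> (pi/2) n \<phi>"
proof -
  have "\<bar>cos (((x - c) + (y - c)) / 2)\<bar> = \<bar>cos (((x - pi/2) + (y - pi/2)) / 2)\<bar>" for x y :: real
    using norm_cis_diff[OF assms, of x y] norm_cis_diff[of "pi/2" x y] by simp
  then show ?thesis unfolding integrand_def[abs_def] by (simp only:)
qed

text \<open>With \<open>z\<close> the value at the center, this takes out exp (n \<phi>(c)) and
  leaves the local analysis with a function that vanishes there.\<close>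

lemma integrand_shift:
  "integrand \<beta> c n \<phi> \<theta> = exp (of_nat n * z) * integrand \<beta> c n (\<lambda>x. \<phi> x - z) \<theta>"
proof -
  have "(\<Prod>j\<in>{1..n}. exp (\<phi> (\<theta> j))) = exp (of_nat n * z) * (\<Prod>j\<in>{1..n}. exp (\<phi> (\<theta> j) - z))"
    by (simp add: exp_of_nat_mult exp_diff prod_dividef)
  then show ?thesis by (simp add: integrand_def)
qed

lemma norm_integrand:
  "norm (integrand \<beta> c n \<phi> \<theta>) = kernel \<beta> c n \<theta> * (\<Prod>j\<in>{1..n}. exp (Re (\<phi> (\<theta> j))))"
  unfolding integrand_def norm_mult norm_of_real prod_norm[symmetric] norm_exp_eq_Re
  by (simp add: abs_of_nonneg prod_nonneg)

lemma finite_measure_PiM_lebesgue_on: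
  "finite I \<Longrightarrow> finite_measure (Pi\<^sub>M I (\<lambda>_. lebesgue_on {-pi..pi::real}))"
proof -
  assume I: "finite I"
  interpret M: finite_measure "lebesgue_on {-pi..pi::real}" by (rule finite_measure_lebesgue_on) auto
  interpret P: product_sigma_finite "\<lambda>_. lebesgue_on {-pi..pi::real}" by standard
  have "emeasure (Pi\<^sub>M I (\<lambda>_. lebesgue_on {-pi..pi})) (space (Pi\<^sub>M I (\<lambda>_. lebesgue_on {-pi..pi}))) = (\<Prod>i\<in>I. emeasure (lebesgue_on {-pi..pi}) (space (lebesgue_on {-pi..pi::real})))"
    unfolding space_PiM by (rule P.emeasure_PiM[OF I]) auto
  also have "\<dots> \<noteq> \<infinity>"
    using M.emeasure_finite by (auto simp: ennreal_prod_eq_top power_eq_top_ennreal)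
  finally show ?thesis by (rule finite_measureI)
qed

lemma integrand_integrable:
  assumes "\<beta> > 0" "\<phi> \<in> borel_measurable lebesgue" "\<And>x. Re (\<phi> x) \<le> B" "A \<in> borel_measurable (leb_pow n)" "\<And>\<theta>. \<bar>A \<theta>\<bar> \<le> (1::real)"
  shows "integrable (cube n) (\<lambda>\<theta>. A \<theta> *\<^sub>R integrand \<beta> c n \<phi> \<theta>)"
proof -
  interpret finite_measure "cube n" by (rule finite_measure_PiM_lebesgue_on) simp
  show ?thesis
  proof (rule integrable_const_bound[where B="exp B ^ n"])
    have "norm (integrand \<beta> c n \<phi> \<theta>) \<le> 1 * exp B ^ n" for \<theta>
      unfolding norm_integrand
    proof (intro mult_mono)
      have "\<bar>cos x\<bar> powr \<beta> \<le> 1" for x :: real using assms(1) by (intro powr_le1) auto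
      then show "kernel \<beta> c n \<theta> \<le> 1"
        by (intro prod_le_1 conjI prod_nonneg) auto
      have "(\<Prod>j\<in>{1..n}. exp (Re (\<phi> (\<theta> j)))) \<le> (\<Prod>j\<in>{1..n}. exp B)" using assms(3) by (intro prod_mono) auto
      then show "(\<Prod>j\<in>{1..n}. exp (Re (\<phi> (\<theta> j)))) \<le> exp B ^ n" by simp
    qed (auto intro!: prod_nonneg)
    then have "norm (A \<theta> *\<^sub>R integrand \<beta> c n \<phi> \<theta>) \<le> 1 * exp B ^ n" for \<theta>
      unfolding norm_scaleR using assms(5)[of \<theta>] by (intro mult_mono) auto
    then show "AE \<theta> in cube n. norm (A \<theta> *\<^sub>R integrand \<beta> c n \<phi> \<theta>) \<le> exp B ^ n" by simp
    have "(\<lambda>\<theta>. A \<theta> *\<^sub>R integrand \<beta> c n \<phi> \<theta>) \<in> borel_measurable (leb_pow n)"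
      by (intro borel_measurable_scaleR assms(4) borel_measurable_integrand assms(2))
    from measurable_compose[OF measurable_id_PiM_lebesgue_on[where s=1] this, of "{-pi..pi}"]
    show "(\<lambda>\<theta>. A \<theta> *\<^sub>R integrand \<beta> c n \<phi> \<theta>) \<in> borel_measurable (cube n)"
      by simp
  qed
qed

text \<open>The cube is cut into the two neighborhoods and a rest. Every configuration of the rest
  lies in \<open>far\<close> for at least one center, so the integral \<open>R\<close> over it is
  bounded by the two far integrals together.\<close>

lemma I_int_split:
  fixes \<beta> \<delta> L B :: real and \<phi> :: "real \<Rightarrow> complex"
  assumes bt: "\<beta> > 0" and \<delta>: "0 < \<delta>" "\<delta> \<le> 1" and \<phi>m: "\<phi> \<in> borel_measurable lebesgue" and n: "n \<ge> 1"
    and bd: "\<And>x. \<bar>Re (\<phi> x)\<bar> \<le> B"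
    and rest: "\<And>c. c \<in> {pi/2, -pi/2} \<Longrightarrow> (LINT \<theta>|cube n.
      indicator (far \<delta> c n) \<theta> *
      (kernel \<beta> c n \<theta> * (\<Prod>j\<in>{1..n}. exp (Re (\<phi> (\<theta> j))))))
      \<le> X c"
  obtains R where "norm R \<le> X (pi/2) + X (-pi/2)"
    "I_int \<beta> n \<phi> = of_real (2 powr (\<beta> * (real n * (real n - 1) / 2))) *
      (exp (of_nat n * \<phi> (pi/2)) * (LINT \<theta>|cube n. indicator (nearby \<delta> (pi/2) n) \<theta> *\<^sub>R integrand \<beta> (pi/2) n (\<lambda>x. \<phi> x - \<phi> (pi/2)) \<theta>)
      + exp (of_nat n * \<phi> (-pi/2)) * (LINT \<theta>|cube n. indicator (nearby \<delta> (-pi/2) n) \<theta> *\<^sub>R integrand \<beta> (-pi/2) n (\<lambda>x. \<phi> x - \<phi> (-pi/2)) \<theta>)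
      + R)"
proof -
  let ?M = "cube n"
  let ?L = "Pi\<^sub>M {1..n} (\<lambda>_. lebesgue :: real measure)"
  define F where "F = integrand \<beta> (pi/2) n \<phi>"
  define Np Nm where "Np = nearby \<delta> (pi/2) n" and "Nm = nearby \<delta> (-pi/2) n"
  define r where "r \<theta> = (1 - indicator Np \<theta> - indicator Nm \<theta> :: real)" for \<theta>
  have Fc: "integrand \<beta> c n \<phi> = F" if "c \<in> {pi/2, -pi/2}" for c
    unfolding F_def by (rule integrand_center_indep[OF that])
  \<comment> \<open>A common point would have its first coordinate, present as n \<ge> 1, within
    distance 1 of both centers, which are pi apart.\<close>
  have disj: "Np \<inter> Nm = {}"
  proof -
    have False if "\<theta> \<in> Np" "\<theta> \<in> Nm" for \<theta>
    proof -
      have "\<bar>\<theta> 1 - pi/2\<bar> \<le> 1" "\<bar>\<theta> 1 - - pi/2\<bar> \<le> 1" using that n \<delta> by (force simp: Np_def Nm_def nearby_def)+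
      then show False using pi_gt3 by linarith
    qed
    then show ?thesis by auto
  qed
  have r01: "r \<theta> = 0 \<or> r \<theta> = 1" for \<theta> using disj by (auto simp: r_def indicator_def)
  have Nm[measurable]: "(indicator Np :: _ \<Rightarrow> real) \<in> borel_measurable ?L" "(indicator Nm :: _ \<Rightarrow> real) \<in> borel_measurable ?L"
    unfolding Np_def Nm_def by (rule measurable_indicator_nearby)+
  have rm: "r \<in> borel_measurable ?L" unfolding r_def[abs_def] by measurable
  have Re_le: "Re (\<phi> x) \<le> B" for x using bd[of x] by linarith
  have ii: "integrable ?M (\<lambda>\<theta>. A \<theta> *\<^sub>R F \<theta>)" if "A \<in> borel_measurable ?L" "\<And>\<theta>. \<bar>A \<theta>\<bar> \<le> (1::real)" for A
    unfolding F_def by (rule integrand_integrable[OF bt \<phi>m Re_le that])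
  have ip: "integrable ?M (\<lambda>\<theta>. indicator Np \<theta> *\<^sub>R F \<theta>)" "integrable ?M (\<lambda>\<theta>. indicator Nm \<theta> *\<^sub>R F \<theta>)"
    by (rule ii[OF Nm(1)], simp add: indicator_def, rule ii[OF Nm(2)], simp add: indicator_def)
  have ir: "integrable ?M (\<lambda>\<theta>. r \<theta> *\<^sub>R F \<theta>)"
    by (rule ii[OF rm]) (use r01 in \<open>metis abs_one abs_zero order_refl zero_le_one\<close>)
  define R where "R = (LINT \<theta>|?M. r \<theta> *\<^sub>R F \<theta>)"
  have "integral\<^sup>L ?M F = (LINT \<theta>|?M. indicator Np \<theta> *\<^sub>R F \<theta> + indicator Nm \<theta> *\<^sub>R F \<theta> + r \<theta> *\<^sub>R F \<theta>)"
    by (intro Bochner_Integration.integral_cong) (simp_all add: r_def algebra_simps)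
  also have "\<dots> = (LINT \<theta>|?M. indicator Np \<theta> *\<^sub>R F \<theta>) + (LINT \<theta>|?M. indicator Nm \<theta> *\<^sub>R F \<theta>) + R"
    using ip ir by (simp add: R_def)
  finally have FI: "integral\<^sup>L ?M F = (LINT \<theta>|?M. indicator Np \<theta> *\<^sub>R F \<theta>) + (LINT \<theta>|?M. indicator Nm \<theta> *\<^sub>R F \<theta>) + R" .
  have sh: "(LINT \<theta>|?M. indicator (nearby \<delta> c n) \<theta> *\<^sub>R F \<theta>) = exp (of_nat n * \<phi> c) * (LINT \<theta>|?M. indicator (nearby \<delta> c n) \<theta> *\<^sub>R integrand \<beta> c n (\<lambda>x. \<phi> x - \<phi> c) \<theta>)"
    if "c \<in> {pi/2, -pi/2}" for c
    unfolding Fc[OF that, symmetric] integrand_shift[of \<beta> c n \<phi> _ "\<phi> c"] integral_mult_right_zero[symmetric] by simp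
  define Ac where "Ac c = far \<delta> c n" for c
  have nF: "norm (F \<theta>) = kernel \<beta> c n \<theta> * (\<Prod>j\<in>{1..n}. exp (Re (\<phi> (\<theta> j))))"
    if "c \<in> {pi/2, -pi/2}" for c \<theta>
    unfolding Fc[OF that, symmetric] by (rule norm_integrand)
  have X: "(LINT \<theta>|?M. indicator (Ac c) \<theta> * norm (F \<theta>)) \<le> X c" if "c \<in> {pi/2, -pi/2}" for c
    using rest[OF that] unfolding nF[OF that] Ac_def .
  have iA: "integrable ?M (\<lambda>\<theta>. indicator (Ac c) \<theta> * norm (F \<theta>))" for c
  proof -
    have [measurable]: "(\<lambda>\<theta>. \<Sum>j\<in>{1..n}. 1 - cos (\<theta> j - c)) \<in> borel_measurable ?L"
    proof (rule borel_measurable_sum)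
      fix j assume "j \<in> {1..n}"
      then have [measurable]: "(\<lambda>\<theta>. \<theta> j) \<in> borel_measurable ?L" by (rule borel_measurable_PiM_lebesgue_coordinate)
      show "(\<lambda>\<theta>. 1 - cos (\<theta> j - c)) \<in> borel_measurable ?L" by measurable
    qed
    have [measurable]: "(indicator (nearby \<delta> c n) :: _ \<Rightarrow> real) \<in> borel_measurable ?L"
      by (rule measurable_indicator_nearby)
    have "(indicator (Ac c) :: _ \<Rightarrow> real) = (\<lambda>\<theta>. if (\<Sum>j\<in>{1..n}. 1 - cos (\<theta> j - c)) \<le> real n then 1 - indicator (nearby \<delta> c n) \<theta> else 0)"
      by (auto simp: Ac_def nearby_def indicator_def fun_eq_iff not_le)
    moreover have "(\<lambda>\<theta>. if (\<Sum>j\<in>{1..n}. 1 - cos (\<theta> j - c)) \<le> real n then 1 - indicator (nearby \<delta> c n) \<theta> else 0 :: real) \<in> borel_measurable ?L"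
      by measurable
    ultimately have "(indicator (Ac c) :: _ \<Rightarrow> real) \<in> borel_measurable ?L" by (simp only:)
    from integrable_norm[OF ii[OF this]] show ?thesis by (simp add: indicator_def)
  qed
  have "norm R \<le> (LINT \<theta>|?M. norm (r \<theta> *\<^sub>R F \<theta>))" unfolding R_def by (rule integral_norm_bound)
  also have "\<dots> \<le> (LINT \<theta>|?M. indicator (Ac (pi/2)) \<theta> * norm (F \<theta>) + indicator (Ac (-pi/2)) \<theta> * norm (F \<theta>))"
  proof (rule integral_mono')
    fix \<theta>
    show "norm (r \<theta> *\<^sub>R F \<theta>) \<le> indicator (Ac (pi/2)) \<theta> * norm (F \<theta>) + indicator (Ac (-pi/2)) \<theta> * norm (F \<theta>)"
    proof (cases "\<theta> \<in> Np \<or> \<theta> \<in> Nm")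
      case True
      then have "r \<theta> = 0" using disj by (auto simp: r_def indicator_def)
      then show ?thesis by simp
    next
      case False
      \<comment> \<open>The cosines for the two centers cancel, so one of the two sums is at most
        n.\<close>
      have "(\<Sum>j\<in>{1..n}. 1 - cos (\<theta> j - pi/2)) + (\<Sum>j\<in>{1..n}. 1 - cos (\<theta> j - - pi/2)) = 2 * real n"
        by (simp add: cos_diff cos_add flip: sum.distrib)
      then have "(\<Sum>j\<in>{1..n}. 1 - cos (\<theta> j - pi/2)) \<le> real n \<or> (\<Sum>j\<in>{1..n}. 1 - cos (\<theta> j - - pi/2)) \<le> real n" by linarith
      then have "\<theta> \<in> Ac (pi/2) \<or> \<theta> \<in> Ac (-pi/2)"
        using False unfolding Ac_def Np_def Nm_def nearby_def by (auto simp: not_le)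
      moreover have "r \<theta> = 1" using False by (simp add: r_def)
      ultimately show ?thesis by (auto simp: indicator_def)
    qed
  qed (use iA in \<open>auto intro!: add_nonneg_nonneg\<close>)
  also have "\<dots> \<le> X (pi/2) + X (-pi/2)"
    using iA X[of "pi/2"] X[of "-pi/2"] by simp
  finally have nR: "norm R \<le> X (pi/2) + X (-pi/2)" .
  show ?thesis
    by (rule that[OF nR]) (use I_int_integrand[of "pi/2" \<beta> n \<phi>] sh[of "pi/2"] sh[of "-pi/2"] FI in \<open>simp add: Np_def Nm_def F_def\<close>)
qed

text \<open>A relative error becomes a correction of the exponent: w exp (- E) = 1 + u with |u|
  \<le> r, and |Ln (1 + u)| \<le> 2 |u| for |u| < 1/2, where 1 + u also stays away from 0.\<close>

lemma exp_add_Ln_quotient: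
  fixes w E :: complex
  assumes "norm (w - exp E) \<le> r * norm (exp E)" "r < 1/2"
  shows "exp (E + Ln (w * exp (- E))) = w" "norm (Ln (w * exp (- E))) \<le> 2 * r"
proof -
  define u where "u = w * exp (- E) - 1"
  have "u = (w - exp E) * exp (- E)" by (simp add: u_def left_diff_distrib flip: exp_add)
  then have "norm u \<le> r * norm (exp E) * norm (exp (- E))"
    unfolding norm_mult by (simp only: mult_right_mono[OF assms(1)] norm_ge_zero norm_mult)
  also have "\<dots> = r" by (simp add: mult.assoc flip: exp_add)
  finally have "norm u \<le> r" .
  then have u: "norm u < 1/2" using assms(2) by linarith
  have w: "w * exp (- E) = 1 + u" by (simp add: u_def)
  show "norm (Ln (w * exp (- E))) \<le> 2 * r" using norm_Ln_le[OF u] \<open>norm u \<le> r\<close> unfolding w by linarith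
  have "u \<noteq> - 1" using u by auto
  then have "1 + u \<noteq> 0" by (simp add: add_eq_0_iff)
  then have "w * exp (- E) \<noteq> 0" using w by simp
  then show "exp (E + Ln (w * exp (- E))) = w" by (simp add: exp_add exp_minus field_simps)
qed

abbreviation expansion :: "real \<Rightarrow> (real \<Rightarrow> complex) \<Rightarrow> real \<Rightarrow> nat \<Rightarrow> complex \<Rightarrow> complex \<Rightarrow> bool" where
  "expansion \<beta> f t n w\<^sub>1 w\<^sub>2 \<equiv> I_int \<beta> n (\<lambda>\<theta>. of_real t * f \<theta>) = complex_of_real (prefactor \<beta> n) *
    (exp (of_nat n * of_real t * f (pi/2))
       * exp ((of_real t)\<^sup>2 * (D1 f (pi/2))\<^sup>2 / of_real \<beta> + 2 * of_real t * D2 f (pi/2) / of_real \<beta> + w\<^sub>1)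
   + exp (of_nat n * of_real t * f (-pi/2))
       * exp ((of_real t)\<^sup>2 * (D1 f (-pi/2))\<^sup>2 / of_real \<beta> + 2 * of_real t * D2 f (-pi/2) / of_real \<beta> + w\<^sub>2))"

text \<open>The error terms have to be chosen before the compact set. They are therefore defined by
  explicit formulas for all t and n, and only their estimates refer to \<open>K\<close>.\<close>

lemma I_int_asymp_uniform:
  fixes \<beta> q :: real and f :: "real \<Rightarrow> complex"
  assumes bt: "\<beta> > 0" and fm: "f \<in> borel_measurable lebesgue" and fb: "bounded (range f)"
    and q: "0 < q" "q \<le> 1" and C2: "C2_holder_near q f (pi/2)" "C2_holder_near q f (-pi/2)"
  shows "\<exists>\<epsilon>\<^sub>1 \<epsilon>\<^sub>2 :: real \<Rightarrow> nat \<Rightarrow> complex. \<forall>K. compact K \<longrightarrow>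
    (\<exists>C. \<forall>\<^sub>F n in sequentially. \<forall>t\<in>K.
      norm (\<epsilon>\<^sub>1 t n) \<le> C * real n powr (- q / 2) \<and>
      norm (\<epsilon>\<^sub>2 t n) \<le> C * real n powr (- q / 2) \<and>
      expansion \<beta> f t n (\<epsilon>\<^sub>1 t n) (\<epsilon>\<^sub>2 t n))"
proof -
  obtain d0 C6 :: real where d0: "0 < d0" "d0 \<le> 1" "0 \<le> C6" and lc0:
    "\<And>u. \<bar>u\<bar> \<le> d0 \<Longrightarrow> 0 < cos u"
    "\<And>u. \<bar>u\<bar> \<le> d0 \<Longrightarrow> \<bar>ln (cos u) + u^2/2 + u^4/12\<bar> \<le> C6 * u^6"
    "\<And>u. \<bar>u\<bar> \<le> d0 \<Longrightarrow> ln (cos u) \<le> - (u^2/2)"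
    using ln_cos_expansion by blast
  obtain d1 L1 where d1: "0 < d1" "d1 \<le> d0" "0 \<le> L1"
    "\<And>x. \<bar>x\<bar> \<le> d1 \<Longrightarrow> norm (f (pi/2 + x) - f (pi/2) - D1 f (pi/2) * of_real x - D2 f (pi/2) / 2 * (of_real x)\<^sup>2) \<le> L1 * \<bar>x\<bar> powr (2 + q)"
    using C2_holder_near_expansion[OF C2(1) d0(1) q(1)] by blast
  obtain \<delta> L2 where d2: "0 < \<delta>" "\<delta> \<le> d1" "0 \<le> L2"
    "\<And>x. \<bar>x\<bar> \<le> \<delta> \<Longrightarrow> norm (f (-pi/2 + x) - f (-pi/2) - D1 f (-pi/2) * of_real x - D2 f (-pi/2) / 2 * (of_real x)\<^sup>2) \<le> L2 * \<bar>x\<bar> powr (2 + q)"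
    using C2_holder_near_expansion[OF C2(2) d1(1) q(1)] by blast
  have \<delta>: "0 < \<delta>" "\<delta> \<le> 1" "\<delta> \<le> d0" "\<delta> \<le> pi / 2" using d0 d1 d2 pi_gt3 by linarith+
  define L where "L = max L1 L2"
  have L0: "0 \<le> L" using d1 by (simp add: L_def)
  have tay: "norm (f (c + x) - f c - D1 f c * of_real x - D2 f c / 2 * (of_real x)\<^sup>2) \<le> L * \<bar>x\<bar> powr (2 + q)"
    if "c \<in> {pi/2, -pi/2}" "\<bar>x\<bar> \<le> \<delta>" for c x
  proof -
    have "L1 * \<bar>x\<bar> powr (2 + q) \<le> L * \<bar>x\<bar> powr (2 + q)" "L2 * \<bar>x\<bar> powr (2 + q) \<le> L * \<bar>x\<bar> powr (2 + q)"
      by (auto simp: L_def intro!: mult_right_mono)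
    moreover have "\<bar>x\<bar> \<le> d1" using that d2 by linarith
    ultimately show ?thesis using that(1) d1(4)[of x] d2(4)[OF that(2)] by (elim insertE emptyE; hypsubst) linarith+
  qed
  obtain Fb where Fb: "\<And>x. norm (f x) \<le> Fb" using fb by (auto simp: bounded_iff)
  have Fb0: "0 \<le> Fb" using Fb[of 0] norm_ge_zero order_trans by blast
  define DB where "DB = norm (D1 f (pi/2)) + norm (D1 f (-pi/2)) + norm (D2 f (pi/2)) + norm (D2 f (-pi/2))"
  have DB: "norm (D1 f c) \<le> DB" "norm (D2 f c) \<le> DB" if "c \<in> {pi/2, -pi/2}" for c
  proof -
    have "norm (D1 f c) \<le> DB \<and> norm (D2 f c) \<le> DB"
      using that unfolding DB_def by (elim insertE emptyE; hypsubst) simp_all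
    then show "norm (D1 f c) \<le> DB" "norm (D2 f c) \<le> DB" by auto
  qed
  have DB0: "0 \<le> DB" by (simp add: DB_def)
  define Ex where "Ex c t = (of_real t)\<^sup>2 * (D1 f c)\<^sup>2 / of_real \<beta> + 2 * of_real t * D2 f c / of_real \<beta>" for c t
  define V where "V n = gauss_volume \<beta> n" for n :: nat
  define A0 where "A0 = 2 powr (-1/2) * exp (1 - 1 / (2 * \<beta>))"
  have A0: "A0 > 0" by (simp add: A0_def)
  define N2 where "N2 n = 2 powr (\<beta> * (real n * (real n - 1) / 2))" for n :: nat
  have pre: "prefactor \<beta> n = N2 n * V n * A0" for n
    by (simp add: prefactor_def N2_def V_def A0_def powr_diff powr_minus_divide)
  define J where "J c t n = (LINT \<theta>|cube n. indicator (nearby \<delta> c n) \<theta> *\<^sub>R integrand \<beta> c n (\<lambda>x. of_real t * f x - of_real t * f c) \<theta>)" for c t n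
  define U where "U c t n = exp (of_nat n * of_real t * f c)" for c t and n :: nat
  \<comment> \<open>Defined by subtraction, so that the decomposition is an identity for all t and
    n; its smallness is shown for n large depending on \<open>K\<close>.\<close>
  define R where "R t n = I_int \<beta> n (\<lambda>\<theta>. of_real t * f \<theta>) / of_real (N2 n) - U (pi/2) t n * J (pi/2) t n - U (-pi/2) t n * J (-pi/2) t n" for t n
  \<comment> \<open>The remainder is charged to the center whose factor exp (n t f(c)) has the
    larger modulus, with ties going to pi / 2. Divided by the other factor it could be exponentially
    large.\<close>
  define pick where "pick t = (Re (of_real t * f (-pi/2)) \<le> Re (of_real t * f (pi/2)))" for t :: real
  define H1 where "H1 t n = (J (pi/2) t n + (if pick t then R t n / U (pi/2) t n else 0)) / of_real (V n * A0)" for t n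
  define H2 where "H2 t n = (J (-pi/2) t n + (if pick t then 0 else R t n / U (-pi/2) t n)) / of_real (V n * A0)" for t n
  define \<epsilon>1 where "\<epsilon>1 t n = Ln (H1 t n * exp (- Ex (pi/2) t))" for t n
  define \<epsilon>2 where "\<epsilon>2 t n = Ln (H2 t n * exp (- Ex (-pi/2) t))" for t n
  let ?G = "\<lambda>C t n. norm (\<epsilon>1 t n) \<le> C * real n powr (- q / 2) \<and> norm (\<epsilon>2 t n) \<le> C * real n powr (- q / 2) \<and>
    I_int \<beta> n (\<lambda>\<theta>. of_real t * f \<theta>) = complex_of_real (prefactor \<beta> n) *
      (U (pi/2) t n * exp (Ex (pi/2) t + \<epsilon>1 t n) + U (-pi/2) t n * exp (Ex (-pi/2) t + \<epsilon>2 t n))"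
  have main: "\<exists>C. \<forall>\<^sub>F n in sequentially. \<forall>t\<in>K. ?G C t n"
    if K: "compact K" for K
  proof -
    obtain T where T: "\<And>t. t \<in> K \<Longrightarrow> \<bar>t\<bar> \<le> T" "0 \<le> T"
    proof -
      from compact_imp_bounded[OF K] obtain b where "0 < b" "\<forall>x\<in>K. norm x \<le> b" unfolding bounded_pos by blast
      then show ?thesis using that[of b] by simp
    qed
    have loc: "\<exists>C. 0 \<le> C \<and> (\<forall>\<^sub>F n in sequentially. \<forall>t\<in>K. norm (J c t n - of_real (V n * A0) * exp (Ex c t)) \<le> V n * (C * real n powr (- q / 2)))"
      if c: "c \<in> {pi/2, -pi/2}" for c
    proof -
      have TL: "0 \<le> T * L" "0 \<le> T * DB" using T(2) L0 DB0 by auto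
      obtain C where C: "0 \<le> C"
        "\<forall>\<^sub>F n in sequentially. local_asymp \<beta> q \<delta> (T * L) (T * DB) c C n"
        by (rule local_integral_asymp[OF bt q d0(3) lc0 \<delta>(1,2) TL c]) (use \<delta>(3) in auto)
      have "\<forall>\<^sub>F n in sequentially. \<forall>t\<in>K. norm (J c t n - of_real (V n * A0) * exp (Ex c t)) \<le> V n * (C * real n powr (- q / 2))"
        using C(2)
      proof (eventually_elim, intro ballI)
        fix n t
        assume H: "local_asymp \<beta> q \<delta> (T * L) (T * DB) c C n"
          and t: "t \<in> K"
        have tT: "\<bar>t\<bar> \<le> T" by (rule T(1)[OF t])
        have 1: "(\<lambda>x. of_real t * f x - of_real t * f c) \<in> borel_measurable lebesgue"
          using fm by measurable
        have 2: "\<forall>x. \<bar>x\<bar> \<le> \<delta> \<longrightarrow> norm (of_real t * f (c + x) - of_real t * f c - of_real t * D1 f c * of_real x - of_real t * D2 f c / 2 * (of_real x)\<^sup>2) \<le> T * L * \<bar>x\<bar> powr (2 + q)"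
          (is "\<forall>x. _ \<longrightarrow> ?E x")
        proof (intro allI impI)
          fix x :: real assume x: "\<bar>x\<bar> \<le> \<delta>"
          have "of_real t * f (c + x) - of_real t * f c - of_real t * D1 f c * of_real x - of_real t * D2 f c / 2 * (of_real x)\<^sup>2 =
            of_real t * (f (c + x) - f c - D1 f c * of_real x - D2 f c / 2 * (of_real x)\<^sup>2)"
            by (simp add: algebra_simps)
          also have "norm \<dots> \<le> T * (L * \<bar>x\<bar> powr (2 + q))"
            unfolding norm_mult norm_of_real by (intro mult_mono tT tay c x T(2) norm_ge_zero)
          finally show "?E x"
            by (simp add: mult.assoc)
        qed
        have 3: "norm (of_real t * D1 f c) \<le> T * DB" "norm (of_real t * D2 f c) \<le> T * DB"
          unfolding norm_mult norm_of_real by (intro mult_mono tT DB c T(2) norm_ge_zero)+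
        have "exp ((of_real t * D1 f c)\<^sup>2 / \<beta> + (1 + 2 * (of_real t * D2 f c) / \<beta> - of_real (1 / (2 * \<beta>)))) = of_real (exp (1 - 1 / (2 * \<beta>))) * exp (Ex c t)"
          by (simp add: Ex_def power_mult_distrib algebra_simps exp_of_real[symmetric] flip: exp_add)
        then show "norm (J c t n - of_real (V n * A0) * exp (Ex c t)) \<le> V n * (C * real n powr (- q / 2))"
          using H[rule_format, OF 1 2[rule_format] 3] by (simp add: J_def V_def A0_def mult.assoc)
      qed
      then show ?thesis using C(1) by blast
    qed
    obtain Cp where Cp: "0 \<le> Cp" "\<forall>\<^sub>F n in sequentially. \<forall>t\<in>K. norm (J (pi/2) t n - of_real (V n * A0) * exp (Ex (pi/2) t)) \<le> V n * (Cp * real n powr (- q / 2))"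
      using loc[of "pi/2"] by auto
    obtain Cm where Cm: "0 \<le> Cm" "\<forall>\<^sub>F n in sequentially. \<forall>t\<in>K. norm (J (-pi/2) t n - of_real (V n * A0) * exp (Ex (-pi/2) t)) \<le> V n * (Cm * real n powr (- q / 2))"
      using loc[of "-pi/2"] by auto
    \<comment> \<open>Lipschitz constant of t f at a center: for |y| \<le> 1 the quadratic term and
      the Hoelder remainder are also bounded by multiples of |y|.\<close>
    define Lh where "Lh = T * (DB + DB + L)"
    have Lh0: "0 \<le> Lh" using T(2) DB0 L0 by (simp add: Lh_def)
    have TF0: "0 \<le> T * Fb" using T(2) Fb0 by simp
    have lip: "\<bar>Re (of_real t * f (c + y)) - Re (of_real t * f c)\<bar> \<le> Lh * \<bar>y\<bar>"
      if t: "t \<in> K" and c: "c \<in> {pi/2, -pi/2}" and y: "\<bar>y\<bar> \<le> \<delta>" for t c y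
    proof -
      have y1: "\<bar>y\<bar> \<le> 1" using y \<delta> by linarith
      have yq: "\<bar>y\<bar> powr (2 + q) \<le> \<bar>y\<bar>"
      proof (cases "y = 0")
        case False
        then have "\<bar>y\<bar> powr (2 + q) \<le> \<bar>y\<bar> powr 1" using y1 q by (intro powr_mono') auto
        then show ?thesis using False by simp
      qed simp
      have y2: "(cmod (of_real y))\<^sup>2 \<le> \<bar>y\<bar>" using y1 mult_left_mono[OF y1, of "\<bar>y\<bar>"] by (simp add: power2_eq_square flip: abs_mult)
      have "f (c + y) - f c = (f (c + y) - f c - D1 f c * of_real y - D2 f c / 2 * (of_real y)\<^sup>2) + (D1 f c * of_real y + D2 f c / 2 * (of_real y)\<^sup>2)" by simp
      then have "norm (f (c + y) - f c) \<le> norm (f (c + y) - f c - D1 f c * of_real y - D2 f c / 2 * (of_real y)\<^sup>2) + (norm (D1 f c * of_real y) + norm (D2 f c / 2 * (of_real y)\<^sup>2))"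
        by (metis norm_triangle_ineq norm_triangle_mono order_refl)
      also have "\<dots> \<le> L * \<bar>y\<bar> + (DB * \<bar>y\<bar> + DB * \<bar>y\<bar>)"
      proof (intro add_mono)
        show "norm (f (c + y) - f c - D1 f c * of_real y - D2 f c / 2 * (of_real y)\<^sup>2) \<le> L * \<bar>y\<bar>"
          using tay[OF c y] mult_left_mono[OF yq L0] by linarith
        show "norm (D1 f c * of_real y) \<le> DB * \<bar>y\<bar>" unfolding norm_mult norm_of_real by (intro mult_right_mono DB c) simp
        have "norm (D2 f c / 2) \<le> DB" using DB(2)[OF c] DB0 by (simp add: norm_divide)
        then show "norm (D2 f c / 2 * (of_real y)\<^sup>2) \<le> DB * \<bar>y\<bar>" unfolding norm_mult norm_power by (intro mult_mono y2 DB0) auto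
      qed
      finally have fl: "norm (f (c + y) - f c) \<le> (DB + DB + L) * \<bar>y\<bar>" by (simp add: algebra_simps)
      have "Re (of_real t * f (c + y)) - Re (of_real t * f c) = Re (of_real t * (f (c + y) - f c))" by (simp add: algebra_simps)
      also have "\<bar>\<dots>\<bar> \<le> norm (of_real t * (f (c + y) - f c))" by (rule abs_Re_le_cmod)
      also have "\<dots> \<le> T * ((DB + DB + L) * \<bar>y\<bar>)"
        unfolding norm_mult norm_of_real by (intro mult_mono T t fl norm_ge_zero)
      finally show ?thesis by (simp add: Lh_def mult.assoc)
    qed
    have bnd: "\<bar>Re (of_real t * f x)\<bar> \<le> T * Fb" if t: "t \<in> K" for t x
    proof -
      have "\<bar>Re (of_real t * f x)\<bar> \<le> norm (of_real t * f x)" by (rule abs_Re_le_cmod)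
      also have "\<dots> \<le> T * Fb" unfolding norm_mult norm_of_real by (intro mult_mono T t Fb norm_ge_zero)
      finally show ?thesis .
    qed
    have Rb: "\<forall>\<^sub>F n in sequentially. \<forall>t\<in>K. norm (R t n) \<le> V n / real n * (norm (U (pi/2) t n) + norm (U (-pi/2) t n))"
      using rest_bound[OF bt \<delta>(1,4) Lh0 TF0 insertI1[of "pi/2" "{-pi/2}"]]
        rest_bound[OF bt \<delta>(1,4) Lh0 TF0 insertI2[OF singletonI[of "-pi/2"], of "pi/2"]]
        eventually_ge_at_top[of 1]
    proof eventually_elim
      case (elim n)
      show ?case
      proof
      fix t assume tK: "t \<in> K"
      define X where "X c = V n * exp (real n * Re (of_real t * f c)) / real n" for c
      have X: "(LINT \<theta>|cube n.
        indicator (far \<delta> c n) \<theta> *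
        (kernel \<beta> c n \<theta> * (\<Prod>j\<in>{1..n}. exp (Re (of_real t * f (\<theta> j))))))
        \<le> X c" if c: "c \<in> {pi/2, -pi/2}" for c
      proof -
        have b: "\<forall>x. \<bar>Re (of_real t * f x)\<bar> \<le> T * Fb" "\<forall>y. \<bar>y\<bar> \<le> \<delta> \<longrightarrow> \<bar>Re (of_real t * f (c + y)) - Re (of_real t * f c)\<bar> \<le> Lh * \<bar>y\<bar>"
          using bnd lip tK c by blast+
        show ?thesis using c
        proof (elim insertE emptyE)
          assume e: "c = pi/2"
          show ?thesis using elim(1)[THEN spec[of _ "\<lambda>x. Re (of_real t * f x)"], THEN mp, THEN mp, OF b[unfolded e]]
            unfolding X_def V_def e .
        next
          assume e: "c = -pi/2"
          show ?thesis using elim(2)[THEN spec[of _ "\<lambda>x. Re (of_real t * f x)"], THEN mp, THEN mp, OF b[unfolded e]]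
            unfolding X_def V_def e .
        qed
      qed
      have m: "(\<lambda>\<theta>. of_real t * f \<theta>) \<in> borel_measurable lebesgue" using fm by measurable
      obtain R' where R': "norm R' \<le> X (pi/2) + X (-pi/2)"
        "I_int \<beta> n (\<lambda>\<theta>. of_real t * f \<theta>) = of_real (N2 n) * (exp (of_nat n * (of_real t * f (pi/2))) * J (pi/2) t n + exp (of_nat n * (of_real t * f (-pi/2))) * J (-pi/2) t n + R')"
        using I_int_split[OF bt \<delta>(1,2) m elim(3) bnd[OF tK] X] unfolding N2_def J_def by blast
      have N: "N2 n \<noteq> 0" by (simp add: N2_def)
      have "R t n = R'" using N unfolding R_def R'(2) U_def by (simp add: mult.assoc)
      moreover have "X c = V n / real n * norm (U c t n)" for c by (simp add: X_def U_def mult.assoc)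
      ultimately show "norm (R t n) \<le> V n / real n * (norm (U (pi/2) t n) + norm (U (-pi/2) t n))"
        using R'(1) by (simp add: distrib_left)
      qed
    qed
    \<comment> \<open>\<open>Ex\<close> is bounded for t in \<open>K\<close>, so |exp (Ex c t)| is
      at least 1 / Em. This turns the absolute local errors into relative ones.\<close>
    define Em where "Em = exp ((T * DB)\<^sup>2 / \<beta> + 2 * (T * DB) / \<beta>)"
    have Em: "1 \<le> Em * norm (exp (Ex c t))" if "c \<in> {pi/2, -pi/2}" "t \<in> K" for c t
    proof -
      have 3: "norm (of_real t * D1 f c) \<le> T * DB" "norm (of_real t * D2 f c) \<le> T * DB"
        unfolding norm_mult norm_of_real by (intro mult_mono T that DB norm_ge_zero)+
      have "norm (Ex c t) \<le> norm ((of_real t)\<^sup>2 * (D1 f c)\<^sup>2 / of_real \<beta>) + norm (2 * of_real t * D2 f c / of_real \<beta>)"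
        unfolding Ex_def by (rule norm_triangle_ineq)
      also have "\<dots> = (norm (of_real t * D1 f c))\<^sup>2 / \<beta> + 2 * norm (of_real t * D2 f c) / \<beta>"
        using bt by (simp add: norm_mult norm_divide norm_power power_mult_distrib)
      also have "\<dots> \<le> (T * DB)\<^sup>2 / \<beta> + 2 * (T * DB) / \<beta>"
        using 3 bt by (intro add_mono divide_right_mono power_mono) auto
      finally have "- Re (Ex c t) \<le> (T * DB)\<^sup>2 / \<beta> + 2 * (T * DB) / \<beta>"
        using abs_Re_le_cmod[of "Ex c t"] by linarith
      then have "exp 0 \<le> exp ((T * DB)\<^sup>2 / \<beta> + 2 * (T * DB) / \<beta> + Re (Ex c t))" by (subst exp_le_cancel_iff) linarith
      then show ?thesis by (simp add: Em_def exp_add)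
    qed
    have Em0: "0 < Em" by (simp add: Em_def)
    \<comment> \<open>\<open>Cp\<close> and \<open>Cm\<close> come from the local integrals and 2
      from the remainder, where both factors are bounded by the larger one. The logarithm doubles
      this, whence 2 C in the final estimate.\<close>
    define C where "C = (Cp + Cm + 2) / A0 * Em"
    have C0: "0 \<le> C" using Cp Cm A0 Em0 by (simp add: C_def)
    have small: "\<forall>\<^sub>F n in sequentially. C * real n powr (- q / 2) < 1 / 2"
    proof -
      have "((\<lambda>n. C * real n powr (- q / 2)) \<longlongrightarrow> 0) sequentially" using q by real_asymp
      then show ?thesis by (rule order_tendstoD(2)) simp
    qed
    have "\<forall>\<^sub>F n in sequentially. \<forall>t\<in>K. ?G (2 * C) t n"
      using Cp(2) Cm(2) Rb small eventually_ge_at_top[of 1]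
    proof eventually_elim
      case (elim n)
      show ?case
      proof
      fix t assume t: "t \<in> K"
      define r where "r = real n powr (- q / 2)"
      have n: "real n > 0" using elim by simp
      have Vp: "0 < V n" using bt n by (simp add: V_def)
      \<comment> \<open>The remainder decays like 1 / n, which is at most n^(-q/2) because q \<le>
        1.\<close>
      have inv: "1 / real n \<le> r"
      proof -
        have "1 / real n = real n powr (-1)" using n by (simp add: powr_minus_divide)
        also have "\<dots> \<le> r" unfolding r_def using elim(5) q by (intro powr_mono) auto
        finally show ?thesis .
      qed
      have r0: "0 \<le> r" by (simp add: r_def)
      have U0: "U c t n \<noteq> 0" "norm (U c t n) = exp (real n * Re (of_real t * f c))" for c
        by (simp_all add: U_def mult.assoc)
      have frac: "norm (R t n / U c t n) \<le> V n * (2 * r)"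
        if "norm (U c' t n) \<le> norm (U c t n)" "(c = pi/2 \<and> c' = -pi/2) \<or> (c = -pi/2 \<and> c' = pi/2)" for c c'
      proof -
        have "norm (R t n) \<le> V n / real n * (norm (U (pi/2) t n) + norm (U (-pi/2) t n))" using elim(3) t by blast
        also have "\<dots> \<le> V n / real n * (2 * norm (U c t n))"
        proof (rule mult_left_mono)
          show "norm (U (pi/2) t n) + norm (U (-pi/2) t n) \<le> 2 * norm (U c t n)"
            using that(2,1) by (elim disjE conjE; hypsubst) linarith+
        qed (use Vp in simp)
        finally have "norm (R t n) \<le> V n * (2 * (1 / real n)) * norm (U c t n)" by simp
        then have "norm (R t n / U c t n) \<le> V n * (2 * (1 / real n))"
          using U0(1)[of c] by (simp add: norm_divide divide_le_eq)
        also have "\<dots> \<le> V n * (2 * r)" using inv Vp by (intro mult_left_mono) auto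
        finally show ?thesis .
      qed
      have close: "norm (S / of_real (V n * A0) - exp (Ex c t)) \<le> (C * r) * norm (exp (Ex c t))"
        if c: "c \<in> {pi/2, -pi/2}" and S: "norm (S - of_real (V n * A0) * exp (Ex c t)) \<le> V n * ((Cp + Cm + 2) * r)" for S c
      proof -
        have VA: "V n * A0 > 0" using Vp A0 by simp
        have "S / of_real (V n * A0) - exp (Ex c t) = (S - of_real (V n * A0) * exp (Ex c t)) / of_real (V n * A0)"
          using Vp A0 by (simp add: diff_divide_distrib)
        then have "norm (S / of_real (V n * A0) - exp (Ex c t)) = norm (S - of_real (V n * A0) * exp (Ex c t)) / (V n * A0)"
          using VA by (simp add: norm_divide del: of_real_mult)
        also have "\<dots> \<le> V n * ((Cp + Cm + 2) * r) / (V n * A0)"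
          using S VA by (intro divide_right_mono) auto
        also have "\<dots> = (Cp + Cm + 2) / A0 * r * 1" using Vp by simp
        also have "\<dots> \<le> (Cp + Cm + 2) / A0 * r * (Em * norm (exp (Ex c t)))"
          using Em[OF c t] Cp Cm A0 r0 by (intro mult_left_mono) auto
        finally show ?thesis by (simp add: C_def mult_ac)
      qed
      have J1: "norm (J (pi/2) t n - of_real (V n * A0) * exp (Ex (pi/2) t)) \<le> V n * (Cp * r)"
        and J2: "norm (J (-pi/2) t n - of_real (V n * A0) * exp (Ex (-pi/2) t)) \<le> V n * (Cm * r)"
        using elim(1,2) t unfolding r_def by blast+
      have plus: "norm (S + Q - W) \<le> V n * ((Cp + Cm + 2) * r)"
        if "norm (S - W) \<le> V n * (D * r)" "norm Q \<le> V n * (2 * r)" "D \<le> Cp + Cm" for S Q W :: complex and D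
      proof -
        have "norm (S + Q - W) \<le> norm (S - W) + norm Q" using norm_triangle_ineq[of "S - W" Q] by (simp add: algebra_simps)
        also have "\<dots> \<le> V n * (D * r) + V n * (2 * r)" using that by simp
        also have "\<dots> = V n * ((D + 2) * r)" by (simp add: algebra_simps)
        also have "\<dots> \<le> V n * ((Cp + Cm + 2) * r)" using that(3) Vp r0 by (intro mult_left_mono mult_right_mono) auto
        finally show ?thesis .
      qed
      have Q1: "norm (if pick t then R t n / U (pi/2) t n else 0) \<le> V n * (2 * r)"
      proof (cases "pick t")
        case True
        then have "norm (U (-pi/2) t n) \<le> norm (U (pi/2) t n)" unfolding U0(2) pick_def by (simp add: mult_left_mono)
        then show ?thesis using frac[of "-pi/2" "pi/2"] True by simp
      qed (use Vp r0 in simp)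
      have Q2: "norm (if pick t then 0 else R t n / U (-pi/2) t n) \<le> V n * (2 * r)"
      proof (cases "pick t")
        case False
        then have "norm (U (pi/2) t n) \<le> norm (U (-pi/2) t n)" unfolding U0(2) pick_def by (simp add: mult_left_mono)
        then show ?thesis using frac[of "pi/2" "-pi/2"] False by simp
      qed (use Vp r0 in simp)
      have H1c: "norm (H1 t n - exp (Ex (pi/2) t)) \<le> (C * r) * norm (exp (Ex (pi/2) t))"
        unfolding H1_def by (intro close plus[OF J1 Q1]) (use Cm in auto)
      have H2c: "norm (H2 t n - exp (Ex (-pi/2) t)) \<le> (C * r) * norm (exp (Ex (-pi/2) t))"
        unfolding H2_def by (intro close plus[OF J2 Q2]) (use Cp in auto)
      have sm: "C * r < 1 / 2" using elim(4) by (simp add: r_def)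
      note e1 = exp_add_Ln_quotient[OF H1c sm, folded \<epsilon>1_def] and e2 = exp_add_Ln_quotient[OF H2c sm, folded \<epsilon>2_def]
      have VA: "of_real (V n * A0) \<noteq> (0 :: complex)" "of_real (N2 n) \<noteq> (0 :: complex)" using Vp A0 by (simp_all add: N2_def)
      \<comment> \<open>Whatever \<open>pick\<close> says, exactly one bracket contains
        \<open>R\<close>, divided by the factor it is multiplied with here, so \<open>R\<close>
        reappears once.\<close>
      have "of_real (V n * A0) * (U (pi/2) t n * H1 t n + U (-pi/2) t n * H2 t n) = U (pi/2) t n * J (pi/2) t n + U (-pi/2) t n * J (-pi/2) t n + R t n"
      proof -
        have "of_real (V n * A0) * H1 t n = J (pi/2) t n + (if pick t then R t n / U (pi/2) t n else 0)"
          "of_real (V n * A0) * H2 t n = J (-pi/2) t n + (if pick t then 0 else R t n / U (-pi/2) t n)"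
          unfolding H1_def H2_def using VA(1) by (simp_all del: of_real_mult)
        then have "of_real (V n * A0) * (U (pi/2) t n * H1 t n + U (-pi/2) t n * H2 t n) = U (pi/2) t n * (J (pi/2) t n + (if pick t then R t n / U (pi/2) t n else 0)) + U (-pi/2) t n * (J (-pi/2) t n + (if pick t then 0 else R t n / U (-pi/2) t n))"
          by (metis (no_types, lifting) distrib_left mult.left_commute)
        then show ?thesis using U0(1) by (simp add: distrib_left)
      qed
      also have "\<dots> = I_int \<beta> n (\<lambda>\<theta>. of_real t * f \<theta>) / of_real (N2 n)" by (simp add: R_def)
      finally have "I_int \<beta> n (\<lambda>\<theta>. of_real t * f \<theta>) = of_real (prefactor \<beta> n) * (U (pi/2) t n * H1 t n + U (-pi/2) t n * H2 t n)"
        using VA(2) by (simp add: pre field_simps)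
      then show "?G (2 * C) t n"
        using e1 e2 by (simp add: r_def mult.assoc)
      qed
    qed
    then show ?thesis by blast
  qed
  show ?thesis
    by (rule exI[of _ \<epsilon>1], rule exI[of _ \<epsilon>2], intro allI impI, rule main[unfolded U_def Ex_def])
qed

text \<open>Both claims follow from the uniform expansion, whose error n^(-q/2) is at most
  n^(-\<zeta>) since \<zeta> < q / 2. The first claim is the case of the compact set {1}.\<close>

theorem theorem1p2:
  fixes \<beta> q \<zeta> :: real and f :: "real \<Rightarrow> complex"
  assumes "\<beta> > 0"
    and "f \<in> borel_measurable lebesgue"
    and "\<forall>\<theta>. f (\<theta> + 2 * pi) = f \<theta>"
    and "bounded (range f)"
    and "0 < q" and "q \<le> 1"
    and "C2_holder_near q f (pi/2)"
    and "C2_holder_near q f (-pi/2)"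
    and "sup_Re f + \<beta> * ln (cos (pi/16)) < min (Re (f (pi/2))) (Re (f (-pi/2)))"
    and "0 < \<zeta>" and "\<zeta> < min (1/4) (q/2)"
  shows "(\<exists>\<epsilon>\<^sub>1 \<epsilon>\<^sub>2 :: nat \<Rightarrow> complex.
            (\<lambda>n. norm (\<epsilon>\<^sub>1 n)) \<in> O(\<lambda>n. real n powr (-\<zeta>)) \<and>
            (\<lambda>n. norm (\<epsilon>\<^sub>2 n)) \<in> O(\<lambda>n. real n powr (-\<zeta>)) \<and>
            (\<forall>\<^sub>F n in sequentially.
               I_int \<beta> n f = complex_of_real (prefactor \<beta> n) *
                 (exp (of_nat n * f (pi/2))
                    * exp ((D1 f (pi/2))\<^sup>2 / of_real \<beta> + 2 * D2 f (pi/2) / of_real \<beta> + \<epsilon>\<^sub>1 n)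
                + exp (of_nat n * f (-pi/2))
                    * exp ((D1 f (-pi/2))\<^sup>2 / of_real \<beta> + 2 * D2 f (-pi/2) / of_real \<beta> + \<epsilon>\<^sub>2 n))))
       \<and> ((\<forall>\<theta>. Re (f \<theta>) = 0) \<longrightarrow>
          (\<exists>\<epsilon>\<^sub>1 \<epsilon>\<^sub>2 :: real \<Rightarrow> nat \<Rightarrow> complex. \<forall>K. compact K \<longrightarrow>
            (\<exists>C. \<forall>\<^sub>F n in sequentially. \<forall>t\<in>K.
               norm (\<epsilon>\<^sub>1 t n) \<le> C * real n powr (-\<zeta>) \<and>
               norm (\<epsilon>\<^sub>2 t n) \<le> C * real n powr (-\<zeta>) \<and>
               I_int \<beta> n (\<lambda>\<theta>. of_real t * f \<theta>) = complex_of_real (prefactor \<beta> n) *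
                 (exp (of_nat n * of_real t * f (pi/2))
                    * exp ((of_real t)\<^sup>2 * (D1 f (pi/2))\<^sup>2 / of_real \<beta>
                           + 2 * of_real t * D2 f (pi/2) / of_real \<beta> + \<epsilon>\<^sub>1 t n)
                + exp (of_nat n * of_real t * f (-pi/2))
                    * exp ((of_real t)\<^sup>2 * (D1 f (-pi/2))\<^sup>2 / of_real \<beta>
                           + 2 * of_real t * D2 f (-pi/2) / of_real \<beta> + \<epsilon>\<^sub>2 t n)))))"
proof -
  note bt = assms(1) and q = assms(5,6)
  obtain e1 e2 :: "real \<Rightarrow> nat \<Rightarrow> complex" where e: "\<And>K. compact K \<Longrightarrow>
    (\<exists>C. \<forall>\<^sub>F n in sequentially. \<forall>t\<in>K.
      norm (e1 t n) \<le> C * real n powr (- q / 2) \<and>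
      norm (e2 t n) \<le> C * real n powr (- q / 2) \<and>
      expansion \<beta> f t n (e1 t n) (e2 t n))"
    using I_int_asymp_uniform[OF bt assms(2,4) q assms(7,8)] by blast
  let ?G = "\<lambda>p C t n. norm (e1 t n) \<le> C * real n powr p \<and> norm (e2 t n) \<le> C * real n powr p \<and> expansion \<beta> f t n (e1 t n) (e2 t n)"
  \<comment> \<open>The constant \<open>C\<close> comes without a sign, so its absolute value is
    used when the power of n is enlarged.\<close>
  have le: "C * real n powr (- q / 2) \<le> \<bar>C\<bar> * real n powr (- \<zeta>)" if "n \<ge> 1" for C and n :: nat
  proof -
    have "real n powr (- q / 2) \<le> real n powr (- \<zeta>)" using that assms(11) by (intro powr_mono) auto
    then show ?thesis by (intro mult_mono) auto
  qed
  have unif: "\<exists>C. \<forall>\<^sub>F n in sequentially. \<forall>t\<in>K. ?G (- \<zeta>) C t n"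
    if "compact K" for K
  proof -
    from e[OF that] obtain C where C: "\<forall>\<^sub>F n in sequentially. \<forall>t\<in>K. ?G (- q / 2) C t n" by blast
    show ?thesis
      by (rule exI[of _ "\<bar>C\<bar>"], rule eventually_mono[OF eventually_conj[OF C eventually_ge_at_top[of 1]]])
        (use le[of _ C] in \<open>blast intro: order_trans\<close>)
  qed
  obtain C where C: "\<forall>\<^sub>F n in sequentially. \<forall>t\<in>{1}. ?G (- \<zeta>) C t n"
    using unif[OF compact_sing[of "1::real"]] by blast
  have O1: "(\<lambda>n. norm (e1 1 n)) \<in> O(\<lambda>n. real n powr (-\<zeta>))" "(\<lambda>n. norm (e2 1 n)) \<in> O(\<lambda>n. real n powr (-\<zeta>))"
    by (rule bigoI[of _ C], rule eventually_mono[OF C], simp)+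
  have "\<forall>\<^sub>F n in sequentially. expansion \<beta> f 1 n (e1 1 n) (e2 1 n)"
    by (rule eventually_mono[OF C]) simp
  note O1 = O1 this[simplified]
  show ?thesis
  proof (rule conjI, goal_cases)
    case 1
    show ?case by (rule exI[of _ "e1 1"], rule exI[of _ "e2 1"], intro conjI) (use O1 in simp_all)
  next
    case 2
    show ?case by (rule impI, rule exI[of _ e1], rule exI[of _ e2], intro allI impI, rule unif)
  qed
qed

end
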